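(* Let $\omega\in S_n$ be vexillary, and suppose $p_1(x_1,\dots,x_n)$ and $p_2(x_1,\dots,x_n)$ are monomials with nonzero coefficient in $\mathfrak{G}_\omega$ such that $p_1\mid p_2$. Then every monomial $q(x_1,\dots,x_n)$ with $p_1\mid q$ and $q\mid p_2$ also has nonzero coefficient in $\mathfrak{G}_\omega$.
   Context: Permutations are in one-line notation; $\omega$ is vexillary if it is $2143$-avoiding. The Grothendieck polynomial $\mathfrak{G}_\omega\in\mathbb{Z}[x_1,\dots,x_n]$ is defined by $\mathfrak{G}_{\omega_0}=x_1^{n-1}x_2^{n-2}\cdots x_{n-1}$ for $\omega_0=n\,(n-1)\cdots1$ and $\mathfrak{G}_{\omega s_i}=\pi_i\mathfrak{G}_\omega$ whenever $\omega s_i$ has one fewer inversion than $\omega$, where $s_i=(i,i+1)$, $\pi_i(f)=\partial_i(f-x_{i+1}f)$ and $\partial_i(f)=(f-s_if)/(x_i-x_{i+1})$ ($s_i$ swapping $x_i,x_{i+1}$). *)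

theory Defs
  imports "HOL-Library.Poly_Mapping" "HOL-Combinatorics.Permutations"
begin

section \<open>Integer polynomials in the variables \<open>x\<^sub>1, x\<^sub>2, \<dots>\<close>\<close>

text \<open>
  A polynomial maps each exponent vector to its coefficient. The ambient ring has one variable
  for every natural number; \<open>\<int>[x\<^sub>1, \<dots>, x\<^sub>n]\<close> is the subring of polynomials whose
  exponent vectors are supported on \<open>{1..n}\<close>.
  Pitfall: the order of the library on exponent vectors is lexicographic, so \<open>\<le>\<close> on them
  is not divisibility of monomials.
\<close>

type_synonym expvec = "nat \<Rightarrow>\<^sub>0 nat"
type_synonym ipoly = "expvec \<Rightarrow>\<^sub>0 int"

definition monomial :: "expvec \<Rightarrow> ipoly"
  where "monomial m = Poly_Mapping.single m 1"

abbreviation coefficient :: "ipoly \<Rightarrow> expvec \<Rightarrow> int"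
  where "coefficient f m \<equiv> Poly_Mapping.lookup f m"

definition xvar :: "nat \<Rightarrow> ipoly"
  where "xvar i = monomial (Poly_Mapping.single i 1)"

text \<open>
  \<open>Poly_Mapping.map_key g f\<close> is \<open>f \<circ> g\<close> (for injective \<open>g\<close>), so the
  coefficient of \<open>m\<close> in \<open>swap_vars i f\<close> is the coefficient in \<open>f\<close> of \<open>m\<close> with
  its entries \<open>i\<close> and \<open>i + 1\<close> interchanged.
\<close>

definition swap_vars :: "nat \<Rightarrow> ipoly \<Rightarrow> ipoly"
  where "swap_vars i f = Poly_Mapping.map_key (Poly_Mapping.map_key (transpose i (Suc i))) f"

text \<open>The quotient exists and is unique, see \<open>divided_difference_eq\<close> below.\<close>

definition divided_difference :: "nat \<Rightarrow> ipoly \<Rightarrow> ipoly"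
  where "divided_difference i f = (THE g. (xvar i - xvar (Suc i)) * g = f - swap_vars i f)"

definition isobaric_dd :: "nat \<Rightarrow> ipoly \<Rightarrow> ipoly"
  where "isobaric_dd i f = divided_difference i (f - xvar (Suc i) * f)"


section \<open>Permutations and Grothendieck polynomials\<close>

text \<open>
  An element of \<open>S\<^sub>n\<close> is a function \<open>w\<close> with \<open>w permutes {1..n}\<close>; its one-line notation is
  \<open>w 1, \<dots>, w n\<close>, and \<open>w s\<^sub>i\<close> is \<open>w \<circ> transpose i (Suc i)\<close>.
\<close>

definition vexillary :: "nat \<Rightarrow> (nat \<Rightarrow> nat) \<Rightarrow> bool"
  where "vexillary n w \<longleftrightarrow>
    \<not> (\<exists>a b c d. 1 \<le> a \<and> a < b \<and> b < c \<and> c < d \<and> d \<le> n \<and>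
        w b < w a \<and> w a < w d \<and> w d < w c)"

definition inversion_set :: "nat \<Rightarrow> (nat \<Rightarrow> nat) \<Rightarrow> (nat \<times> nat) set"
  where "inversion_set n w = {(a, b). 1 \<le> a \<and> a < b \<and> b \<le> n \<and> w b < w a}"

definition inversions :: "nat \<Rightarrow> (nat \<Rightarrow> nat) \<Rightarrow> nat"
  where "inversions n w = card (inversion_set n w)"

definition longest_perm :: "nat \<Rightarrow> nat \<Rightarrow> nat"
  where "longest_perm n a = (if a \<in> {1..n} then n + 1 - a else a)"

text \<open>
  \<open>is_grothendieck n w f\<close>: \<open>f\<close> is obtained for \<open>w\<close> along some chain of the
  recursion. That the result does not depend on the chain is \<open>grothendieck_unique_existence\<close> below.
\<close>

inductive is_grothendieck :: "nat \<Rightarrow> (nat \<Rightarrow> nat) \<Rightarrow> ipoly \<Rightarrow> bool" for n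
  where
    longest: "is_grothendieck n (longest_perm n) (\<Prod>i = 1..n. xvar i ^ (n - i))"
  | step: "is_grothendieck n w f \<Longrightarrow> 1 \<le> i \<Longrightarrow> i < n \<Longrightarrow>
      Suc (inversions n (w \<circ> transpose i (Suc i))) = inversions n w \<Longrightarrow>
      is_grothendieck n (w \<circ> transpose i (Suc i)) (isobaric_dd i f)"

definition grothendieck :: "nat \<Rightarrow> (nat \<Rightarrow> nat) \<Rightarrow> ipoly"
  where "grothendieck n w = (THE f. is_grothendieck n w f)"


section \<open>The operators are well defined\<close>

lemma ipoly_induct [case_names zero single add]:
  fixes f :: ipoly
  assumes "P 0" and "\<And>m c. P (Poly_Mapping.single m c)"
    and "\<And>f g. P f \<Longrightarrow> P g \<Longrightarrow> P (f + g)"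
  shows "P f"
proof (induction f rule: update_induct)
  case const
  show ?case by (rule assms(1))
next
  case (update f a b)
  have "Poly_Mapping.update a b f = f + Poly_Mapping.single a b"
    using update(1)
    by (intro poly_mapping_eqI) (auto simp: lookup_update lookup_add lookup_single in_keys_iff when_def)
  then show ?case using assms(2,3) update(3) by simp
qed

abbreviation swap_exp :: "nat \<Rightarrow> expvec \<Rightarrow> expvec"
  where "swap_exp i \<equiv> Poly_Mapping.map_key (transpose i (Suc i))"

lemma inj_transpose [simp]: "inj (transpose a b)"
  by (metis bij_betw_imp_inj_on bij_swap_iff bij_id transpose_involutory involuntory_imp_bij)

lemma swap_exp_involutory [simp]: "swap_exp i (swap_exp i m) = m"
  by (simp add: map_key_compose map_key_id transpose_comp_involutory id_def)

lemma inj_swap_exp [simp]: "inj (swap_exp i)"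
  by (metis injI swap_exp_involutory)

lemma swap_vars_single [simp]:
  "swap_vars i (Poly_Mapping.single m c) = Poly_Mapping.single (swap_exp i m) c"
proof -
  have "swap_vars i (Poly_Mapping.single (swap_exp i (swap_exp i m)) c)
      = Poly_Mapping.single (swap_exp i m) c"
    unfolding swap_vars_def by (rule map_key_single) simp
  then show ?thesis by simp
qed

lemma swap_vars_zero [simp]: "swap_vars i 0 = 0"
  by (simp add: swap_vars_def)

lemma swap_vars_add [simp]: "swap_vars i (f + g) = swap_vars i f + swap_vars i g"
  by (simp add: swap_vars_def map_key_plus)

lemma swap_vars_diff [simp]: "swap_vars i (f - g) = swap_vars i f - swap_vars i g"
  by (metis add_diff_cancel_right' diff_add_cancel swap_vars_add)

lemma swap_vars_one [simp]: "swap_vars i 1 = 1"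
  using swap_vars_single[of i 0 1] by simp

lemma swap_vars_mult [simp]: "swap_vars i (f * g) = swap_vars i f * swap_vars i g"
proof (induction f rule: ipoly_induct)
  case (single m c)
  show ?case
  proof (induction g rule: ipoly_induct)
    case (single m' c')
    show ?case by (simp add: mult_single map_key_plus)
  qed (simp_all add: algebra_simps)
qed (simp_all add: algebra_simps)

lemma swap_vars_involutory [simp]: "swap_vars i (swap_vars i f) = f"
  by (induction f rule: ipoly_induct) simp_all

lemma swap_exp_single: "swap_exp i (Poly_Mapping.single j c) = Poly_Mapping.single (transpose i (Suc i) j) c"
  using map_key_single[OF inj_transpose, of i "Suc i" "transpose i (Suc i) j" c] by simp

lemma swap_vars_xvar [simp]: "swap_vars i (xvar j) = xvar (transpose i (Suc i) j)"
  by (simp add: xvar_def monomial_def swap_exp_single)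

lemma xvar_eq_iff [simp]: "xvar i = xvar j \<longleftrightarrow> i = j"
proof
  assume "xvar i = xvar j"
  then have "coefficient (xvar i) (Poly_Mapping.single i 1) = coefficient (xvar j) (Poly_Mapping.single i 1)" by simp
  then have "Poly_Mapping.single j (1::nat) = Poly_Mapping.single i 1"
    by (simp add: xvar_def monomial_def lookup_single when_def split: if_splits)
  then show "i = j"
    by (metis lookup_single_eq lookup_single_not_eq one_neq_zero)
qed simp

lemma monomial_induct [case_names one var]:
  assumes "P 1" and "\<And>j f. P f \<Longrightarrow> P (xvar j * f)"
  shows "P (Poly_Mapping.single m 1 :: ipoly)"
proof -
  have pow: "P f \<Longrightarrow> P (Poly_Mapping.single (Poly_Mapping.single j k) 1 * f)" for j k f
  proof (induction k)
    case (Suc k)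
    have "Poly_Mapping.single (Poly_Mapping.single j (Suc k)) (1::int)
        = xvar j * Poly_Mapping.single (Poly_Mapping.single j k) 1"
      by (simp add: xvar_def monomial_def mult_single single_add[symmetric])
    then show ?case using Suc assms(2) by (simp add: mult.assoc)
  qed simp
  show ?thesis
  proof (induction m rule: update_induct)
    case const
    then show ?case using assms(1) by simp
  next
    case (update m a b)
    have "Poly_Mapping.update a b m = Poly_Mapping.single a b + m"
      using update(1)
      by (intro poly_mapping_eqI) (auto simp: lookup_update lookup_add lookup_single in_keys_iff when_def)
    then show ?case using pow[OF update(3), of a b] by (simp add: mult_single)
  qed
qed

lemma diff_dvd_diff_swap_vars: "xvar i - xvar (Suc i) dvd f - swap_vars i f"
proof (induction f rule: ipoly_induct)
  case (single m c)
  have "xvar i - xvar (Suc i) dvd Poly_Mapping.single m 1 - swap_vars i (Poly_Mapping.single m 1)"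
  proof (induction m rule: monomial_induct)
    case (var j f)
    have "xvar i - xvar (Suc i) dvd xvar j - xvar (transpose i (Suc i) j)"
      by (auto simp: transpose_def) (metis dvd_minus_iff dvd_refl minus_diff_eq)
    moreover have "xvar j * f - swap_vars i (xvar j * f)
      = xvar j * (f - swap_vars i f) + (xvar j - xvar (transpose i (Suc i) j)) * swap_vars i f"
      by (simp add: algebra_simps)
    ultimately show ?case using var by (metis dvd_add dvd_mult dvd_mult2)
  qed simp
  moreover have "Poly_Mapping.single m c - swap_vars i (Poly_Mapping.single m c)
    = Poly_Mapping.single 0 c * (Poly_Mapping.single m 1 - swap_vars i (Poly_Mapping.single m 1))"
    by (simp add: right_diff_distrib mult_single)
  ultimately show ?case by (metis dvd_mult)
next
  case (add f g)
  have "(f + g) - swap_vars i (f + g) = (f - swap_vars i f) + (g - swap_vars i g)" by simp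
  with add show ?case by (metis dvd_add)
qed simp

lemma divided_difference_eq:
  "(xvar i - xvar (Suc i)) * divided_difference i f = f - swap_vars i f"
proof -
  obtain g where g: "(xvar i - xvar (Suc i)) * g = f - swap_vars i f"
    using diff_dvd_diff_swap_vars by (metis dvdE)
  show ?thesis
    unfolding divided_difference_def
  proof (rule theI[of "\<lambda>g. (xvar i - xvar (Suc i)) * g = f - swap_vars i f" g])
    show "(xvar i - xvar (Suc i)) * g = f - swap_vars i f" by (rule g)
  next
    fix h assume "(xvar i - xvar (Suc i)) * h = f - swap_vars i f"
    then have "(xvar i - xvar (Suc i)) * h = (xvar i - xvar (Suc i)) * g" using g by (rule trans[OF _ sym])
    then show "h = g" by simp
  qed
qed

lemma isobaric_dd_eq:
  "(xvar i - xvar (Suc i)) * isobaric_dd i f = (1 - xvar (Suc i)) * f - (1 - xvar i) * swap_vars i f"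
  unfolding isobaric_dd_def divided_difference_eq by (simp add: algebra_simps)


section \<open>Grothendieck polynomials are well defined\<close>


lemma isobaric_dd_eqI:
  assumes "(xvar i - xvar (Suc i)) * g = (1 - xvar (Suc i)) * f - (1 - xvar i) * swap_vars i f"
  shows "isobaric_dd i f = g"
  using assms isobaric_dd_eq[of i f] by (metis xvar_eq_iff eq_iff_diff_eq_0 mult_left_cancel n_not_Suc_n)

lemma swap_vars_isobaric_dd [simp]: "swap_vars i (isobaric_dd i f) = isobaric_dd i f"
proof (rule isobaric_dd_eqI[symmetric])
  have "swap_vars i ((xvar i - xvar (Suc i)) * isobaric_dd i f)
      = swap_vars i ((1 - xvar (Suc i)) * f - (1 - xvar i) * swap_vars i f)"
    by (simp only: isobaric_dd_eq)
  then have "(xvar (Suc i) - xvar i) * swap_vars i (isobaric_dd i f)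
      = (1 - xvar i) * swap_vars i f - (1 - xvar (Suc i)) * f"
    by simp
  then show "(xvar i - xvar (Suc i)) * swap_vars i (isobaric_dd i f)
      = (1 - xvar (Suc i)) * f - (1 - xvar i) * swap_vars i f"
    by (simp add: algebra_simps)
qed

lemma swap_vars_commute:
  assumes "Suc i < j"
  shows "swap_vars i (swap_vars j f) = swap_vars j (swap_vars i f)"
proof -
  have *: "transpose j (Suc j) \<circ> transpose i (Suc i) = transpose i (Suc i) \<circ> transpose j (Suc j)"
    using assms by (auto simp: fun_eq_iff transpose_def)
  show ?thesis
    by (induction f rule: ipoly_induct) (simp_all add: map_key_compose *)
qed

lemma transpose_braid:
  "transpose i (Suc i) \<circ> transpose (Suc i) (Suc (Suc i)) \<circ> transpose i (Suc i)
    = transpose (Suc i) (Suc (Suc i)) \<circ> transpose i (Suc i) \<circ> transpose (Suc i) (Suc (Suc i))"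
  by (auto simp: fun_eq_iff transpose_def)

lemma swap_vars_braid:
  "swap_vars i (swap_vars (Suc i) (swap_vars i f))
    = swap_vars (Suc i) (swap_vars i (swap_vars (Suc i) f))"
  by (induction f rule: ipoly_induct)
    (simp_all add: map_key_compose inj_compose transpose_braid flip: comp_assoc)

lemma isobaric_dd_commute:
  assumes "Suc i < j"
  shows "isobaric_dd i (isobaric_dd j f) = isobaric_dd j (isobaric_dd i f)"
proof -
  let ?a = "xvar i" and ?b = "xvar (Suc i)" and ?c = "xvar j" and ?d = "xvar (Suc j)"
  have tr [simp]: "transpose i (Suc i) j = j" "transpose i (Suc i) (Suc j) = Suc j"
    "transpose j (Suc j) i = i" "transpose j (Suc j) (Suc i) = Suc i"
    using assms by (auto simp: transpose_def)
  define g h where "g = isobaric_dd i f" and "h = isobaric_dd j f"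
  have g: "(?a - ?b) * g = (1 - ?b) * f - (1 - ?a) * swap_vars i f"
    and h: "(?c - ?d) * h = (1 - ?d) * f - (1 - ?c) * swap_vars j f"
    by (simp_all add: g_def h_def isobaric_dd_eq)
  have tg: "(?a - ?b) * swap_vars j g = (1 - ?b) * swap_vars j f - (1 - ?a) * swap_vars j (swap_vars i f)"
    using arg_cong[OF g, of "swap_vars j"] by simp
  have sh: "(?c - ?d) * swap_vars i h = (1 - ?d) * swap_vars i f - (1 - ?c) * swap_vars j (swap_vars i f)"
    using arg_cong[OF h, of "swap_vars i"] by (simp add: swap_vars_commute[OF assms])
  have "(?a - ?b) * (?c - ?d) * isobaric_dd i h
      = (?c - ?d) * ((?a - ?b) * isobaric_dd i h)"
    by (simp only: ac_simps)
  also have "\<dots> = (1 - ?b) * ((?c - ?d) * h) - (1 - ?a) * ((?c - ?d) * swap_vars i h)"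
    unfolding isobaric_dd_eq by (simp add: algebra_simps)
  also have "\<dots> = (1 - ?d) * ((?a - ?b) * g) - (1 - ?c) * ((?a - ?b) * swap_vars j g)"
    unfolding g h tg sh by (simp add: algebra_simps)
  also have "\<dots> = (?a - ?b) * ((?c - ?d) * isobaric_dd j g)"
    unfolding isobaric_dd_eq by (simp add: algebra_simps)
  also have "\<dots> = (?a - ?b) * (?c - ?d) * isobaric_dd j g"
    by (simp only: ac_simps)
  finally show ?thesis unfolding g_def h_def by simp
qed

lemma isobaric_dd_braid:
  "isobaric_dd i (isobaric_dd (Suc i) (isobaric_dd i f))
    = isobaric_dd (Suc i) (isobaric_dd i (isobaric_dd (Suc i) f))"
proof -
  let ?a = "xvar i" and ?b = "xvar (Suc i)" and ?c = "xvar (Suc (Suc i))"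
  let ?s = "swap_vars i" and ?t = "swap_vars (Suc i)"
  let ?p = "isobaric_dd i" and ?q = "isobaric_dd (Suc i)"
  let ?V = "(?a - ?b) * (?a - ?c) * (?b - ?c)"
  have tr [simp]: "transpose i (Suc i) (Suc (Suc i)) = Suc (Suc i)"
    "transpose (Suc i) (Suc (Suc i)) i = i"
    by (auto simp: transpose_def)
  define R where "R = (1 - ?c)^2 * ((1 - ?b) * f - (1 - ?a) * ?s f)
      - (1 - ?b)^2 * ((1 - ?c) * ?t f - (1 - ?a) * ?t (?s f))
      + (1 - ?a)^2 * ((1 - ?c) * ?s (?t f) - (1 - ?b) * ?s (?t (?s f)))"
  have "?V * ?p (?q (?p f)) = R"
  proof -
    define g where "g = ?p f"
    define h where "h = ?q g"
    have g: "(?a - ?b) * g = (1 - ?b) * f - (1 - ?a) * ?s f"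
      unfolding g_def by (rule isobaric_dd_eq)
    have tg: "(?a - ?c) * ?t g = (1 - ?c) * ?t f - (1 - ?a) * ?t (?s f)"
      using arg_cong[OF g, of ?t] by simp
    have stg: "(?b - ?c) * ?s (?t g) = (1 - ?c) * ?s (?t f) - (1 - ?b) * ?s (?t (?s f))"
      using arg_cong[OF tg, of ?s] by simp
    have h: "(?b - ?c) * h = (1 - ?c) * g - (1 - ?b) * ?t g"
      unfolding h_def by (rule isobaric_dd_eq)
    have sh: "(?a - ?c) * ?s h = (1 - ?c) * g - (1 - ?a) * ?s (?t g)"
      using arg_cong[OF h, of ?s] by (simp add: g_def)
    have "?V * ?p h = (?a - ?c) * (?b - ?c) * ((?a - ?b) * ?p h)"
      by (simp only: ac_simps)
    also have "\<dots> = (1 - ?b) * (?a - ?c) * ((?b - ?c) * h) - (1 - ?a) * (?b - ?c) * ((?a - ?c) * ?s h)"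
      unfolding isobaric_dd_eq by (simp add: algebra_simps)
    also have "\<dots> = (1 - ?c)^2 * ((?a - ?b) * g) - (1 - ?b)^2 * ((?a - ?c) * ?t g)
        + (1 - ?a)^2 * ((?b - ?c) * ?s (?t g))"
      unfolding h sh by (simp add: algebra_simps power2_eq_square)
    also have "\<dots> = R"
      unfolding g tg stg R_def by (rule refl)
    finally show ?thesis unfolding h_def g_def .
  qed
  moreover have "?V * ?q (?p (?q f)) = R"
  proof -
    define g where "g = ?q f"
    define h where "h = ?p g"
    have g: "(?b - ?c) * g = (1 - ?c) * f - (1 - ?b) * ?t f"
      unfolding g_def by (rule isobaric_dd_eq)
    have sg: "(?a - ?c) * ?s g = (1 - ?c) * ?s f - (1 - ?a) * ?s (?t f)"
      using arg_cong[OF g, of ?s] by simp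
    have tsg: "(?a - ?b) * ?t (?s g) = (1 - ?b) * ?t (?s f) - (1 - ?a) * ?s (?t (?s f))"
      using arg_cong[OF sg, of ?t] by (simp add: swap_vars_braid)
    have h: "(?a - ?b) * h = (1 - ?b) * g - (1 - ?a) * ?s g"
      unfolding h_def by (rule isobaric_dd_eq)
    have th: "(?a - ?c) * ?t h = (1 - ?c) * g - (1 - ?a) * ?t (?s g)"
      using arg_cong[OF h, of ?t] by (simp add: g_def)
    have "?V * ?q h = (?a - ?c) * (?a - ?b) * ((?b - ?c) * ?q h)"
      by (simp only: ac_simps)
    also have "\<dots> = (1 - ?c) * (?a - ?c) * ((?a - ?b) * h) - (1 - ?b) * (?a - ?b) * ((?a - ?c) * ?t h)"
      unfolding isobaric_dd_eq by (simp add: algebra_simps)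
    also have "\<dots> = (1 - ?c) * (1 - ?b) * ((?b - ?c) * g) - (1 - ?c) * (1 - ?a) * ((?a - ?c) * ?s g)
        + (1 - ?b) * (1 - ?a) * ((?a - ?b) * ?t (?s g))"
      unfolding h th by (simp add: algebra_simps)
    also have "\<dots> = R"
      unfolding g sg tsg R_def by (simp add: algebra_simps power2_eq_square)
    finally show ?thesis unfolding h_def g_def .
  qed
  moreover have "?V \<noteq> 0" by simp
  ultimately show ?thesis by (metis mult_left_cancel)
qed

lemma finite_inversion_set [simp]: "finite (inversion_set n w)"
  by (rule finite_subset[of _ "{1..n} \<times> {1..n}"]) (auto simp: inversion_set_def)

lemma inversions_le: "inversions n w \<le> n * n"
  unfolding inversions_def
  using card_mono[of "{1..n} \<times> {1..n}" "inversion_set n w"]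
  by (fastforce simp: inversion_set_def)

lemma inversions_ascent:
  assumes "1 \<le> i" "i < n" "w i < w (Suc i)"
  shows "inversions n (w \<circ> transpose i (Suc i)) = Suc (inversions n w)"
proof -
  let ?s = "transpose i (Suc i)"
  let ?\<phi> = "\<lambda>(a, b). (?s a, ?s b)"
  have eq: "inversion_set n (w \<circ> ?s) = insert (i, Suc i) (?\<phi> ` inversion_set n w)"
  proof (intro set_eqI iffI)
    fix p assume p: "p \<in> inversion_set n (w \<circ> ?s)"
    show "p \<in> insert (i, Suc i) (?\<phi> ` inversion_set n w)"
    proof (cases "p = (i, Suc i)")
      case False
      with p have "?\<phi> p \<in> inversion_set n w"
        using assms by (auto simp: inversion_set_def transpose_def split: if_splits)
      then have "?\<phi> (?\<phi> p) \<in> ?\<phi> ` inversion_set n w" by blast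
      then show ?thesis by (simp add: case_prod_beta)
    qed simp
  next
    fix p assume "p \<in> insert (i, Suc i) (?\<phi> ` inversion_set n w)"
    then show "p \<in> inversion_set n (w \<circ> ?s)"
      using assms by (auto simp: inversion_set_def transpose_def split: if_splits)
  qed
  have "inj ?\<phi>" by (auto simp: inj_def dest: injD[OF inj_transpose])
  then have "card (?\<phi> ` inversion_set n w) = inversions n w"
    unfolding inversions_def by (meson card_image inj_on_subset subset_UNIV)
  moreover have "(i, Suc i) \<notin> ?\<phi> ` inversion_set n w"
    using assms by (auto simp: inversion_set_def transpose_def split: if_splits)
  ultimately show ?thesis
    unfolding inversions_def eq by simp
qed

lemma comp_transpose_twice [simp]: "w \<circ> transpose a b \<circ> transpose a b = w"
  by (simp add: comp_assoc)

lemma permutes_transpose: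
  assumes "w permutes {1..n}" "1 \<le> i" "i < n"
  shows "(w \<circ> transpose i (Suc i)) permutes {1..n}"
  using assms by (intro permutes_compose permutes_swap_id) auto

lemma inversions_transpose_iff:
  assumes "w permutes {1..n}" "1 \<le> i" "i < n"
  shows "Suc (inversions n w) = inversions n (w \<circ> transpose i (Suc i)) \<longleftrightarrow> w i < w (Suc i)"
proof (cases "w i < w (Suc i)")
  case False
  have "w i \<noteq> w (Suc i)" using permutes_inj[OF assms(1)] by (metis injD n_not_Suc_n)
  with False show ?thesis
    using inversions_ascent[of i n "w \<circ> transpose i (Suc i)"] assms by simp
qed (use assms inversions_ascent in simp)

lemma is_grothendieck_permutes:
  "is_grothendieck n w f \<Longrightarrow> w permutes {1..n}"
proof (induction rule: is_grothendieck.induct)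
  case longest
  show ?case
    by (rule bij_imp_permutes, rule bij_betw_byWitness[of _ "longest_perm n"])
      (auto simp: longest_perm_def)
next
  case (step w f i)
  then show ?case using permutes_transpose by blast
qed

lemma no_ascent_imp_longest:
  assumes "w permutes {1..n}" and "\<And>i. 1 \<le> i \<Longrightarrow> i < n \<Longrightarrow> \<not> w i < w (Suc i)"
  shows "w = longest_perm n"
proof
  have step: "w (Suc i) < w i" if "1 \<le> i" "i < n" for i
    using assms(2)[OF that] permutes_inj[OF assms(1)]
    by (metis injD linorder_neqE_nat n_not_Suc_n)
  have up: "w (1 + k) + k \<le> n" if "1 + k \<le> n" for k
    using that
  proof (induction k)
    case 0
    then show ?case using permutes_in_image[OF assms(1), of 1] by auto
  next
    case (Suc k)
    then show ?case using step[of "1 + k"] by simp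
  qed
  have down: "k < w (n - k)" if "k < n" for k
    using that
  proof (induction k)
    case 0
    then show ?case using permutes_in_image[OF assms(1), of n] by auto
  next
    case (Suc k)
    then show ?case using step[of "n - Suc k"] Suc_diff_Suc[of k n] by fastforce
  qed
  fix a
  show "w a = longest_perm n a"
  proof (cases "a \<in> {1..n}")
    case True
    then show ?thesis using up[of "a - 1"] down[of "n - a"] by (auto simp: longest_perm_def)
  next
    case False
    then show ?thesis using permutes_not_in[OF assms(1) False] by (auto simp: longest_perm_def)
  qed
qed

lemma is_grothendieck_ascent:
  assumes "is_grothendieck n (w \<circ> transpose i (Suc i)) f"
    and "1 \<le> i" "i < n" "w i < w (Suc i)"
  shows "is_grothendieck n w (isobaric_dd i f)"
  using is_grothendieck.step[OF assms(1-3)] inversions_ascent[OF assms(2-4)] by simp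

lemma is_grothendieck_exists:
  "w permutes {1..n} \<Longrightarrow> \<exists>f. is_grothendieck n w f"
proof (induction "n * n - inversions n w" arbitrary: w rule: less_induct)
  case less
  show ?case
  proof (cases "\<exists>i. 1 \<le> i \<and> i < n \<and> w i < w (Suc i)")
    case True
    then obtain i where i: "1 \<le> i" "i < n" "w i < w (Suc i)" by blast
    have "n * n - inversions n (w \<circ> transpose i (Suc i)) < n * n - inversions n w"
      using inversions_ascent[of i n w, OF i] inversions_le[of n "w \<circ> transpose i (Suc i)"] by simp
    then show ?thesis
      using less(1) permutes_transpose[OF less(2) i(1,2)] is_grothendieck_ascent[OF _ i] by blast
  next
    case False
    then show ?thesis
      using no_ascent_imp_longest[OF less(2)] is_grothendieck.longest by blast
  qed
qed

lemma is_grothendieck_cases: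
  assumes "is_grothendieck n w f"
  obtains "w = longest_perm n" "f = (\<Prod>i = 1..n. xvar i ^ (n - i))"
  | i g where "1 \<le> i" "i < n" "w i < w (Suc i)"
      "is_grothendieck n (w \<circ> transpose i (Suc i)) g" "f = isobaric_dd i g"
  using assms
proof cases
  case (step u g i)
  have u: "u = w \<circ> transpose i (Suc i)" using step(1) by simp
  have "w i < w (Suc i)"
    using inversions_transpose_iff[OF is_grothendieck_permutes[OF assms] step(4,5)] step(6)
    unfolding step(1)[symmetric] u by simp
  moreover have "is_grothendieck n (w \<circ> transpose i (Suc i)) g" using step(3) u by simp
  ultimately show ?thesis using that(2) step(2,4,5) by blast
qed (use that in blast)

lemma is_grothendieck_unique:
  "is_grothendieck n w f \<Longrightarrow> is_grothendieck n w g \<Longrightarrow> f = g"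
proof (induction "n * n - inversions n w" arbitrary: w f g rule: less_induct)
  case less
  let ?s = "\<lambda>i. transpose i (Suc i)"
  have w: "w permutes {1..n}" using is_grothendieck_permutes less(2) by blast
  have IH: "f' = g'" if "1 \<le> i" "i < n" "w i < w (Suc i)"
    "is_grothendieck n (w \<circ> ?s i) f'" "is_grothendieck n (w \<circ> ?s i) g'" for i f' g'
  proof -
    have "n * n - inversions n (w \<circ> ?s i) < n * n - inversions n w"
      using inversions_ascent[of i n w, OF that(1-3)] inversions_le[of n "w \<circ> ?s i"] by simp
    then show ?thesis using less(1) that(4,5) by blast
  qed
  have no_longest: False if "w = longest_perm n" "1 \<le> i" "i < n" "w i < w (Suc i)" for i
    using that by (auto simp: longest_perm_def)
  have diamond: "isobaric_dd i f' = isobaric_dd j g'"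
    if "i < j" and i: "1 \<le> i" "i < n" "w i < w (Suc i)" "is_grothendieck n (w \<circ> ?s i) f'"
      and j: "1 \<le> j" "j < n" "w j < w (Suc j)" "is_grothendieck n (w \<circ> ?s j) g'" for i j f' g'
  proof (cases "j = Suc i")
    case False
    with \<open>i < j\<close> have ij: "Suc i < j" by simp
    have comm: "w \<circ> ?s i \<circ> ?s j = w \<circ> ?s j \<circ> ?s i"
      using ij by (auto simp: fun_eq_iff transpose_def)
    obtain h where h: "is_grothendieck n (w \<circ> ?s i \<circ> ?s j) h"
      using is_grothendieck_exists permutes_transpose w i j by blast
    have "is_grothendieck n (w \<circ> ?s i) (isobaric_dd j h)"
      using h i j ij by (intro is_grothendieck_ascent) (auto simp: transpose_def)
    moreover have "is_grothendieck n (w \<circ> ?s j) (isobaric_dd i h)"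
      using h i j ij unfolding comm by (intro is_grothendieck_ascent) (auto simp: transpose_def)
    ultimately show ?thesis
      using IH i j isobaric_dd_commute[OF ij] by metis
  next
    case True
    let ?t = "?s (Suc i)"
    have braid: "w \<circ> ?s i \<circ> ?t \<circ> ?s i = w \<circ> ?t \<circ> ?s i \<circ> ?t"
      using transpose_braid[of i] by (simp add: comp_assoc)
    obtain h where h: "is_grothendieck n (w \<circ> ?s i \<circ> ?t \<circ> ?s i) h"
      using is_grothendieck_exists permutes_transpose w i j True by metis
    have "is_grothendieck n (w \<circ> ?s i) (isobaric_dd (Suc i) (isobaric_dd i h))"
      using h i j True
      by (intro is_grothendieck_ascent) (auto simp: transpose_def)
    moreover have "is_grothendieck n (w \<circ> ?t) (isobaric_dd i (isobaric_dd (Suc i) h))"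
      using h i j True unfolding braid
      by (intro is_grothendieck_ascent) (auto simp: transpose_def)
    ultimately show ?thesis
      using IH i j True isobaric_dd_braid[of i h] by metis
  qed
  show ?case
    using less(2)
  proof (cases rule: is_grothendieck_cases)
    case 1
    note f = this
    show ?thesis
      using less(3) by (cases rule: is_grothendieck_cases) (use f no_longest in blast)+
  next
    case (2 i f')
    note f = this
    show ?thesis
      using less(3)
    proof (cases rule: is_grothendieck_cases)
      case 1
      then show ?thesis using f no_longest by blast
    next
      case (2 j g')
      show ?thesis
      proof (cases i j rule: linorder_cases)
        case less
        then show ?thesis using diamond f 2 by metis
      next
        case equal
        then show ?thesis using IH f 2 by metis
      next
        case greater
        then show ?thesis using diamond f 2 by metis
      qed
    qed
  qed
qed

theorem grothendieck_unique_existence: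
  "w permutes {1..n} \<Longrightarrow> \<exists>!f. is_grothendieck n w f"
  using is_grothendieck_exists is_grothendieck_unique by blast

lemma is_grothendieck_grothendieck:
  "w permutes {1..n} \<Longrightarrow> is_grothendieck n w (grothendieck n w)"
  unfolding grothendieck_def by (rule theI'[OF grothendieck_unique_existence])

theorem grothendieck_longest:
  "grothendieck n (longest_perm n) = (\<Prod>i = 1..n. xvar i ^ (n - i))"
  using is_grothendieck.longest is_grothendieck_permutes is_grothendieck_grothendieck
    is_grothendieck_unique by blast

theorem grothendieck_step:
  assumes "w permutes {1..n}" "1 \<le> i" "i < n"
    and "Suc (inversions n (w \<circ> transpose i (Suc i))) = inversions n w"
  shows "grothendieck n (w \<circ> transpose i (Suc i)) = isobaric_dd i (grothendieck n w)"
  using assms is_grothendieck.step is_grothendieck_grothendieck is_grothendieck_unique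
    permutes_transpose by metis

end

theory Submission
  imports Defs
begin

text \<open>
  Moving suitable entries of a vexillary permutation to the front one after the other leads to a
  dominant permutation, whose Grothendieck polynomial is a monomial. Reading the moves backwards
  writes \<open>\<GG>\<^sub>w\<close> as the polynomial \<open>flagged p \<phi> k 0\<close> of a partition \<open>p\<close> with increasing flags
  \<open>\<phi>\<close>. In its last variable this polynomial satisfies a recursion
  \<open>f = x\<^sub>m f\<^sub>1 + (1 - x\<^sub>m) f\<^sub>2\<close> in which no cancellation occurs, because the sign of a
  coefficient only depends on the degree. The recursion identifies the support: its elements are
  the sums of the columns of a filling, where each column is a spanning set of a matroid with a bound
  on its surplus entries, and each row allows only one column to have a surplus. All
  monomials of lowest degree are sums of bases, and bases are allowed in every such column, so
  \<open>p\<^sub>1\<close> can be replaced by a sum of bases of the columns that make up \<open>p\<^sub>2\<close>.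
  Augmentation along exchanges in the columns, as for sums of matroids, then removes from \<open>p\<^sub>2\<close>
  one variable after the other until \<open>q\<close> is reached.
\<close>

section \<open>Isobaric divided differences and flagged polynomials\<close>

text \<open>The surplus rows couple the columns, so the support is a union of sums of independent
  families, one sum for each way to distribute the surplus rows. Augmentation has to stay within one
  such sum: the distribution found for \<open>p2\<close> is kept throughout, and that of
  \<open>p1\<close> is forgotten together with its surplus entries. The price of this description is
  paid in the recursion. Multiplication by the last variable asks for one more surplus entry in row
  \<open>h\<close>, which may already belong to a taller column; \<open>columns_swap\<close>
  resolves the conflict. Flagged polynomials are defined by operators and not as sums over tableaux,
  because this is the form in which moving entries produces them, and their recursion is then a
  Leibniz rule. Avoidance of 2143 enters through one invariant: the later entries that exceed the
  last moved one increase.\<close>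

lemma isobaric_dd_mult_symmetric:
  assumes "swap_vars i f = f"
  shows "isobaric_dd i (f * g) = f * isobaric_dd i g"
proof (rule isobaric_dd_eqI)
  have "(xvar i - xvar (Suc i)) * (f * isobaric_dd i g) = f * ((xvar i - xvar (Suc i)) * isobaric_dd i g)"
    by (simp only: ac_simps)
  also have "\<dots> = (1 - xvar (Suc i)) * (f * g) - (1 - xvar i) * swap_vars i (f * g)"
    unfolding isobaric_dd_eq by (simp add: assms algebra_simps)
  finally show "(xvar i - xvar (Suc i)) * (f * isobaric_dd i g)
      = (1 - xvar (Suc i)) * (f * g) - (1 - xvar i) * swap_vars i (f * g)" .
qed

lemma isobaric_dd_add: "isobaric_dd i (f + g) = isobaric_dd i f + isobaric_dd i g"
proof (rule isobaric_dd_eqI)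
  show "(xvar i - xvar (Suc i)) * (isobaric_dd i f + isobaric_dd i g)
      = (1 - xvar (Suc i)) * (f + g) - (1 - xvar i) * swap_vars i (f + g)"
    unfolding distrib_left[of "xvar i - xvar (Suc i)"] isobaric_dd_eq by (simp add: algebra_simps)
qed

lemma isobaric_dd_fixed_iff: "isobaric_dd i f = f \<longleftrightarrow> swap_vars i f = f"
proof
  assume "swap_vars i f = f"
  then show "isobaric_dd i f = f"
    by (intro isobaric_dd_eqI) (simp add: algebra_simps)
qed (metis swap_vars_isobaric_dd)

lemma isobaric_dd_idem [simp]: "isobaric_dd i (isobaric_dd i f) = isobaric_dd i f"
  by (simp add: isobaric_dd_fixed_iff)

lemma isobaric_dd_one [simp]: "isobaric_dd i 1 = 1"
  by (simp add: isobaric_dd_fixed_iff)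

text \<open>Skew Leibniz rule; its coefficient \<open>1 - xvar (Suc i)\<close> reappears as the
  factor of the second term in the flagged recursion.\<close>

lemma isobaric_dd_xvar_mult:
  "isobaric_dd i (xvar i * g) = (1 - xvar (Suc i)) * g + xvar (Suc i) * isobaric_dd i g"
proof (rule isobaric_dd_eqI)
  have "(xvar i - xvar (Suc i)) * ((1 - xvar (Suc i)) * g + xvar (Suc i) * isobaric_dd i g)
      = (xvar i - xvar (Suc i)) * (1 - xvar (Suc i)) * g
        + xvar (Suc i) * ((xvar i - xvar (Suc i)) * isobaric_dd i g)"
    by (simp add: algebra_simps)
  also have "\<dots> = (1 - xvar (Suc i)) * (xvar i * g) - (1 - xvar i) * swap_vars i (xvar i * g)"
    unfolding isobaric_dd_eq by (simp add: algebra_simps)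
  finally show "(xvar i - xvar (Suc i)) * ((1 - xvar (Suc i)) * g + xvar (Suc i) * isobaric_dd i g)
      = (1 - xvar (Suc i)) * (xvar i * g) - (1 - xvar i) * swap_vars i (xvar i * g)" .
qed

lemma isobaric_dd_one_minus_xvar_mult:
  assumes "swap_vars i f = f"
  shows "isobaric_dd i ((1 - xvar i) * f) = 0"
  by (rule isobaric_dd_eqI) (simp add: assms algebra_simps)

lemma swap_vars_xvar_other: "j \<noteq> i \<Longrightarrow> j \<noteq> Suc i \<Longrightarrow> swap_vars i (xvar j) = xvar j"
  by (simp add: transpose_def)

lemma swap_vars_power [simp]: "swap_vars i (f ^ k) = swap_vars i f ^ k"
  by (induction k) simp_all

text \<open>\<open>iso_chain a b\<close> is \<open>\<pi>\<^bsub>b-1\<^esub> \<dots> \<pi>\<^bsub>a+1\<^esub> \<pi>\<^bsub>a\<^esub>\<close>.\<close>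

primrec iso_chain :: "nat \<Rightarrow> nat \<Rightarrow> ipoly \<Rightarrow> ipoly"
  where "iso_chain a 0 f = f"
  | "iso_chain a (Suc b) f = (if a \<le> b then isobaric_dd b (iso_chain a b f) else f)"

lemma iso_chain_trivial [simp]: "b \<le> a \<Longrightarrow> iso_chain a b f = f"
  by (cases b) auto

lemma iso_chain_left:
  "a < b \<Longrightarrow> iso_chain a b f = iso_chain (Suc a) b (isobaric_dd a f)"
proof (induction b)
  case (Suc b)
  then show ?case by (cases "a = b") auto
qed simp

lemma iso_chain_mult_symmetric:
  assumes "\<And>i. a \<le> i \<Longrightarrow> i < b \<Longrightarrow> swap_vars i f = f"
  shows "iso_chain a b (f * g) = f * iso_chain a b g"
  using assms by (induction b) (auto simp: isobaric_dd_mult_symmetric)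

lemma iso_chain_add: "iso_chain a b (f + g) = iso_chain a b f + iso_chain a b g"
  by (induction b) (auto simp: isobaric_dd_add)

lemma iso_chain_isobaric_dd_high:
  "b < j \<Longrightarrow> iso_chain a b (isobaric_dd j f) = isobaric_dd j (iso_chain a b f)"
proof (induction b)
  case (Suc b)
  then show ?case using isobaric_dd_commute[of b j] by simp
qed simp

lemma iso_chain_isobaric_dd_low:
  "Suc j < a \<Longrightarrow> iso_chain a b (isobaric_dd j f) = isobaric_dd j (iso_chain a b f)"
proof (induction b)
  case (Suc b)
  then show ?case using isobaric_dd_commute[of j b] by simp
qed simp

text \<open>The braid relation carries the operator past its neighbouring pair in the chain and
  raises its index by one; with the remaining factors the operator in question commutes.\<close>

lemma isobaric_dd_iso_chain:
  "a \<le> i \<Longrightarrow> Suc i < b \<Longrightarrow> isobaric_dd i (iso_chain a b f) = iso_chain a b (isobaric_dd (Suc i) f)"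
proof (induction b)
  case (Suc b)
  show ?case
  proof (cases "Suc i = b")
    case True
    then have b: "b = Suc i" by simp
    show ?thesis using Suc.prems
      by (simp add: b isobaric_dd_braid iso_chain_isobaric_dd_high)
  next
    case False
    then have "Suc i < b" using Suc.prems by simp
    then show ?thesis using Suc by (simp add: isobaric_dd_commute)
  qed
qed simp

lemma iso_chain_iso_chain:
  "a \<le> c \<Longrightarrow> b < m \<Longrightarrow> iso_chain c b (iso_chain a m f) = iso_chain a m (iso_chain (Suc c) (Suc b) f)"
  by (induction b) (auto simp: isobaric_dd_iso_chain)

text \<open>The identity behind the recursion of the flagged polynomials in their last variable:
  \<open>\<pi>\<^bsub>b\<^esub>\<close> annihilates the Leibniz terms \<open>(1 - x\<^bsub>b\<^esub>) f\<close> with \<open>f\<close> symmetric.\<close>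

lemma iso_chain_xvar_mult:
  assumes "a \<le> b" and "\<And>j. a < j \<Longrightarrow> j \<le> b \<Longrightarrow> swap_vars j f = f"
  shows "iso_chain a (Suc b) (xvar a * f)
    = (1 - xvar (Suc b)) * iso_chain a b f + xvar (Suc b) * iso_chain a (Suc b) f"
  using assms
proof (induction b rule: dec_induct)
  case base
  then show ?case by (simp add: isobaric_dd_xvar_mult)
next
  case (step b)
  have "isobaric_dd (Suc b) (iso_chain a b f) = iso_chain a b f"
    using step(1) step(4)[of "Suc b"] iso_chain_isobaric_dd_high[of b "Suc b" a f]
    by (simp add: isobaric_dd_fixed_iff[THEN iffD2])
  then have "isobaric_dd (Suc b) ((1 - xvar (Suc b)) * iso_chain a b f) = 0"
    by (simp add: isobaric_dd_fixed_iff isobaric_dd_one_minus_xvar_mult)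
  then show ?case
    using step by (simp add: isobaric_dd_add isobaric_dd_xvar_mult)
qed

text \<open>The reason for the exponent \<open>p r + \<phi> r - r\<close> in \<open>flagged\<close>:
  the \<open>\<phi> r - r\<close> operators of a chain use up that many powers, so that an empty
  last row contributes 1.\<close>

lemma iso_chain_power_one: "iso_chain a (a + k) (xvar a ^ k) = 1"
proof (induction k)
  case (Suc k)
  have "iso_chain a (Suc (a + k)) (xvar a * xvar a ^ k) = 1"
    using Suc by (subst iso_chain_xvar_mult) (auto simp: transpose_def)
  then show ?case by simp
qed simp

text \<open>By the symmetry of \<open>f\<close> the inner chain may start at \<open>a\<close> as
  well. The outer chain can then be prolonged by the operator at \<open>b\<close> at the cost of
  shortening the inner one again, and this operator is idempotent.\<close>

lemma isobaric_dd_double_iso_chain: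
  assumes "a < b" and "swap_vars a f = f"
  shows "isobaric_dd b (iso_chain a b (iso_chain (Suc a) (Suc b) f)) = iso_chain a b (iso_chain (Suc a) (Suc b) f)"
proof -
  have "iso_chain (Suc a) (Suc b) f = iso_chain a (Suc b) f"
    using assms iso_chain_left[of a "Suc b" f] isobaric_dd_fixed_iff[of a f] by simp
  then have "iso_chain a b (iso_chain (Suc a) (Suc b) f) = iso_chain a (Suc b) (iso_chain (Suc a) (Suc b) f)"
    using iso_chain_iso_chain[of a a b "Suc b" f] by simp
  also have "\<dots> = isobaric_dd b (iso_chain a b (iso_chain (Suc a) (Suc b) f))"
    using assms by simp
  finally show ?thesis by simp
qed

text \<open>The rows \<open>t + 1, \<dots>, t + n\<close> have lengths \<open>p\<close> and flags \<open>\<phi>\<close>; the polynomial is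
  the signed generating function of flagged set-valued tableaux of this shape.\<close>

primrec flagged :: "(nat \<Rightarrow> nat) \<Rightarrow> (nat \<Rightarrow> nat) \<Rightarrow> nat \<Rightarrow> nat \<Rightarrow> ipoly"
  where "flagged p \<phi> 0 t = 1"
  | "flagged p \<phi> (Suc n) t = iso_chain (Suc t) (\<phi> (Suc t))
      (xvar (Suc t) ^ (p (Suc t) + \<phi> (Suc t) - Suc t) * flagged p \<phi> n (Suc t))"

section \<open>Symmetry and recursion of flagged polynomials\<close>

lemma flagged_cong:
  assumes "\<And>r. t < r \<Longrightarrow> r \<le> t + n \<Longrightarrow> p r = p' r \<and> \<phi> r = \<phi>' r"
  shows "flagged p \<phi> n t = flagged p' \<phi>' n t"
  using assms by (induction n arbitrary: t) auto

lemma swap_vars_flagged_low: "Suc i \<le> t \<Longrightarrow> swap_vars i (flagged p \<phi> n t) = flagged p \<phi> n t"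
proof (induction n arbitrary: t)
  case (Suc n)
  let ?f = "xvar (Suc t) ^ (p (Suc t) + \<phi> (Suc t) - Suc t) * flagged p \<phi> n (Suc t)"
  have "isobaric_dd i ?f = ?f"
    using Suc by (simp add: isobaric_dd_fixed_iff transpose_def)
  then have "isobaric_dd i (flagged p \<phi> (Suc n) t) = flagged p \<phi> (Suc n) t"
    using Suc.prems iso_chain_isobaric_dd_low[of i "Suc t" "\<phi> (Suc t)" ?f] by simp
  then show ?case by (simp add: isobaric_dd_fixed_iff)
qed simp

text \<open>The operator at \<open>i\<close> is either the outermost one of the first chain, hence
  absorbed, or it passes through the chain with its index raised and is absorbed by the later
  rows.\<close>

lemma swap_vars_flagged:
  assumes "t < i" and "\<And>r. t < r \<Longrightarrow> r \<le> t + n \<Longrightarrow> i < \<phi> r"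
    and "\<And>r s. t < r \<Longrightarrow> r \<le> s \<Longrightarrow> s \<le> t + n \<Longrightarrow> \<phi> r \<le> \<phi> s"
  shows "swap_vars i (flagged p \<phi> n t) = flagged p \<phi> n t"
  using assms
proof (induction n arbitrary: t i)
  case (Suc n)
  let ?f = "xvar (Suc t) ^ (p (Suc t) + \<phi> (Suc t) - Suc t) * flagged p \<phi> n (Suc t)"
  have i: "i < \<phi> (Suc t)" using Suc.prems(2)[of "Suc t"] by simp
  have "isobaric_dd i (iso_chain (Suc t) (\<phi> (Suc t)) ?f) = iso_chain (Suc t) (\<phi> (Suc t)) ?f"
  proof (cases "Suc i = \<phi> (Suc t)")
    case True
    then show ?thesis using Suc.prems(1) by (simp flip: True)
  next
    case False
    then have less: "Suc i < \<phi> (Suc t)" using i by simp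
    have "Suc i < \<phi> r" if "Suc t < r" "r \<le> Suc t + n" for r
      using less Suc.prems(3)[of "Suc t" r] that by simp
    then have "swap_vars (Suc i) (flagged p \<phi> n (Suc t)) = flagged p \<phi> n (Suc t)"
      using Suc.prems(1,3) by (intro Suc.IH) auto
    then have "isobaric_dd (Suc i) ?f = ?f"
      using Suc.prems(1) by (simp add: isobaric_dd_fixed_iff transpose_def)
    then show ?thesis using less Suc.prems(1) by (simp add: isobaric_dd_iso_chain)
  qed
  then show ?case by (simp add: isobaric_dd_fixed_iff)
qed simp

text \<open>One factor \<open>xvar (Suc t)\<close> is split off. The exponent that remains belongs
  both to the row shortened by one and to the row with its flag lowered by one. The later flags are
  at least \<open>Suc m\<close>, which gives the symmetry needed for
  \<open>iso_chain_xvar_mult\<close>.\<close>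

lemma flagged_transition:
  assumes "Suc t \<le> m" and "\<phi> (Suc t) = Suc m"
    and "\<And>r s. t < r \<Longrightarrow> r \<le> s \<Longrightarrow> s \<le> t + Suc n \<Longrightarrow> \<phi> r \<le> \<phi> s"
    and "p (Suc t) = Suc c"
  shows "flagged p \<phi> (Suc n) t = xvar (Suc m) * flagged (p(Suc t := c)) \<phi> (Suc n) t
    + (1 - xvar (Suc m)) * flagged p (\<phi>(Suc t := m)) (Suc n) t"
proof -
  let ?g = "flagged p \<phi> n (Suc t)"
  let ?N = "c + m - t"
  have e1: "flagged (p(Suc t := c)) \<phi> n (Suc t) = ?g" by (rule flagged_cong) auto
  have e2: "flagged p (\<phi>(Suc t := m)) n (Suc t) = ?g" by (rule flagged_cong) auto
  have sym: "swap_vars j (xvar (Suc t) ^ ?N * ?g) = xvar (Suc t) ^ ?N * ?g" if j: "Suc t < j" "j \<le> m" for j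
  proof -
    have "j < \<phi> r" if "Suc t < r" "r \<le> Suc t + n" for r
      using assms(3)[of "Suc t" r] assms(2) that j(2) by simp
    then have "swap_vars j ?g = ?g" using j assms(3) by (intro swap_vars_flagged) auto
    then show ?thesis using j by (simp add: transpose_def)
  qed
  have "flagged p \<phi> (Suc n) t = iso_chain (Suc t) (Suc m) (xvar (Suc t) * (xvar (Suc t) ^ ?N * ?g))"
  proof -
    have "Suc c + Suc m - Suc t = Suc ?N" using assms(1) by simp
    then show ?thesis unfolding flagged.simps assms(2,4) by (simp only: power_Suc mult.assoc)
  qed
  also have "\<dots> = (1 - xvar (Suc m)) * iso_chain (Suc t) m (xvar (Suc t) ^ ?N * ?g)
      + xvar (Suc m) * iso_chain (Suc t) (Suc m) (xvar (Suc t) ^ ?N * ?g)"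
    by (rule iso_chain_xvar_mult[OF assms(1) sym])
  also have "iso_chain (Suc t) m (xvar (Suc t) ^ ?N * ?g) = flagged p (\<phi>(Suc t := m)) (Suc n) t"
    using e2 by (simp add: assms(4))
  also have "iso_chain (Suc t) (Suc m) (xvar (Suc t) ^ ?N * ?g) = flagged (p(Suc t := c)) \<phi> (Suc n) t"
  proof -
    have "c + Suc m - Suc t = ?N" by simp
    then show ?thesis using e1 by (simp add: assms(2))
  qed
  finally show ?thesis by (simp only: add.commute)
qed

lemma flagged_transition_degenerate:
  assumes "\<phi> (Suc t) = Suc t" and "p (Suc t) = Suc c"
  shows "flagged p \<phi> (Suc n) t = xvar (Suc t) * flagged (p(Suc t := c)) \<phi> (Suc n) t"
proof -
  have "flagged (p(Suc t := c)) \<phi> n (Suc t) = flagged p \<phi> n (Suc t)" by (rule flagged_cong) auto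
  then show ?thesis using assms by (simp add: mult.assoc)
qed

text \<open>In tableau terms, columns increase strictly and every column of the first row continues
  into the second, so the largest value cannot occur in the first row. Algebraically, the term with
  the lowered flag is fixed by the operator at \<open>m\<close>, and the two terms of the transition
  add up to it.\<close>

lemma flagged_equal_rows:
  assumes "Suc t \<le> m" and "\<phi> (Suc t) = Suc m" and "\<phi> (Suc (Suc t)) = Suc m"
    and "\<And>r s. t < r \<Longrightarrow> r \<le> s \<Longrightarrow> s \<le> t + Suc (Suc n) \<Longrightarrow> \<phi> r \<le> \<phi> s"
    and "p (Suc t) = c" and "p (Suc (Suc t)) = c"
  shows "flagged p \<phi> (Suc (Suc n)) t = flagged p (\<phi>(Suc t := m)) (Suc (Suc n)) t"
proof -
  let ?h = "flagged p \<phi> n (Suc (Suc t))"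
  let ?g = "flagged p \<phi> (Suc n) (Suc t)"
  let ?N = "c + m - Suc t"
  let ?x = "xvar (Suc t)" and ?y = "xvar (Suc (Suc t))"
  have N: "c + Suc m - Suc t = Suc ?N" "c + Suc m - Suc (Suc t) = ?N" using assms(1) by auto
  have e2: "flagged p (\<phi>(Suc t := m)) (Suc n) (Suc t) = ?g" by (rule flagged_cong) auto
  have sym: "swap_vars j (?x ^ ?N * ?g) = ?x ^ ?N * ?g" if j: "Suc t < j" "j \<le> m" for j
  proof -
    have "j < \<phi> r" if "Suc t < r" "r \<le> Suc t + Suc n" for r
      using assms(4)[of "Suc t" r] assms(2) that j(2) by simp
    then have "swap_vars j ?g = ?g" using j assms(4) by (intro swap_vars_flagged) auto
    then show ?thesis using j by (simp add: transpose_def)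
  qed
  have g: "?g = iso_chain (Suc (Suc t)) (Suc m) (?y ^ ?N * ?h)"
    unfolding flagged.simps assms(3,6) N(2) ..
  have xg: "?x ^ ?N * ?g = iso_chain (Suc (Suc t)) (Suc m) (?x ^ ?N * (?y ^ ?N * ?h))"
    unfolding g by (rule iso_chain_mult_symmetric[symmetric]) (auto simp: transpose_def)
  let ?P = "iso_chain (Suc t) m (?x ^ ?N * ?g)"
  have fixed: "isobaric_dd m ?P = ?P"
  proof (cases "Suc t = m")
    case True
    have "swap_vars (Suc t) ?h = ?h" by (rule swap_vars_flagged_low) simp
    then have "swap_vars (Suc t) (?x ^ ?N * ?g) = ?x ^ ?N * ?g"
      unfolding g using True by (simp add: mult_ac)
    then show ?thesis using True by (simp add: isobaric_dd_fixed_iff)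
  next
    case False
    have h: "swap_vars (Suc t) ?h = ?h" by (rule swap_vars_flagged_low) simp
    have "swap_vars (Suc t) (?x ^ ?N * (?y ^ ?N * ?h)) = ?x ^ ?N * (?y ^ ?N * ?h)"
      using h by (simp add: mult_ac)
    then show ?thesis
      unfolding xg using assms(1) False by (intro isobaric_dd_double_iso_chain) auto
  qed
  have "flagged p \<phi> (Suc (Suc n)) t = iso_chain (Suc t) (Suc m) (?x * (?x ^ ?N * ?g))"
    by (simp only: flagged.simps(2)[of p \<phi> "Suc n" t] assms(2,5) N(1) power_Suc mult.assoc)
  also have "\<dots> = (1 - xvar (Suc m)) * ?P + xvar (Suc m) * iso_chain (Suc t) (Suc m) (?x ^ ?N * ?g)"
    by (rule iso_chain_xvar_mult[OF assms(1) sym])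
  also have "\<dots> = ?P"
    using assms(1) fixed by (simp add: algebra_simps)
  also have "\<dots> = flagged p (\<phi>(Suc t := m)) (Suc (Suc n)) t"
    by (simp only: flagged.simps(2)[of p _ "Suc n" t] e2 fun_upd_same assms(5))
  finally show ?thesis .
qed

lemma flagged_zero_row:
  assumes "Suc t \<le> \<phi> (Suc t)" and "p (Suc t) = 0"
  shows "flagged p \<phi> (Suc 0) t = 1"
  using iso_chain_power_one[of "Suc t" "\<phi> (Suc t) - Suc t"] assms by simp

text \<open>A relation among lower rows survives the chains of the rows above, because its
  coefficients are invariant under the operators in these chains.\<close>

lemma flagged_linear:
  assumes "flagged p \<phi> n (t + s) = a * flagged p1 \<phi>1 n1 (t + s) + b * flagged p2 \<phi>2 n2 (t + s)"
    and "\<And>r. t < r \<Longrightarrow> r \<le> t + s \<Longrightarrow> p1 r = p r \<and> p2 r = p r \<and> \<phi>1 r = \<phi> r \<and> \<phi>2 r = \<phi> r"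
    and "\<And>r i. t < r \<Longrightarrow> r \<le> t + s \<Longrightarrow> i < \<phi> r \<Longrightarrow> swap_vars i a = a \<and> swap_vars i b = b"
  shows "flagged p \<phi> (s + n) t = a * flagged p1 \<phi>1 (s + n1) t + b * flagged p2 \<phi>2 (s + n2) t"
  using assms
proof (induction s arbitrary: t)
  case (Suc s)
  let ?x = "xvar (Suc t) ^ (p (Suc t) + \<phi> (Suc t) - Suc t)"
  have eq: "p1 (Suc t) = p (Suc t)" "p2 (Suc t) = p (Suc t)" "\<phi>1 (Suc t) = \<phi> (Suc t)" "\<phi>2 (Suc t) = \<phi> (Suc t)"
    using Suc.prems(2)[of "Suc t"] by auto
  have "flagged p \<phi> (s + n) (Suc t) = a * flagged p1 \<phi>1 (s + n1) (Suc t) + b * flagged p2 \<phi>2 (s + n2) (Suc t)"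
  proof (rule Suc.IH)
    show "swap_vars i a = a \<and> swap_vars i b = b" if "Suc t < r" "r \<le> Suc t + s" "i < \<phi> r" for r i
      using Suc.prems(3)[of r i] that by simp
  qed (use Suc.prems(1,2) in auto)
  then have "?x * flagged p \<phi> (s + n) (Suc t)
      = a * (?x * flagged p1 \<phi>1 (s + n1) (Suc t)) + b * (?x * flagged p2 \<phi>2 (s + n2) (Suc t))"
    by (simp add: algebra_simps)
  then have "flagged p \<phi> (Suc s + n) t = iso_chain (Suc t) (\<phi> (Suc t)) (a * (?x * flagged p1 \<phi>1 (s + n1) (Suc t)))
      + iso_chain (Suc t) (\<phi> (Suc t)) (b * (?x * flagged p2 \<phi>2 (s + n2) (Suc t)))"
    by (simp add: iso_chain_add)
  also have "\<dots> = a * flagged p1 \<phi>1 (Suc s + n1) t + b * flagged p2 \<phi>2 (Suc s + n2) t"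
    using Suc.prems(3)[of "Suc t"] by (simp add: iso_chain_mult_symmetric eq)
  finally show ?case .
qed simp

section \<open>Vexillary Grothendieck polynomials are flagged\<close>

lemma grothendieck_ascent:
  assumes "w permutes {1..n}" "1 \<le> i" "i < n" "w i < w (Suc i)"
  shows "grothendieck n w = isobaric_dd i (grothendieck n (w \<circ> transpose i (Suc i)))"
  using is_grothendieck_ascent[OF is_grothendieck_grothendieck[OF permutes_transpose] assms(2-4)]
    is_grothendieck_grothendieck is_grothendieck_unique assms by blast

section \<open>Lehmer codes and dominant permutations\<close>

definition lehmer :: "nat \<Rightarrow> (nat \<Rightarrow> nat) \<Rightarrow> nat \<Rightarrow> nat"
  where "lehmer n w i = card {j. i < j \<and> j \<le> n \<and> w j < w i}"

lemma finite_lehmer [simp]: "finite {j. i < j \<and> j \<le> (n::nat) \<and> P j}"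
  by (rule finite_subset[of _ "{..n}"]) auto

lemma lehmer_le: "lehmer n w i \<le> n - i"
proof -
  have "{j. i < j \<and> j \<le> n \<and> w j < w i} \<subseteq> {i<..n}" by auto
  from card_mono[OF _ this] show ?thesis by (simp add: lehmer_def)
qed

text \<open>The values after position \<open>k\<close> are the complement of the first
  \<open>k\<close> values; their order does not affect the code at \<open>k\<close>.\<close>

lemma lehmer_cong:
  assumes "u permutes {1..n}" "w permutes {1..n}" "1 \<le> k" "k \<le> n"
    and "\<And>i. 1 \<le> i \<Longrightarrow> i \<le> k \<Longrightarrow> u i = w i"
  shows "lehmer n u k = lehmer n w k"
proof -
  have img: "v ` {k<..n} = {1..n} - v ` {1..k}" if "v permutes {1..n}" for v
  proof -
    have "v ` ({1..n} - {1..k}) = {1..n} - v ` {1..k}"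
      using permutes_inj[OF that] permutes_image[OF that] by (simp add: image_set_diff)
    moreover have "{1..n} - {1..k} = {k<..n}" using assms(3) by auto
    ultimately show ?thesis by simp
  qed
  have alt: "lehmer n v k = card {y \<in> v ` {k<..n}. y < v k}" if "v permutes {1..n}" for v
  proof -
    have "{y \<in> v ` {k<..n}. y < v k} = v ` {j. k < j \<and> j \<le> n \<and> v j < v k}" by auto
    moreover have "inj_on v {j. k < j \<and> j \<le> n \<and> v j < v k}"
      using permutes_inj[OF that] by (rule inj_on_subset) simp
    ultimately show ?thesis by (simp add: lehmer_def card_image)
  qed
  have "u ` {1..k} = w ` {1..k}" using assms(5) by (intro image_cong) auto
  then show ?thesis
    using assms by (simp add: alt img)
qed

lemma lehmer_ascent: "w i < w (Suc i) \<Longrightarrow> lehmer n w i \<le> lehmer n w (Suc i)"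
  unfolding lehmer_def by (rule card_mono) (auto, metis not_less_iff_gr_or_eq Suc_lessI)

lemma lehmer_descent:
  assumes "Suc i \<le> n" "w (Suc i) < w i"
  shows "lehmer n w (Suc i) < lehmer n w i"
proof -
  have "insert (Suc i) {j. Suc i < j \<and> j \<le> n \<and> w j < w (Suc i)} \<subseteq> {j. i < j \<and> j \<le> n \<and> w j < w i}"
    using assms by auto
  from card_mono[OF _ this] show ?thesis by (simp add: lehmer_def)
qed

lemma permutes_neq: "w permutes S \<Longrightarrow> i \<noteq> j \<Longrightarrow> w i \<noteq> w j"
  using permutes_inj by (metis injD)

lemma lehmer_transpose:
  assumes "i < n" "w i < w (Suc i)"
  shows "lehmer n (w \<circ> transpose i (Suc i)) i = Suc (lehmer n w (Suc i))"
    and "lehmer n (w \<circ> transpose i (Suc i)) (Suc i) = lehmer n w i"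
proof -
  have "{j. i < j \<and> j \<le> n \<and> (w \<circ> transpose i (Suc i)) j < (w \<circ> transpose i (Suc i)) i}
      = insert (Suc i) {j. Suc i < j \<and> j \<le> n \<and> w j < w (Suc i)}"
    using assms by (auto simp: transpose_def split: if_splits)
  then show "lehmer n (w \<circ> transpose i (Suc i)) i = Suc (lehmer n w (Suc i))"
    by (simp add: lehmer_def)
  have "{j. Suc i < j \<and> j \<le> n \<and> (w \<circ> transpose i (Suc i)) j < (w \<circ> transpose i (Suc i)) (Suc i)}
      = {j. i < j \<and> j \<le> n \<and> w j < w i}"
    using assms by (auto simp: transpose_def split: if_splits)
  then show "lehmer n (w \<circ> transpose i (Suc i)) (Suc i) = lehmer n w i"
    by (simp add: lehmer_def)
qed

lemma lehmer_transpose_other: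
  assumes "w permutes {1..n}" "1 \<le> i" "i < n" "k \<noteq> i" "k \<noteq> Suc i" "1 \<le> k" "k \<le> n"
  shows "lehmer n (w \<circ> transpose i (Suc i)) k = lehmer n w k"
proof (cases "k < i")
  case True
  then show ?thesis
    using assms by (intro lehmer_cong permutes_transpose) (auto simp: transpose_def)
next
  case False
  then have "{j. k < j \<and> j \<le> n \<and> (w \<circ> transpose i (Suc i)) j < (w \<circ> transpose i (Suc i)) k}
      = {j. k < j \<and> j \<le> n \<and> w j < w k}"
    using assms by (auto simp: transpose_def)
  then show ?thesis by (simp add: lehmer_def)
qed

lemma lehmer_longest: "1 \<le> i \<Longrightarrow> i \<le> n \<Longrightarrow> lehmer n (longest_perm n) i = n - i"
proof -
  assume "1 \<le> i" "i \<le> n"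
  then have "{j. i < j \<and> j \<le> n \<and> longest_perm n j < longest_perm n i} = {i<..n}"
    by (auto simp: longest_perm_def)
  then show ?thesis by (simp add: lehmer_def)
qed

lemma swap_vars_prod [simp]: "swap_vars i (prod f S) = (\<Prod>j\<in>S. swap_vars i (f j))"
  by (induction S rule: infinite_finite_induct) auto

text \<open>Swapping an ascent \<open>i\<close> leads towards the longest permutation. For a
  decreasing code the entries at \<open>i\<close> and \<open>Suc i\<close> agree, so the larger
  permutation has the monomial \<open>xvar i * S\<close> with \<open>S\<close> symmetric in the two
  variables, and the operator maps it to \<open>S\<close>.\<close>

lemma grothendieck_dominant:
  assumes "w permutes {1..n}" and "\<And>i. 1 \<le> i \<Longrightarrow> i < n \<Longrightarrow> lehmer n w (Suc i) \<le> lehmer n w i"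
  shows "grothendieck n w = (\<Prod>i = 1..n. xvar i ^ lehmer n w i)"
  using assms
proof (induction "n * n - inversions n w" arbitrary: w rule: less_induct)
  case less
  show ?case
  proof (cases "\<exists>i. 1 \<le> i \<and> i < n \<and> w i < w (Suc i)")
    case False
    then have "w = longest_perm n" using no_ascent_imp_longest[OF less(2)] by blast
    then show ?thesis by (simp add: grothendieck_longest lehmer_longest)
  next
    case True
    \<comment> \<open>At the first ascent, a preceding position is a descent and has a strictly
      larger code, so the code remains decreasing when its entry at \<open>i\<close> goes up by
      one.\<close>
    define i where "i = (LEAST i. 1 \<le> i \<and> i < n \<and> w i < w (Suc i))"
    have i: "1 \<le> i" "i < n" "w i < w (Suc i)"
      using LeastI_ex[OF True] unfolding i_def by auto
    have eq: "lehmer n w (Suc i) = lehmer n w i"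
      using lehmer_ascent[of w i n] i less(3)[of i] by simp
    let ?u = "w \<circ> transpose i (Suc i)"
    define c where "c = lehmer n w i"
    have u: "?u permutes {1..n}" using permutes_transpose less(2) i by blast
    have lu: "lehmer n ?u k = (if k = i then Suc c else lehmer n w k)" if "1 \<le> k" "k \<le> n" for k
      using lehmer_transpose[of i n w] lehmer_transpose_other[of w n i k] less(2) i eq that
      by (cases "k = Suc i") (auto simp: c_def)
    have "lehmer n ?u (Suc k) \<le> lehmer n ?u k" if k: "1 \<le> k" "k < n" for k
    proof (cases "Suc k = i")
      case True
      then have "\<not> w k < w (Suc k)"
        using not_less_Least[of k "\<lambda>i. 1 \<le> i \<and> i < n \<and> w i < w (Suc i)"] k unfolding i_def[symmetric] by auto
      then have "w (Suc k) < w k" using permutes_neq[OF less(2), of k "Suc k"] by simp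
      then have "lehmer n w (Suc k) < lehmer n w k" using k by (intro lehmer_descent) auto
      then show ?thesis using lu[of k] lu[of "Suc k"] k True by (simp add: c_def)
    next
      case False
      then show ?thesis using lu[of k] lu[of "Suc k"] k less(3)[of k] by (auto simp: c_def)
    qed
    moreover have "n * n - inversions n ?u < n * n - inversions n w"
      using inversions_ascent[of i n w, OF i] inversions_le[of n ?u] by simp
    ultimately have IH: "grothendieck n ?u = (\<Prod>k = 1..n. xvar k ^ lehmer n ?u k)"
      using less(1) u by blast
    have ins: "{1..n} = insert i (insert (Suc i) ({1..n} - {i, Suc i}))" using i by auto
    let ?R = "(\<Prod>k\<in>{1..n} - {i, Suc i}. xvar k ^ lehmer n w k)"
    let ?S = "xvar i ^ c * xvar (Suc i) ^ c * ?R"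
    have "grothendieck n ?u = (\<Prod>k = 1..n. xvar k ^ (if k = i then Suc c else lehmer n w k))"
      unfolding IH by (rule prod.cong) (auto simp: lu)
    also have "\<dots> = xvar i * ?S"
      by (subst ins) (use eq in \<open>simp add: c_def mult_ac cong: prod.cong_simp\<close>)
    finally have gu: "grothendieck n ?u = xvar i * ?S" .
    have gw: "(\<Prod>k = 1..n. xvar k ^ lehmer n w k) = ?S"
      by (subst ins) (use eq in \<open>simp add: c_def mult_ac\<close>)
    have "swap_vars i ?R = ?R"
      unfolding swap_vars_prod by (rule prod.cong) (auto simp: transpose_def)
    then have "swap_vars i ?S = ?S" by (simp add: mult_ac)
    then have "isobaric_dd i (xvar i * ?S) = ?S"
      using isobaric_dd_fixed_iff[of i ?S] isobaric_dd_xvar_mult[of i ?S] by (simp add: algebra_simps)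
    then show ?thesis using grothendieck_ascent[OF less(2) i] gu gw by simp
  qed
qed

section \<open>Moving entries to the front\<close>

text \<open>The moved entry exceeds everything it passes, so every adjacent swap on its way is taken
  at an ascent and adds one operator to the chain.\<close>

lemma grothendieck_move:
  assumes "a \<le> d" "w permutes {1..n}" "1 \<le> a" "d \<le> n" "\<And>j. a \<le> j \<Longrightarrow> j < d \<Longrightarrow> w j < w d"
  shows "\<exists>u. u permutes {1..n} \<and> u a = w d \<and> (\<forall>j. a \<le> j \<and> j < d \<longrightarrow> u (Suc j) = w j) \<and>
    (\<forall>j. j < a \<or> d < j \<longrightarrow> u j = w j) \<and> grothendieck n w = iso_chain a d (grothendieck n u)"
  using assms
proof (induction d arbitrary: w rule: dec_induct)
  case base
  then show ?case by (intro exI[of _ w]) auto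
next
  case (step d)
  let ?v = "w \<circ> transpose d (Suc d)"
  have asc: "w d < w (Suc d)" using step by simp
  have v: "?v permutes {1..n}" using step by (intro permutes_transpose) auto
  have "\<exists>u. u permutes {1..n} \<and> u a = ?v d \<and> (\<forall>j. a \<le> j \<and> j < d \<longrightarrow> u (Suc j) = ?v j) \<and>
    (\<forall>j. j < a \<or> d < j \<longrightarrow> u j = ?v j) \<and> grothendieck n ?v = iso_chain a d (grothendieck n u)"
    using step.prems by (intro step.IH v) (auto simp: transpose_def)
  then obtain u where u: "u permutes {1..n}" "u a = ?v d" "\<forall>j. a \<le> j \<and> j < d \<longrightarrow> u (Suc j) = ?v j"
    "\<forall>j. j < a \<or> d < j \<longrightarrow> u j = ?v j" "grothendieck n ?v = iso_chain a d (grothendieck n u)"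
    by blast
  have "grothendieck n w = isobaric_dd d (grothendieck n ?v)"
    using step.prems step.hyps asc by (intro grothendieck_ascent) auto
  moreover have "u (Suc j) = w j" if "a \<le> j" "j < Suc d" for j
    using u(3,4) that by (cases "j = d") (auto simp: transpose_def)
  moreover have "u j = w j" if "j < a \<or> Suc d < j" for j
    using u(4) that step.hyps by (auto simp: transpose_def)
  ultimately show ?case using u(1,2,5) step.hyps by (intro exI[of _ u]) auto
qed

lemma less_if_ascending:
  fixes w :: "nat \<Rightarrow> nat"
  assumes "\<And>j. a \<le> j \<Longrightarrow> j < b \<Longrightarrow> w j < w (Suc j)" and "a \<le> i" "i < j" "j \<le> b"
  shows "w i < w j"
  using assms(3,4)
proof (induction j)
  case (Suc j)
  show ?case
  proof (cases "i = j")
    case False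
    then have "w i < w j" using Suc by simp
    also have "w j < w (Suc j)" using assms(1)[of j] assms(2) Suc.prems by simp
    finally show ?thesis .
  qed (use assms(1)[of j] assms(2) Suc.prems in simp)
qed simp

text \<open>
  The first \<open>t\<close> positions hold the entries that were already moved to the front; \<open>p0\<close> and \<open>f0\<close> are
  the length and the flag of the row that the last of these moves produced. The next entry to
  move is the one at the first descent \<open>d\<close> after \<open>t\<close> or, if \<open>w d > w t\<close>, the first one exceeding
  \<open>w t\<close>; the latter choice keeps the Lehmer code decreasing on the front positions.
\<close>

lemma vexillary_flagged_aux:
  assumes "w permutes {1..n}" "t \<le> n" "t \<le> f0"
    and avoid: "\<And>a b c d. t < a \<Longrightarrow> a < b \<Longrightarrow> b < c \<Longrightarrow> c < d \<Longrightarrow> d \<le> n \<Longrightarrow>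
      w b < w a \<Longrightarrow> w a < w d \<Longrightarrow> w d < w c \<Longrightarrow> False"
    and dominant: "\<And>i. 1 \<le> i \<Longrightarrow> i < t \<Longrightarrow> lehmer n w (Suc i) \<le> lehmer n w i"
    and larger: "\<And>a b. 1 \<le> t \<Longrightarrow> t < a \<Longrightarrow> a < b \<Longrightarrow> b \<le> n \<Longrightarrow> w t < w a \<Longrightarrow> w t < w b \<Longrightarrow> w a < w b"
    and incr: "\<And>j. t < j \<Longrightarrow> j < f0 \<Longrightarrow> w j < w (Suc j)"
    and smaller: "\<And>j. 1 \<le> t \<Longrightarrow> t < j \<Longrightarrow> j \<le> f0 \<Longrightarrow> w j < w t"
    and head: "1 \<le> t \<Longrightarrow> lehmer n w t = p0 + f0 - t" "t < f0 \<Longrightarrow> lehmer n w f0 \<le> p0"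
    and zero: "t = 0 \<Longrightarrow> f0 = 0 \<and> p0 = n"
  shows "\<exists>p \<phi> k. grothendieck n w = (\<Prod>i = 1..t. xvar i ^ lehmer n w i) * flagged p \<phi> k t
    \<and> (\<forall>r s. t < r \<and> r \<le> s \<and> s \<le> t + k \<longrightarrow> p s \<le> p r \<and> \<phi> r \<le> \<phi> s)
    \<and> (\<forall>r. t < r \<and> r \<le> t + k \<longrightarrow> r \<le> \<phi> r)
    \<and> (0 < k \<longrightarrow> p (Suc t) \<le> p0 \<and> f0 \<le> \<phi> (Suc t))"
  using assms
proof (induction "n - t" arbitrary: w t f0 p0 rule: less_induct)
  case less
  note w = less(2) and avoid = less(5) and dominant = less(6) and larger = less(7)
    and incr = less(8) and smaller = less(9) and head = less(10,11) and zero = less(12)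
  show ?case
  proof (cases "\<exists>j. t < j \<and> j < n \<and> w (Suc j) < w j")
    case False
    have asc: "w j < w (Suc j)" if "Suc t \<le> j" "j < n" for j
      using False that permutes_neq[OF w, of j "Suc j"] by (metis Suc_le_eq linorder_neqE_nat n_not_Suc_n)
    have zero: "lehmer n w i = 0" if "t < i" for i
    proof -
      have "w i < w j" if "i < j" "j \<le> n" for j
        using less_if_ascending[of "Suc t" n w i j] asc that \<open>t < i\<close> by simp
      then have "{j. i < j \<and> j \<le> n \<and> w j < w i} = {}" by fastforce
      then show ?thesis by (simp add: lehmer_def)
    qed
    have "grothendieck n w = (\<Prod>i = 1..n. xvar i ^ lehmer n w i)"
    proof (rule grothendieck_dominant[OF w])
      show "lehmer n w (Suc i) \<le> lehmer n w i" if "1 \<le> i" "i < n" for i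
        using dominant[of i] zero[of "Suc i"] that by (cases "i < t") auto
    qed
    also have "\<dots> = (\<Prod>i = 1..t. xvar i ^ lehmer n w i)"
      using less(3) zero by (intro prod.mono_neutral_right) auto
    finally show ?thesis by (intro exI[of _ "\<lambda>_. 0"] exI[of _ 0]) simp
  next
    case True
    define d where "d = (LEAST j. t < j \<and> j < n \<and> w (Suc j) < w j)"
    have d: "t < d" "d < n" "w (Suc d) < w d"
      using LeastI_ex[OF True] unfolding d_def by auto
    have asc: "w j < w (Suc j)" if "Suc t \<le> j" "j < d" for j
    proof -
      have "\<not> w (Suc j) < w j"
        using not_less_Least[of j "\<lambda>j. t < j \<and> j < n \<and> w (Suc j) < w j"] that d(2)
        unfolding d_def[symmetric] by auto
      then show ?thesis using permutes_neq[OF w, of j "Suc j"] by simp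
    qed
    have inc: "w i < w j" if "t < i" "i < j" "j \<le> d" for i j
      using less_if_ascending[of "Suc t" d w i j] asc that by simp
    have "\<exists>e. t < e \<and> e \<le> d \<and> (1 \<le> t \<longrightarrow> (\<forall>j. t < j \<and> j < e \<longrightarrow> w j < w t)) \<and>
      (e = d \<and> (t = 0 \<or> w d < w t) \<or> 1 \<le> t \<and> w t < w e)"
    proof (cases "t = 0 \<or> w d < w t")
      case True
      then show ?thesis using d inc[of _ d] by (intro exI[of _ d]) (auto intro: less_trans)
    next
      case False
      define e where "e = (LEAST j. t < j \<and> w t < w j)"
      have ex: "t < d \<and> w t < w d"
        using False d(1) permutes_neq[OF w, of t d] by auto
      have e: "t < e" "w t < w e" using LeastI[of "\<lambda>j. t < j \<and> w t < w j", OF ex] unfolding e_def by auto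
      have "e \<le> d" unfolding e_def by (rule Least_le) (rule ex)
      moreover have "w j < w t" if "t < j" "j < e" for j
        using not_less_Least[of j "\<lambda>j. t < j \<and> w t < w j"] that permutes_neq[OF w, of t j]
        unfolding e_def[symmetric] by auto
      ultimately show ?thesis using e False by (intro exI[of _ e]) auto
    qed
    then obtain e where e: "t < e" "e \<le> d" and below: "\<And>j. 1 \<le> t \<Longrightarrow> t < j \<Longrightarrow> j < e \<Longrightarrow> w j < w t"
      and e_cases: "e = d \<and> (t = 0 \<or> w d < w t) \<or> 1 \<le> t \<and> w t < w e"
      by blast
    have ince: "w i < w j" if "t < i" "i < j" "j \<le> e" for i j using inc that e by simp
    define p where "p = lehmer n w e"
    \<comment> \<open>The left side is the code that the moved entry will have at position
      \<open>t + 1\<close>. The bound keeps the code decreasing on the front and controls the row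
      lengths.\<close>
    have bound: "p + (e - Suc t) \<le> lehmer n w t" if t: "1 \<le> t"
    proof -
      have "w j < w t" if j: "e < j" "j \<le> n" "w j < w e" for j
        using e_cases
      proof
        assume "e = d \<and> (t = 0 \<or> w d < w t)"
        then show ?thesis using j t by auto
      next
        assume "1 \<le> t \<and> w t < w e"
        then show ?thesis using larger[of e j] e j t permutes_neq[OF w, of j t]
          by (metis less_trans linorder_neqE_nat less_irrefl_nat less_asym)
      qed
      then have "{Suc t..<e} \<union> {j. e < j \<and> j \<le> n \<and> w j < w e} \<subseteq> {j. t < j \<and> j \<le> n \<and> w j < w t}"
        using e d below[OF t] by auto
      then have "card ({Suc t..<e} \<union> {j. e < j \<and> j \<le> n \<and> w j < w e}) \<le> lehmer n w t"
        unfolding lehmer_def by (intro card_mono) auto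
      moreover have "card ({Suc t..<e} \<union> {j. e < j \<and> j \<le> n \<and> w j < w e}) = e - Suc t + p"
        unfolding p_def lehmer_def by (subst card_Un_disjoint) auto
      ultimately show ?thesis by simp
    qed
    \<comment> \<open>The invariant \<open>larger\<close> for the next move. If
      \<open>e = d\<close>, entries violating it would form the pattern 2143 with \<open>w d\<close>
      and \<open>w (Suc d)\<close>; otherwise it is inherited from \<open>w t\<close>.\<close>
    have later: "w a < w b" if ab: "e < a" "a < b" "b \<le> n" "w e < w a" "w e < w b" for a b
      using e_cases
    proof
      assume ed: "e = d \<and> (t = 0 \<or> w d < w t)"
      show ?thesis
      proof (rule ccontr)
        assume "\<not> w a < w b"
        then have "w b < w a" using permutes_neq[OF w, of a b] ab by simp
        moreover have "Suc d < a" using ab ed d by (metis Suc_lessI less_asym)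
        ultimately show False using avoid[of d "Suc d" a b] ab ed d by simp
      qed
    next
      assume "1 \<le> t \<and> w t < w e"
      then show ?thesis using larger[of a b] ab e by simp
    qed
    \<comment> \<open>Up to \<open>f0\<close> the entries ascend and stay below \<open>w t\<close>,
      so neither choice of \<open>e\<close> can lie before \<open>f0\<close>.\<close>
    have f0: "f0 \<le> e"
    proof (rule ccontr)
      assume f: "\<not> f0 \<le> e"
      then have "1 \<le> t" using zero by (cases t) auto
      then have "w e < w t" using smaller[of e] f e by simp
      then have "e = d" using e_cases by auto
      then show False using incr[of d] f d by simp
    qed
    \<comment> \<open>For \<open>f0 < e\<close> the bound suffices. For \<open>f0 = e\<close> it is
      off by one, and the invariant on the code at \<open>f0\<close> closes the gap.\<close>
    have p0: "p \<le> p0"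
    proof (cases "t = 0")
      case True
      then show ?thesis using zero lehmer_le[of n w e] by (simp add: p_def)
    next
      case False
      then have "p + (e - Suc t) \<le> p0 + f0 - t" using bound head(1) by simp
      then show ?thesis using head(2) f0 e less(4) unfolding p_def by (cases "f0 = e") auto
    qed
    obtain u where u: "u permutes {1..n}" and u0: "u (Suc t) = w e"
      and u1: "\<And>j. t < j \<Longrightarrow> j < e \<Longrightarrow> u (Suc j) = w j"
      and u2: "\<And>j. j \<le> t \<or> e < j \<Longrightarrow> u j = w j"
      and gw: "grothendieck n w = iso_chain (Suc t) e (grothendieck n u)"
    proof -
      have "\<exists>u. u permutes {1..n} \<and> u (Suc t) = w e \<and> (\<forall>j. Suc t \<le> j \<and> j < e \<longrightarrow> u (Suc j) = w j) \<and>
        (\<forall>j. j < Suc t \<or> e < j \<longrightarrow> u j = w j) \<and> grothendieck n w = iso_chain (Suc t) e (grothendieck n u)"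
        using e d ince w by (intro grothendieck_move) auto
      then show ?thesis using that by (elim exE conjE) (auto simp: Suc_le_eq less_Suc_eq_le)
    qed
    have lu: "lehmer n u i = lehmer n w i" if "1 \<le> i" "i \<le> t" for i
      using u w that u2 less(3) by (intro lehmer_cong) auto
    have uS: "u j = w (if j \<le> e then j - 1 else j)" if "Suc t < j" for j
      using u1[of "j - 1"] u2[of j] that by auto
    have lus: "lehmer n u (Suc t) = p + e - Suc t"
    proof -
      have "{j. Suc t < j \<and> j \<le> n \<and> u j < u (Suc t)} = {Suc t<..e} \<union> {j. e < j \<and> j \<le> n \<and> w j < w e}"
        using e d uS ince by (auto simp: u0)
      then have "lehmer n u (Suc t) = card ({Suc t<..e} \<union> {j. e < j \<and> j \<le> n \<and> w j < w e})"
        by (simp only: lehmer_def)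
      also have "\<dots> = e - Suc t + p"
        unfolding p_def lehmer_def by (subst card_Un_disjoint) auto
      finally show ?thesis using e by simp
    qed
    have "\<exists>p' \<phi> k. grothendieck n u = (\<Prod>i = 1..Suc t. xvar i ^ lehmer n u i) * flagged p' \<phi> k (Suc t)
      \<and> (\<forall>r s. Suc t < r \<and> r \<le> s \<and> s \<le> Suc t + k \<longrightarrow> p' s \<le> p' r \<and> \<phi> r \<le> \<phi> s)
      \<and> (\<forall>r. Suc t < r \<and> r \<le> Suc t + k \<longrightarrow> r \<le> \<phi> r)
      \<and> (0 < k \<longrightarrow> p' (Suc (Suc t)) \<le> p \<and> e \<le> \<phi> (Suc (Suc t)))"
    proof (rule less(1)[OF _ u])
      show "n - Suc t < n - t" "Suc t \<le> n" "Suc t \<le> e" using d e by auto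
      fix a b c d' assume *: "Suc t < a" "a < b" "b < c" "c < d'" "d' \<le> n" "u b < u a" "u a < u d'" "u d' < u c"
      \<comment> \<open>\<open>g\<close> gives the position in \<open>w\<close> of an entry of
        \<open>u\<close>. It is increasing behind position \<open>t + 1\<close>, so patterns there
        come from patterns of \<open>w\<close>.\<close>
      define g where "g j = (if j \<le> e then j - 1 else j)" for j
      have "t < g a" "g a < g b" "g b < g c" "g c < g d'" "g d' \<le> n" using * e d by (auto simp: g_def)
      moreover have "u a = w (g a)" "u b = w (g b)" "u c = w (g c)" "u d' = w (g d')"
        using * uS by (auto simp: g_def)
      ultimately show False using avoid[of "g a" "g b" "g c" "g d'"] * by simp
    next
      show "lehmer n u (Suc i) \<le> lehmer n u i" if "1 \<le> i" "i < Suc t" for i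
      proof (cases "i = t")
        case True
        then show ?thesis using lu[of t] lus bound that e by simp
      next
        case False
        then show ?thesis using lu[of i] lu[of "Suc i"] dominant[of i] that by simp
      qed
    next
      fix a b assume *: "Suc t < a" "a < b" "b \<le> n" "u (Suc t) < u a" "u (Suc t) < u b"
      have "e < a"
      proof (rule ccontr)
        assume "\<not> e < a"
        then have "u a < w e" using uS[of a] ince[of "a - 1" e] * by auto
        then show False using * u0 by simp
      qed
      then show "u a < u b" using later[of a b] * u0 u2[of a] u2[of b] by simp
    next
      show "u j < u (Suc j)" if "Suc t < j" "j < e" for j
        using uS[of j] uS[of "Suc j"] ince[of "j - 1" j] that by simp
      show "u j < u (Suc t)" if "Suc t < j" "j \<le> e" for j
        using uS[of j] u0 ince[of "j - 1" e] that by simp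
      show "lehmer n u (Suc t) = p + e - Suc t" by (rule lus)
      assume te: "Suc t < e"
      have "{j. e < j \<and> j \<le> n \<and> u j < u e} \<subseteq> {j. e < j \<and> j \<le> n \<and> w j < w e}"
        using uS[of e] u2 ince[of "e - 1" e] te by (auto intro: less_trans[of _ "w (e - 1)"])
      then show "lehmer n u e \<le> p" unfolding p_def lehmer_def by (intro card_mono) auto
    qed simp
    then obtain p' \<phi> k where gu: "grothendieck n u = (\<Prod>i = 1..Suc t. xvar i ^ lehmer n u i) * flagged p' \<phi> k (Suc t)"
      and mono: "\<And>r s. Suc t < r \<Longrightarrow> r \<le> s \<Longrightarrow> s \<le> Suc t + k \<Longrightarrow> p' s \<le> p' r \<and> \<phi> r \<le> \<phi> s"
      and ge: "\<And>r. Suc t < r \<Longrightarrow> r \<le> Suc t + k \<Longrightarrow> r \<le> \<phi> r"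
      and first: "0 < k \<Longrightarrow> p' (Suc (Suc t)) \<le> p \<and> e \<le> \<phi> (Suc (Suc t))"
      by blast
    let ?p = "p'(Suc t := p)" and ?\<phi> = "\<phi>(Suc t := e)"
    have cong: "flagged ?p ?\<phi> k (Suc t) = flagged p' \<phi> k (Suc t)" by (rule flagged_cong) auto
    have "grothendieck n u = (\<Prod>i = 1..t. xvar i ^ lehmer n w i)
        * (xvar (Suc t) ^ (p + e - Suc t) * flagged p' \<phi> k (Suc t))"
      unfolding gu by (simp add: prod.atLeast_Suc_atMost_Suc_shift[symmetric] lus lu mult.assoc cong: prod.cong_simp)
    then have "grothendieck n w = (\<Prod>i = 1..t. xvar i ^ lehmer n w i) * flagged ?p ?\<phi> (Suc k) t"
      unfolding gw flagged.simps fun_upd_same cong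
      by (simp only:) (rule iso_chain_mult_symmetric, auto simp: transpose_def intro!: prod.cong)
    moreover have "?p s \<le> ?p r \<and> ?\<phi> r \<le> ?\<phi> s" if rs: "t < r" "r \<le> s" "s \<le> t + Suc k" for r s
    proof (cases "r = Suc t")
      case True
      show ?thesis
      proof (cases "s = Suc t")
        case False
        then show ?thesis using mono[of "Suc (Suc t)" s] first rs True by fastforce
      qed (use True in simp)
    next
      case False
      then show ?thesis using mono[of r s] rs by simp
    qed
    moreover have "r \<le> ?\<phi> r" if "t < r" "r \<le> t + Suc k" for r
      using ge[of r] e that by auto
    ultimately show ?thesis using p0 f0
      by (intro exI[of _ ?p] exI[of _ ?\<phi>] exI[of _ "Suc k"]) auto
  qed
qed

lemma vexillary_flagged:
  assumes "w permutes {1..n}" "vexillary n w"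
  obtains p \<phi> k where "grothendieck n w = flagged p \<phi> k 0"
    and "\<And>r s. 0 < r \<Longrightarrow> r \<le> s \<Longrightarrow> s \<le> k \<Longrightarrow> p s \<le> p r"
    and "\<And>r s. 0 < r \<Longrightarrow> r \<le> s \<Longrightarrow> s \<le> k \<Longrightarrow> \<phi> r \<le> \<phi> s"
    and "\<And>r. 0 < r \<Longrightarrow> r \<le> k \<Longrightarrow> r \<le> \<phi> r"
proof -
  have "\<exists>p \<phi> k. grothendieck n w = (\<Prod>i = 1..0. xvar i ^ lehmer n w i) * flagged p \<phi> k 0
    \<and> (\<forall>r s. 0 < r \<and> r \<le> s \<and> s \<le> 0 + k \<longrightarrow> p s \<le> p r \<and> \<phi> r \<le> \<phi> s)
    \<and> (\<forall>r. 0 < r \<and> r \<le> 0 + k \<longrightarrow> r \<le> \<phi> r)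
    \<and> (0 < k \<longrightarrow> p (Suc 0) \<le> n \<and> 0 \<le> \<phi> (Suc 0))"
  \<comment> \<open>Before any move the bounds on the first row are the trivial ones: length at most
    \<open>n\<close>, flag at least 0.\<close>
  proof (rule vexillary_flagged_aux[OF assms(1)])
    show False if "0 < a" "a < b" "b < c" "c < d" "d \<le> n" "w b < w a" "w a < w d" "w d < w c" for a b c d
      using assms(2) that unfolding vexillary_def by (metis One_nat_def Suc_leI)
  qed simp_all
  then show ?thesis using that by auto
qed

section \<open>Columns and fillings\<close>

abbreviation lo :: "nat set \<Rightarrow> nat \<Rightarrow> nat"
  where "lo U x \<equiv> card (U \<inter> {..x})"

abbreviation hi :: "nat set \<Rightarrow> nat \<Rightarrow> nat"
  where "hi U x \<equiv> card (U \<inter> {x<..})"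

lemma lo_hi: "finite U \<Longrightarrow> lo U x + hi U x = card U"
proof -
  assume "finite U"
  then have "card ((U \<inter> {..x}) \<union> (U \<inter> {x<..})) = lo U x + hi U x"
    by (intro card_Un_disjoint) auto
  moreover have "(U \<inter> {..x}) \<union> (U \<inter> {x<..}) = U" by auto
  ultimately show ?thesis by simp
qed

lemma lo_mono: "finite V \<Longrightarrow> U \<inter> {..x} \<subseteq> V \<Longrightarrow> x \<le> y \<Longrightarrow> lo U x \<le> lo V y"
  by (intro card_mono) auto

lemma hi_mono: "finite V \<Longrightarrow> U \<inter> {x<..} \<subseteq> V \<Longrightarrow> y \<le> x \<Longrightarrow> hi U x \<le> hi V y"
  by (intro card_mono) auto

lemma lo_insert: "finite U \<Longrightarrow> l \<notin> U \<Longrightarrow> lo (insert l U) x = lo U x + of_bool (l \<le> x)"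
  by (auto simp: Int_insert_left)

lemma hi_insert: "finite U \<Longrightarrow> l \<notin> U \<Longrightarrow> hi (insert l U) x = hi U x + of_bool (x < l)"
  by (auto simp: Int_insert_left)

lemma lo_remove: "finite U \<Longrightarrow> i \<in> U \<Longrightarrow> lo U x = lo (U - {i}) x + of_bool (i \<le> x)"
  using lo_insert[of "U - {i}" i x] by (simp add: insert_absorb)

lemma hi_remove: "finite U \<Longrightarrow> i \<in> U \<Longrightarrow> hi U x = hi (U - {i}) x + of_bool (x < i)"
  using hi_insert[of "U - {i}" i x] by (simp add: insert_absorb)

lemma lo_eq_card: "U \<subseteq> {1..x} \<Longrightarrow> x \<le> y \<Longrightarrow> lo U y = card U"
  by (rule arg_cong[of _ _ card]) auto

lemma hi_eq_0: "U \<subseteq> {1..x} \<Longrightarrow> x \<le> y \<Longrightarrow> hi U y = 0"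
proof -
  assume "U \<subseteq> {1..x}" "x \<le> y"
  then have "U \<inter> {y<..} = {}" by fastforce
  then show ?thesis by simp
qed

text \<open>
  The entries of a column of height \<open>b\<close> are a set \<open>U\<close>. For \<open>\<rho> = 0\<close> they are exactly
  \<open>b\<close> entries whose \<open>r\<close>-th smallest is at most \<open>\<phi> r\<close>, with the convention \<open>\<phi> 0 = 0\<close>.
  For \<open>\<rho> > 0\<close> surplus entries are allowed, but only up to the flag \<open>\<phi> \<rho>\<close>.
\<close>

definition column :: "(nat \<Rightarrow> nat) \<Rightarrow> nat \<Rightarrow> nat \<Rightarrow> nat set set"
  where "column \<phi> b \<rho> = {U. U \<subseteq> {1..\<phi> b} \<and> \<rho> \<le> b \<and> (\<forall>r\<le>b. r \<le> lo U (\<phi> r)) \<and>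
    (\<forall>r. \<rho> \<le> r \<and> r \<le> b \<longrightarrow> hi U (\<phi> r) + r \<le> b)}"

lemma columnI:
  assumes "U \<subseteq> {1..\<phi> b}" "\<rho> \<le> b" "\<And>r. r \<le> b \<Longrightarrow> r \<le> lo U (\<phi> r)"
    and "\<And>r. \<rho> \<le> r \<Longrightarrow> r \<le> b \<Longrightarrow> hi U (\<phi> r) + r \<le> b"
  shows "U \<in> column \<phi> b \<rho>"
  using assms unfolding column_def by blast

lemma column_finite: "U \<in> column \<phi> b \<rho> \<Longrightarrow> finite U"
  by (auto simp: column_def intro: finite_subset)

lemma column_card: "U \<in> column \<phi> b \<rho> \<Longrightarrow> b \<le> card U"
  by (auto simp: column_def intro: order_trans[OF _ card_mono] finite_subset)

text \<open>Since \<open>\<phi> 0 = 0\<close>, the surplus condition at \<open>r = 0\<close> counts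
  all entries. It forces exactly \<open>b\<close> of them, and the lower counts then imply the other
  surplus conditions.\<close>

lemma column_zero_iff:
  assumes "\<phi> 0 = 0"
  shows "U \<in> column \<phi> b 0 \<longleftrightarrow> U \<subseteq> {1..\<phi> b} \<and> card U = b \<and> (\<forall>r\<le>b. r \<le> lo U (\<phi> r))"
proof
  assume U: "U \<in> column \<phi> b 0"
  then have "hi U (\<phi> 0) + 0 \<le> b" unfolding column_def by blast
  moreover have "U \<inter> {0<..} = U" using U unfolding column_def by force
  ultimately have "card U \<le> b" using assms by simp
  with U column_card[OF U] show "U \<subseteq> {1..\<phi> b} \<and> card U = b \<and> (\<forall>r\<le>b. r \<le> lo U (\<phi> r))"
    unfolding column_def by auto
next
  assume U: "U \<subseteq> {1..\<phi> b} \<and> card U = b \<and> (\<forall>r\<le>b. r \<le> lo U (\<phi> r))"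
  then have "finite U" using finite_subset by blast
  then have "hi U (\<phi> r) + r \<le> b" if "r \<le> b" for r
    using lo_hi[of U "\<phi> r"] U that by fastforce
  with U show "U \<in> column \<phi> b 0" unfolding column_def by auto
qed

text \<open>Largest entries are dropped as long as there are more than \<open>b\<close>. A count
  affected by this sees all of \<open>U\<close>, so it is still at least \<open>b\<close>
  afterwards.\<close>

lemma column_base_subset:
  assumes "\<phi> 0 = 0" "U \<in> column \<phi> b \<rho>"
  shows "\<exists>B \<subseteq> U. B \<in> column \<phi> b 0"
proof -
  have "U \<subseteq> {1..\<phi> b}" "b \<le> card U" "\<forall>r\<le>b. r \<le> lo U (\<phi> r)"
    using assms(2) column_card[OF assms(2)] by (simp_all add: column_def)
  then show ?thesis
  proof (induction "card U - b" arbitrary: U)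
    case 0
    then have "card U = b" by simp
    then have "U \<in> column \<phi> b 0"
      unfolding column_zero_iff[of \<phi>, OF assms(1)] using 0 by simp
    then show ?case by (intro exI[of _ U]) simp
  next
    case (Suc n)
    have fin: "finite U" using Suc(3) finite_subset by blast
    have "U \<noteq> {}" using Suc(2) by (intro notI) simp
    define u where "u = Max U"
    have u: "u \<in> U" using Max_in[OF fin \<open>U \<noteq> {}\<close>] by (simp add: u_def)
    have card: "Suc (card (U - {u})) = card U" by (rule card_Suc_Diff1[OF fin u])
    have "r \<le> lo (U - {u}) (\<phi> r)" if r: "r \<le> b" for r
    proof (cases "u \<le> \<phi> r")
      case True
      then have "x \<le> \<phi> r" if "x \<in> U" for x using Max_ge[OF fin that] by (simp add: u_def)
      then have "U \<inter> {..\<phi> r} = U" by (intro Int_absorb2 subsetI) simp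
      then have "lo U (\<phi> r) = card U" by simp
      then show ?thesis using lo_remove[OF fin u, of "\<phi> r"] True r Suc(2) by simp
    next
      case False
      moreover have "r \<le> lo U (\<phi> r)" using Suc(5) r by blast
      ultimately show ?thesis using lo_remove[OF fin u, of "\<phi> r"] by simp
    qed
    moreover have "n = card (U - {u}) - b" "U - {u} \<subseteq> {1..\<phi> b}" "b \<le> card (U - {u})"
      using Suc(2,3) card by auto
    ultimately have "\<exists>B \<subseteq> U - {u}. B \<in> column \<phi> b 0"
      by (intro Suc(1)) simp_all
    then show ?case by (meson Diff_subset order_trans)
  qed
qed

text \<open>Deleting \<open>i\<close> can only destroy a lower count, so some segment
  \<open>{..\<phi> r}\<close> containing \<open>i\<close> holds exactly \<open>r\<close> entries of
  \<open>U\<close>. The new entry must lie within the first such segment to repair all of them, and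
  within every segment containing \<open>i\<close> whose surplus bound is attained. It suffices to
  find a threshold \<open>x\<close> respecting these limits up to which \<open>B\<close> has at
  least as many entries as \<open>U\<close>: as \<open>i\<close> is not in \<open>B\<close>, some
  entry of \<open>B\<close> up to \<open>x\<close> is missing in \<open>U\<close>.\<close>

lemma column_exchange:
  assumes \<phi>: "\<phi> 0 = 0" "\<And>r s. r \<le> s \<Longrightarrow> s \<le> b \<Longrightarrow> \<phi> r \<le> \<phi> s"
    and U: "U \<in> column \<phi> b \<rho>" and B: "B \<in> column \<phi> b 0" and i: "i \<in> U" "i \<notin> B"
    and nrem: "U - {i} \<notin> column \<phi> b \<rho>"
  obtains l where "l \<in> B" "l \<notin> U" "insert l (U - {i}) \<in> column \<phi> b \<rho>"
proof -
  have fin: "finite U" "finite B" using column_finite[OF U] column_finite[OF B] by simp_all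
  have U': "U \<subseteq> {1..\<phi> b}" "\<rho> \<le> b" "\<And>r. r \<le> b \<Longrightarrow> r \<le> lo U (\<phi> r)"
    "\<And>r. \<rho> \<le> r \<Longrightarrow> r \<le> b \<Longrightarrow> hi U (\<phi> r) + r \<le> b"
    using U unfolding column_def by auto
  have B': "B \<subseteq> {1..\<phi> b}" "card B = b" "\<And>r. r \<le> b \<Longrightarrow> r \<le> lo B (\<phi> r)"
    using B column_zero_iff[of \<phi>, OF \<phi>(1), of B b] by auto
  have "hi (U - {i}) (\<phi> r) + r \<le> b" if "\<rho> \<le> r" "r \<le> b" for r
    using hi_remove[OF fin(1) i(1), of "\<phi> r"] U'(4)[OF that] by simp
  moreover have "U - {i} \<subseteq> {1..\<phi> b}" using U'(1) by blast
  ultimately obtain r0 where r0: "r0 \<le> b" "lo (U - {i}) (\<phi> r0) < r0"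
    using nrem U'(2) unfolding column_def mem_Collect_eq by (meson not_le)
  then have ex: "\<exists>r. r \<le> b \<and> i \<le> \<phi> r \<and> lo U (\<phi> r) = r"
    using lo_remove[OF fin(1) i(1), of "\<phi> r0"] U'(3)[of r0]
    by (intro exI[of _ r0]) (cases "i \<le> \<phi> r0"; simp)
  define r where "r = (LEAST r. r \<le> b \<and> i \<le> \<phi> r \<and> lo U (\<phi> r) = r)"
  have r: "r \<le> b" "i \<le> \<phi> r" "lo U (\<phi> r) = r" using LeastI_ex[OF ex] unfolding r_def by auto
  have rmin: "r \<le> s" if "s \<le> b" "i \<le> \<phi> s" "lo U (\<phi> s) = s" for s
    unfolding r_def by (rule Least_le) (use that in auto)
  \<comment> \<open>Surplus conditions that hold with equality and would fail if \<open>i\<close>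
    were replaced by an entry beyond \<open>\<phi> s\<close>.\<close>
  define T where "T s \<longleftrightarrow> \<rho> \<le> s \<and> s \<le> b \<and> i \<le> \<phi> s \<and> hi U (\<phi> s) + s = b" for s
  have "\<exists>x. i \<le> x \<and> x \<le> \<phi> r \<and> lo U x \<le> lo B x \<and> (\<forall>s. T s \<longrightarrow> x \<le> \<phi> s)"
  proof (cases "\<exists>s. T s \<and> \<phi> s < \<phi> r")
    case False
    then have "\<forall>s. T s \<longrightarrow> \<phi> r \<le> \<phi> s" by (meson not_le)
    then show ?thesis using r(1,2) B'(3)[OF r(1)] r(3) by (intro exI[of _ "\<phi> r"]) simp
  next
    case True
    define s where "s = (LEAST s. T s \<and> \<phi> s < \<phi> r)"
    have s: "T s" "\<phi> s < \<phi> r" using LeastI_ex[OF True] unfolding s_def by auto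
    have smin: "\<phi> s \<le> \<phi> s'" if "T s'" for s'
    proof (cases "\<phi> s' < \<phi> r")
      case True
      then have "s \<le> s'" unfolding s_def by (intro Least_le) (use that in auto)
      then show ?thesis using \<phi>(2)[of s s'] that unfolding T_def by simp
    qed (use s in simp)
    have "s < r" using s \<phi>(2)[of r s] unfolding T_def by (meson leD not_le)
    \<comment> \<open>The tight count and the surplus bound at the same \<open>r\<close> give
      \<open>card U \<le> b\<close>. Equality at \<open>s\<close> then leaves at most
      \<open>s\<close> entries of \<open>U\<close> up to \<open>\<phi> s\<close>, and
      \<open>B\<close> has at least that many.\<close>
    then have "hi U (\<phi> r) + r \<le> b" using U'(4)[of r] s r unfolding T_def by simp
    then have "card U \<le> b" using lo_hi[OF fin(1), of "\<phi> r"] r by simp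
    then have "lo U (\<phi> s) \<le> s" using lo_hi[OF fin(1), of "\<phi> s"] s unfolding T_def by simp
    moreover have "s \<le> b" "i \<le> \<phi> s" using s(1) unfolding T_def by auto
    ultimately have "i \<le> \<phi> s \<and> \<phi> s \<le> \<phi> r \<and> lo U (\<phi> s) \<le> lo B (\<phi> s)"
      using s(2) B'(3)[of s] by simp
    then show ?thesis using smin by blast
  qed
  then obtain x where x: "i \<le> x" "x \<le> \<phi> r" "lo U x \<le> lo B x" "\<And>s. T s \<Longrightarrow> x \<le> \<phi> s" by blast
  obtain l where l: "l \<in> B" "l \<notin> U" "l \<le> x"
  proof (rule ccontr)
    assume "\<not> thesis"
    then have "B \<inter> {..x} \<subseteq> U - {i}" using that i by auto
    then have "lo B x \<le> lo (U - {i}) x" using fin by (intro lo_mono) auto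
    then show False using lo_remove[OF fin(1) i(1), of x] x by simp
  qed
  have loU: "lo (insert l (U - {i})) y + of_bool (i \<le> y) = lo U y + of_bool (l \<le> y)" for y
    using lo_remove[OF fin(1) i(1), of y] lo_insert[of "U - {i}" l y] fin l by simp
  have hiU: "hi (insert l (U - {i})) y + of_bool (y < i) = hi U y + of_bool (y < l)" for y
    using hi_remove[OF fin(1) i(1), of y] hi_insert[of "U - {i}" l y] fin l by simp
  have "insert l (U - {i}) \<in> column \<phi> b \<rho>"
    unfolding column_def
  proof (intro CollectI conjI allI impI)
    show "insert l (U - {i}) \<subseteq> {1..\<phi> b}" using l B'(1) U'(1) by auto
    show "\<rho> \<le> b" by (rule U')
  next
    fix s assume s: "s \<le> b"
    show "s \<le> lo (insert l (U - {i})) (\<phi> s)"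
    proof (cases "i \<le> \<phi> s \<and> \<phi> s < l")
      case True
      have "lo U (\<phi> s) \<noteq> s"
      proof
        assume "lo U (\<phi> s) = s"
        then have "\<phi> r \<le> \<phi> s" using rmin[of s] s True \<phi>(2) by simp
        then show False using True l x by simp
      qed
      then show ?thesis using loU[of "\<phi> s"] U'(3)[OF s] True by simp
    next
      case False
      then show ?thesis using loU[of "\<phi> s"] U'(3)[OF s] by (cases "i \<le> \<phi> s"; cases "l \<le> \<phi> s"; simp)
    qed
  next
    fix s assume s: "\<rho> \<le> s \<and> s \<le> b"
    show "hi (insert l (U - {i})) (\<phi> s) + s \<le> b"
    proof (cases "i \<le> \<phi> s \<and> \<phi> s < l")
      case True
      then have "\<not> T s" using x(4)[of s] l by auto
      then have "hi U (\<phi> s) + s \<noteq> b" using s True unfolding T_def by auto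
      then show ?thesis using hiU[of "\<phi> s"] U'(4)[of s] s True by simp
    next
      case False
      then show ?thesis using hiU[of "\<phi> s"] U'(4)[of s] s by (cases "i \<le> \<phi> s"; cases "l \<le> \<phi> s"; simp)
    qed
  qed
  then show ?thesis using that l by blast
qed

section \<open>Augmentation in families of columns\<close>

text \<open>For the columns of a filling, this is the exponent vector of the monomial they
  contribute.\<close>

definition weight :: "'a set \<Rightarrow> ('a \<Rightarrow> nat set) \<Rightarrow> nat \<Rightarrow> nat"
  where "weight J U l = (\<Sum>j\<in>J. of_bool (l \<in> U j))"

lemma weight_update:
  assumes "finite J" "j \<in> J"
  shows "weight J (U(j := V)) l + of_bool (l \<in> U j) = weight J U l + of_bool (l \<in> V)"
proof -
  have rest: "(\<Sum>i\<in>J - {j}. of_bool (l \<in> (U(j := V)) i)) = (\<Sum>i\<in>J - {j}. of_bool (l \<in> U i) :: nat)"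
    by (intro sum.cong) auto
  show ?thesis
    unfolding weight_def sum.remove[OF assms] rest fun_upd_same by (simp only: ac_simps)
qed

lemma weight_mono: "(\<And>j. j \<in> J \<Longrightarrow> U j \<subseteq> V j) \<Longrightarrow> weight J U l \<le> weight J V l"
  unfolding weight_def by (intro sum_mono) auto

text \<open>Augmentation: exchanging \<open>i\<close> for some \<open>l\<close> in a column moves the surplus of \<open>U\<close> over
  the target \<open>T\<close> from \<open>i\<close> to \<open>l\<close> and brings \<open>U\<close> closer to the bases \<open>B\<close>.\<close>

lemma columns_remove:
  assumes J: "finite J" and \<phi>: "\<phi> 0 = 0" "\<And>j r s. j \<in> J \<Longrightarrow> r \<le> s \<Longrightarrow> s \<le> b j \<Longrightarrow> \<phi> r \<le> \<phi> s"
    and B: "\<And>j. j \<in> J \<Longrightarrow> B j \<in> column \<phi> (b j) 0" "\<And>l. weight J B l \<le> T l"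
    and "\<And>j. j \<in> J \<Longrightarrow> U j \<in> column \<phi> (b j) (\<rho> j)"
    and "\<And>l. weight J U l = T l + of_bool (l = i)"
  shows "\<exists>V. (\<forall>j\<in>J. V j \<in> column \<phi> (b j) (\<rho> j)) \<and> weight J V = T"
  using assms(6-7)
proof (induction "\<Sum>j\<in>J. card (U j - B j)" arbitrary: U i rule: less_induct)
  case less
  have lt: "weight J B i < weight J U i" using less(3)[of i] B(2)[of i] by simp
  obtain j where j: "j \<in> J" "i \<in> U j" "i \<notin> B j"
  proof (rule ccontr)
    assume "\<not> thesis"
    then have "weight J U i \<le> weight J B i"
      unfolding weight_def using that by (intro sum_mono) (auto simp: of_bool_def)
    then show False using lt by simp
  qed
  have fin: "finite (U j)" using column_finite less(2) j(1) by blast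
  show ?case
  proof (cases "U j - {i} \<in> column \<phi> (b j) (\<rho> j)")
    case True
    have "weight J (U(j := U j - {i})) l = T l" for l
      using weight_update[OF J j(1), of U "U j - {i}" l] less(3)[of l] j(2) by (cases "l = i") auto
    then show ?thesis
      using True less(2) by (intro exI[of _ "U(j := U j - {i})"]) auto
  next
    case False
    obtain l where l: "l \<in> B j" "l \<notin> U j" "insert l (U j - {i}) \<in> column \<phi> (b j) (\<rho> j)"
      using column_exchange[where \<phi> = \<phi>, OF \<phi>(1) _ less(2)[OF j(1)] B(1)[OF j(1)] j(2,3) False] \<phi>(2) j(1)
      by blast
    have li: "l \<noteq> i" using l j by auto
    let ?U = "U(j := insert l (U j - {i}))"
    show ?thesis
    proof (rule less(1)[of ?U l])
      have "insert l (U j - {i}) - B j = (U j - B j) - {i}" using l by auto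
      moreover have "card ((U j - B j) - {i}) < card (U j - B j)"
        using fin j by (intro card_Diff1_less) auto
      ultimately have "card (?U j - B j) < card (U j - B j)" by simp
      moreover have "card (?U k - B k) \<le> card (U k - B k)" if "k \<in> J" for k
        using calculation by (cases "k = j") auto
      ultimately show "(\<Sum>k\<in>J. card (?U k - B k)) < (\<Sum>k\<in>J. card (U k - B k))"
        using J j(1) by (intro sum_strict_mono_ex1) blast+
    next
      show "?U k \<in> column \<phi> (b k) (\<rho> k)" if "k \<in> J" for k using l less(2) that by simp
      show "weight J ?U m = T m + of_bool (m = l)" for m
        using weight_update[OF J j(1), of U "insert l (U j - {i})" m] less(3)[of m] j(2) l li
        by (cases "m = i"; cases "m = l") auto
    qed
  qed
qed

text \<open>Entries leave \<open>U\<close> one at a time. Each intermediate target still lies above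
  \<open>q\<close>, hence above the weight of the bases, as \<open>columns_remove\<close>
  requires.\<close>

lemma columns_interval:
  assumes J: "finite J" and \<phi>: "\<phi> 0 = 0" "\<And>j r s. j \<in> J \<Longrightarrow> r \<le> s \<Longrightarrow> s \<le> b j \<Longrightarrow> \<phi> r \<le> \<phi> s"
    and U: "\<And>j. j \<in> J \<Longrightarrow> U j \<in> column \<phi> (b j) (\<rho> j)" and B: "\<And>j. j \<in> J \<Longrightarrow> B j \<in> column \<phi> (b j) 0"
    and q: "\<And>l. weight J B l \<le> q l" "\<And>l. q l \<le> weight J U l"
  shows "\<exists>V. (\<forall>j\<in>J. V j \<in> column \<phi> (b j) (\<rho> j)) \<and> weight J V = q"
proof -
  \<comment> \<open>No column has an entry beyond \<open>N\<close>, so the finite sum up to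
    \<open>N\<close> sees the whole excess over \<open>q\<close>.\<close>
  define N where "N = (\<Sum>j\<in>J. \<phi> (b j))"
  have supp: "weight J U l = 0" if U: "\<And>j. j \<in> J \<Longrightarrow> U j \<in> column \<phi> (b j) (\<rho> j)" and l: "N < l" for U l
  proof -
    have "l \<notin> U j" if "j \<in> J" for j
    proof -
      have "\<phi> (b j) \<le> N" unfolding N_def using J that by (intro member_le_sum) auto
      then show ?thesis using U[OF that] l unfolding column_def by fastforce
    qed
    then show ?thesis by (simp add: weight_def)
  qed
  show ?thesis
    using U q(2)
  proof (induction "\<Sum>l\<le>N. weight J U l - q l" arbitrary: U rule: less_induct)
    case less
    show ?case
    proof (cases "weight J U = q")
      case False
      then obtain i where "weight J U i \<noteq> q i" by blast
      then have i: "q i < weight J U i" using less(3)[of i] by simp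
      define T where "T l = weight J U l - of_bool (l = i)" for l
      have T: "weight J U l = T l + of_bool (l = i)" for l using i by (auto simp: T_def)
      have qT: "q l \<le> T l" for l using less(3)[of l] i by (auto simp: T_def)
      have "weight J B l \<le> T l" for l using q(1)[of l] qT[of l] by simp
      have "\<exists>V. (\<forall>j\<in>J. V j \<in> column \<phi> (b j) (\<rho> j)) \<and> weight J V = T"
        by (rule columns_remove[where \<phi> = \<phi> and U = U and B = B and i = i])
          (fact J \<phi> B \<open>\<And>l. weight J B l \<le> T l\<close> less(2) T)+
      then obtain V where V: "\<And>j. j \<in> J \<Longrightarrow> V j \<in> column \<phi> (b j) (\<rho> j)" "weight J V = T"
        by blast
      have "i \<le> N" using supp[OF less(2), of i] i by (metis not_le not_less_zero)
      then have "(\<Sum>l\<le>N. weight J V l - q l) < (\<Sum>l\<le>N. weight J U l - q l)"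
        using i unfolding V(2) by (intro sum_strict_mono_ex1) (auto simp: T_def intro!: bexI[of _ i])
      then show ?thesis using less(1) V qT by blast
    qed (use less(2) in blast)
  qed
qed


section \<open>Columns under a change of the largest flag\<close>

lemma column_cong:
  assumes "\<And>r. r \<le> b \<Longrightarrow> \<phi> r = \<phi>' r"
  shows "column \<phi> b \<rho> = column \<phi>' b \<rho>"
  unfolding column_def using assms by auto

text \<open>\<open>m\<close> is the largest flag and \<open>h\<close> the first row that has it.\<close>

locale last_flag =
  fixes \<phi> :: "nat \<Rightarrow> nat" and k h m :: nat
  assumes zero: "\<phi> 0 = 0" and mono: "r \<le> s \<Longrightarrow> s \<le> k \<Longrightarrow> \<phi> r \<le> \<phi> s"
    and h: "1 \<le> h" "h \<le> k" and below: "r < h \<Longrightarrow> \<phi> r < m"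
    and above: "h \<le> r \<Longrightarrow> r \<le> k \<Longrightarrow> \<phi> r = m"
begin

text \<open>The flags of the second term in the recursion. Lowering only the first row that has the
  largest flag keeps the flags weakly increasing.\<close>

definition lowered where "lowered = \<phi>(h := m - 1)"

lemma lowered_simps [simp]: "lowered h = m - 1" "r \<noteq> h \<Longrightarrow> lowered r = \<phi> r"
  by (auto simp: lowered_def)

lemma m_pos: "0 < m" using below[of 0] h by simp

text \<open>Only \<open>b > h\<close> needs an argument. At most one entry of \<open>U\<close>
  equals \<open>m\<close>, so among at least \<open>b\<close> entries at least \<open>h\<close> lie
  below \<open>m\<close>, and the at most one entry beyond \<open>m - 1\<close> is within the
  allowed \<open>b - h\<close>.\<close>

lemma column_lowered_other:
  assumes "b \<le> k" "b \<noteq> h"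
  shows "column lowered b \<rho> = column \<phi> b \<rho>"
proof (cases "b < h")
  case True
  then show ?thesis by (intro column_cong) auto
next
  case False
  then have b: "h < b" using assms by simp
  have m: "\<phi> b = m" "\<phi> h = m" using above assms b h by auto
  have "U \<in> column lowered b \<rho> \<longleftrightarrow> U \<in> column \<phi> b \<rho>" if U: "U \<subseteq> {1..m}" for U
  proof -
    have fin: "finite U" using U finite_subset by blast
    have lom: "lo U m = card U" "hi U m = 0" using lo_eq_card[OF U] hi_eq_0[OF U] by auto
    have "lo U m \<le> lo U (m - 1) + 1"
    proof -
      have "U \<inter> {..m} \<subseteq> insert m (U \<inter> {..m - 1})" by auto
      then have "lo U m \<le> card (insert m (U \<inter> {..m - 1}))" using fin by (intro card_mono) auto
      also have "\<dots> \<le> lo U (m - 1) + 1" using card_insert_le_m1[of "Suc (lo U (m - 1))" "U \<inter> {..m - 1}" m] by simp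
      finally show ?thesis .
    qed
    moreover have "lo U (m - 1) \<le> lo U m" using fin by (intro lo_mono) auto
    moreover have "lo U (m - 1) + hi U (m - 1) = card U" using lo_hi fin by blast
    ultimately have lh: "b \<le> card U \<Longrightarrow> h \<le> lo U (m - 1)" "hi U (m - 1) + h \<le> b"
      using lom b by auto
    show ?thesis
    proof
      assume *: "U \<in> column lowered b \<rho>"
      then have P: "\<rho> \<le> b" "\<And>r. r \<le> b \<Longrightarrow> r \<le> lo U (lowered r)" "\<And>r. \<rho> \<le> r \<Longrightarrow> r \<le> b \<Longrightarrow> hi U (lowered r) + r \<le> b"
        unfolding column_def by auto
      have "r \<le> lo U (\<phi> r)" if "r \<le> b" for r
        using P(2)[of r] that lom m b column_card[OF *] by (cases "r = h") auto
      moreover have "hi U (\<phi> r) + r \<le> b" if "\<rho> \<le> r" "r \<le> b" for r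
        using P(3)[of r] that lom m b by (cases "r = h") auto
      ultimately show "U \<in> column \<phi> b \<rho>" using P(1) U m unfolding column_def by simp
    next
      assume *: "U \<in> column \<phi> b \<rho>"
      then have P: "\<rho> \<le> b" "\<And>r. r \<le> b \<Longrightarrow> r \<le> lo U (\<phi> r)" "\<And>r. \<rho> \<le> r \<Longrightarrow> r \<le> b \<Longrightarrow> hi U (\<phi> r) + r \<le> b"
        unfolding column_def by auto
      have "r \<le> lo U (lowered r)" if "r \<le> b" for r
        using P(2)[of r] that lh(1) column_card[OF *] by (cases "r = h") auto
      moreover have "hi U (lowered r) + r \<le> b" if "\<rho> \<le> r" "r \<le> b" for r
        using P(3)[of r] that lh(2) by (cases "r = h") auto
      ultimately show "U \<in> column lowered b \<rho>" using P(1) U m b unfolding column_def by simp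
    qed
  qed
  moreover have "U \<subseteq> {1..m}" if "U \<in> column lowered b \<rho> \<or> U \<in> column \<phi> b \<rho>" for U
    using that m b unfolding column_def by auto
  ultimately show ?thesis by blast
qed

lemma column_lowered_subset: "U \<in> column lowered h \<rho> \<Longrightarrow> m \<notin> U \<and> U \<in> column \<phi> h \<rho>"
proof -
  assume *: "U \<in> column lowered h \<rho>"
  then have U: "U \<subseteq> {1..m - 1}" and P: "\<rho> \<le> h" "\<And>r. r \<le> h \<Longrightarrow> r \<le> lo U (lowered r)"
    "\<And>r. \<rho> \<le> r \<Longrightarrow> r \<le> h \<Longrightarrow> hi U (lowered r) + r \<le> h"
    unfolding column_def by auto
  have m: "\<phi> h = m" using above h by simp
  have fin: "finite U" using U finite_subset by blast
  have "r \<le> lo U (\<phi> r)" if "r \<le> h" for r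
  proof (cases "r = h")
    case True
    have "lo U (m - 1) \<le> lo U m" using fin by (intro lo_mono) auto
    then show ?thesis using P(2)[of r] True m by simp
  qed (use P(2)[of r] that in simp)
  moreover have "hi U (\<phi> r) + r \<le> h" if "\<rho> \<le> r" "r \<le> h" for r
    using P(3)[of r] that m hi_eq_0[OF U, of m] by (cases "r = h") auto
  moreover have "U \<subseteq> {1..m}" by (rule order_trans[OF U]) auto
  moreover have "m \<notin> U" using U m_pos by auto
  ultimately show ?thesis using P(1) m unfolding column_def by simp
qed

lemma column_lowered_if: 
  assumes "U \<in> column \<phi> h \<rho>" "m \<notin> U"
  shows "U \<in> column lowered h \<rho>"
proof -
  have m: "\<phi> h = m" using above h by simp
  have P: "\<rho> \<le> h" "\<And>r. r \<le> h \<Longrightarrow> r \<le> lo U (\<phi> r)"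
    "\<And>r. \<rho> \<le> r \<Longrightarrow> r \<le> h \<Longrightarrow> hi U (\<phi> r) + r \<le> h" and Um: "U \<subseteq> {1..m}"
    using assms m unfolding column_def by auto
  have U: "U \<subseteq> {1..m - 1}"
  proof
    fix x assume "x \<in> U"
    then have "x \<in> {1..m}" "x \<noteq> m" using Um assms(2) by auto
    then show "x \<in> {1..m - 1}" by auto
  qed
  have "r \<le> lo U (lowered r)" if "r \<le> h" for r
    using P(2)[of r] that m lo_eq_card[OF U, of m] lo_eq_card[OF U, of "m - 1"] by (cases "r = h") auto
  moreover have "hi U (lowered r) + r \<le> h" if "\<rho> \<le> r" "r \<le> h" for r
    using P(3)[of r] that hi_eq_0[OF U, of "m - 1"] by (cases "r = h") auto
  ultimately show ?thesis using P(1) U unfolding column_def by simp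
qed

text \<open>With surplus row \<open>h\<close> the only surplus condition is the one at
  \<open>\<phi> h = m\<close>, beyond which there is no entry. So \<open>m\<close> may join whatever
  the surplus row of \<open>U\<close> was.\<close>

lemma column_raise: 
  assumes "U \<in> column lowered h \<rho>"
  shows "insert m U \<in> column \<phi> h h"
proof -
  have m: "\<phi> h = m" using above h by simp
  have U: "m \<notin> U" "U \<in> column \<phi> h \<rho>" using column_lowered_subset[OF assms] by auto
  then have P: "U \<subseteq> {1..m}" "\<And>r. r \<le> h \<Longrightarrow> r \<le> lo U (\<phi> r)"
    using m unfolding column_def by auto
  have fin: "finite U" using P finite_subset by blast
  have lo: "r \<le> lo (insert m U) (\<phi> r)" if "r \<le> h" for r
    using P(2)[OF that] lo_insert[OF fin U(1), of "\<phi> r"] by simp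
  have ins: "insert m U \<subseteq> {1..m}" using P(1) m_pos by auto
  have "hi (insert m U) (\<phi> r) + r \<le> h" if "h \<le> r" "r \<le> h" for r
    using hi_eq_0[OF ins, of m] that m by simp
  with ins lo show ?thesis using m by (intro columnI) auto
qed

text \<open>A column with more than \<open>h\<close> entries still has \<open>h\<close> of them
  after losing \<open>m\<close>, now all below \<open>m\<close>.\<close>

lemma column_unraise: 
  assumes "U \<in> column \<phi> h h" "m \<in> U" "h < card U"
  shows "U - {m} \<in> column lowered h h"
proof -
  have m: "\<phi> h = m" using above h by simp
  have P: "U \<subseteq> {1..m}" "\<And>r. r \<le> h \<Longrightarrow> r \<le> lo U (\<phi> r)"
    using assms m unfolding column_def by auto
  have fin: "finite U" using P finite_subset by blast
  have sub: "U - {m} \<subseteq> {1..m - 1}"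
  proof
    fix x assume "x \<in> U - {m}"
    then have "x \<in> {1..m}" "x \<noteq> m" using P(1) by auto
    then show "x \<in> {1..m - 1}" by auto
  qed
  have "r \<le> lo (U - {m}) (lowered r)" if r: "r \<le> h" for r
  proof (cases "r = h")
    case True
    then show ?thesis
      using lo_eq_card[OF sub, of "m - 1"] assms card_Suc_Diff1[OF fin assms(2)] by simp
  next
    case False
    then have "\<phi> r < m" using below r by simp
    then show ?thesis using lo_remove[OF fin assms(2), of "\<phi> r"] P(2)[OF r] False by simp
  qed
  moreover have "hi (U - {m}) (m - 1) = 0" using hi_eq_0[OF sub, of "m - 1"] by simp
  ultimately show ?thesis using sub unfolding column_def by auto
qed

text \<open>A surplus label below \<open>h\<close> allows only one entry beyond
  \<open>\<phi> (h - 1)\<close>. This entry is \<open>m\<close>, so without it the column ends at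
  the flag of row \<open>h - 1\<close>.\<close>

lemma column_shorten:
  assumes "U \<in> column \<phi> h \<rho>" "m \<in> U" "\<rho> < h"
  shows "U - {m} \<in> column \<phi> (h - 1) \<rho>"
proof -
  have m: "\<phi> h = m" using above h by simp
  have P: "U \<subseteq> {1..m}" "\<And>r. r \<le> h \<Longrightarrow> r \<le> lo U (\<phi> r)"
    "\<And>r. \<rho> \<le> r \<Longrightarrow> r \<le> h \<Longrightarrow> hi U (\<phi> r) + r \<le> h"
    using assms m unfolding column_def by auto
  have fin: "finite U" using P finite_subset by blast
  have lo: "lo (U - {m}) (\<phi> r) = lo U (\<phi> r)" "hi U (\<phi> r) = Suc (hi (U - {m}) (\<phi> r))" if "r < h" for r
    using lo_remove[OF fin assms(2), of "\<phi> r"] hi_remove[OF fin assms(2), of "\<phi> r"] below[OF that] by auto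
  have "hi (U - {m}) (\<phi> (h - 1)) = 0" using P(3)[of "h - 1"] lo(2)[of "h - 1"] assms(3) by simp
  then have "(U - {m}) \<inter> {\<phi> (h - 1)<..} = {}" using fin by simp
  then have "U - {m} \<subseteq> {..\<phi> (h - 1)}" by (metis Compl_greaterThan disjoint_eq_subset_Compl)
  then have "U - {m} \<subseteq> {1..\<phi> (h - 1)}" using P(1) by fastforce
  moreover have "r \<le> lo (U - {m}) (\<phi> r)" if "r \<le> h - 1" for r
    using P(2)[of r] lo(1)[of r] that h by simp
  moreover have "hi (U - {m}) (\<phi> r) + r \<le> h - 1" if "\<rho> \<le> r" "r \<le> h - 1" for r
    using P(3)[of r] lo(2)[of r] that h by fastforce
  ultimately show ?thesis using assms(3) unfolding column_def by simp
qed

lemma column_extend: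
  assumes "U \<in> column \<phi> (h - 1) \<rho>"
  shows "m \<notin> U" "insert m U \<in> column \<phi> h \<rho>"
proof -
  have m: "\<phi> h = m" using above h by simp
  have lt: "\<phi> (h - 1) < m" using below h by simp
  have P: "U \<subseteq> {1..\<phi> (h - 1)}" "\<rho> \<le> h - 1" "\<And>r. r \<le> h - 1 \<Longrightarrow> r \<le> lo U (\<phi> r)"
    "\<And>r. \<rho> \<le> r \<Longrightarrow> r \<le> h - 1 \<Longrightarrow> hi U (\<phi> r) + r \<le> h - 1"
    using assms unfolding column_def by auto
  show mU: "m \<notin> U" using P(1) lt by auto
  have fin: "finite U" using P finite_subset by blast
  have sub: "insert m U \<subseteq> {1..m}" using P(1) lt m_pos by auto
  have "r \<le> lo (insert m U) (\<phi> r)" if r: "r \<le> h" for r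
  proof (cases "r = h")
    case True
    have "h - 1 \<le> card U" using column_card[OF assms] .
    then show ?thesis using True m lo_eq_card[OF sub, of m] fin mU by simp
  next
    case False
    then have "r \<le> lo U (\<phi> r)" using P(3)[of r] r by simp
    then show ?thesis using lo_insert[OF fin mU, of "\<phi> r"] by simp
  qed
  moreover have "hi (insert m U) (\<phi> r) + r \<le> h" if r: "\<rho> \<le> r" "r \<le> h" for r
  proof (cases "r = h")
    case True
    then show ?thesis using m hi_eq_0[OF sub, of m] by simp
  next
    case False
    then have "hi U (\<phi> r) + r \<le> h - 1" using P(4)[of r] r by simp
    then show ?thesis using hi_insert[OF fin mU, of "\<phi> r"] h by (cases "\<phi> r < m") auto
  qed
  ultimately show "insert m U \<in> column \<phi> h \<rho>" using sub m P(2) unfolding column_def by simp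
qed


text \<open>
  If the surplus row \<open>h\<close> is taken by a column \<open>U1\<close> of height \<open>b > h\<close>, it can be handed over to a
  column \<open>U0\<close> of height \<open>h\<close>, which then absorbs a further entry \<open>m\<close>: the two columns exchange their
  parts below the largest \<open>x\<close> where \<open>U1\<close> has \<open>b - h\<close> more entries above \<open>x\<close> than \<open>U0\<close>.
\<close>

lemma columns_swap:
  assumes U1: "U1 \<in> column \<phi> b h" "h < b" "b \<le> k" and U0: "U0 \<in> column lowered h \<rho>" "\<rho> < h"
  obtains V1 V0 where "V1 \<in> column \<phi> b \<rho>" "V0 \<in> column \<phi> h h"
    "\<And>l. of_bool (l \<in> V1) + of_bool (l \<in> V0) = of_bool (l \<in> U1) + of_bool (l \<in> U0) + (of_bool (l = m) :: nat)"
proof -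
  have m: "\<phi> h = m" "\<phi> b = m" using above h U1 by auto
  have P1: "U1 \<subseteq> {1..m}" "\<And>r. r \<le> b \<Longrightarrow> r \<le> lo U1 (\<phi> r)" "\<And>r. h \<le> r \<Longrightarrow> r \<le> b \<Longrightarrow> hi U1 (\<phi> r) + r \<le> b"
    using U1 m unfolding column_def by auto
  have mU0: "m \<notin> U0" and U0': "U0 \<in> column \<phi> h \<rho>" using column_lowered_subset[OF U0(1)] by auto
  then have P0: "U0 \<subseteq> {1..m}" "\<And>r. r \<le> h \<Longrightarrow> r \<le> lo U0 (\<phi> r)" "\<And>r. \<rho> \<le> r \<Longrightarrow> r \<le> h \<Longrightarrow> hi U0 (\<phi> r) + r \<le> h"
    using m unfolding column_def by auto
  have fin: "finite U1" "finite U0" using P1(1) P0(1) finite_subset by blast+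
  define a c where "a x = hi U1 x" and "c x = hi U0 x" for x
  define \<delta> where "\<delta> = b - h"
  have \<delta>: "b = h + \<delta>" "0 < \<delta>" using U1(2) by (auto simp: \<delta>_def)
  have card1: "lo U1 x + a x = card U1" for x using lo_hi[OF fin(1)] by (simp add: a_def)
  have card0: "lo U0 x + c x = card U0" for x using lo_hi[OF fin(2)] by (simp add: c_def)
  have c_bound: "c (\<phi> r) + r \<le> h" if "\<rho> \<le> r" "r \<le> h" for r using P0(3)[OF that] by (simp add: c_def)
  have a_m: "a x = 0" "c x = 0" if "m \<le> x" for x
    using hi_eq_0[OF P1(1) that] hi_eq_0[OF P0(1) that] by (auto simp: a_def c_def)
  show ?thesis
  proof (cases "\<exists>x. \<phi> \<rho> \<le> x \<and> c x + \<delta> \<le> a x")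
    case False
    \<comment> \<open>Without such an \<open>x\<close>, \<open>U1\<close> itself meets the surplus
      conditions from row \<open>\<rho>\<close> on: the columns only trade their labels, and
      \<open>m\<close> joins \<open>U0\<close>.\<close>
    then have less: "a x < c x + \<delta>" if "\<phi> \<rho> \<le> x" for x using that by (meson not_le)
    have "hi U1 (\<phi> r) + r \<le> b" if r: "\<rho> \<le> r" "r \<le> b" for r
    proof (cases "h \<le> r")
      case True
      then show ?thesis using P1(3) r by blast
    next
      case False
      then have "\<phi> \<rho> \<le> \<phi> r" using mono[of \<rho> r] r U1 by simp
      then show ?thesis using less[of "\<phi> r"] c_bound[of r] r False \<delta> by (simp add: a_def)
    qed
    then have "U1 \<in> column \<phi> b \<rho>" using P1 m U0(2) U1(2) unfolding column_def by simp
    moreover have "insert m U0 \<in> column \<phi> h h" by (rule column_raise[OF U0(1)])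
    ultimately show ?thesis using that[of U1 "insert m U0"] mU0 by (auto simp: of_bool_def)
  next
    case True
    define X where "X = {x. \<phi> \<rho> \<le> x \<and> c x + \<delta> \<le> a x}"
    have Xm: "x < m" if "x \<in> X" for x
      using that a_m[of x] \<delta>(2) unfolding X_def by (metis (mono_tags, lifting) add_is_0 le_zero_eq mem_Collect_eq not_gr_zero not_le)
    have "finite X" using Xm by (intro finite_subset[of X "{..<m}"]) auto
    moreover have "X \<noteq> {}" using True unfolding X_def by blast
    ultimately obtain x where xX: "x \<in> X" and xmax: "\<And>y. y \<in> X \<Longrightarrow> y \<le> x"
      using Max_in[of X] Max_ge[of X] by metis
    have x: "\<phi> \<rho> \<le> x" "c x + \<delta> \<le> a x" "x < m" using xX Xm unfolding X_def by auto
    have gt: "a y < c y + \<delta>" if "x < y" for y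
    proof (rule ccontr)
      assume "\<not> a y < c y + \<delta>"
      then have "y \<in> X" using x(1) that unfolding X_def by simp
      then show False using xmax[of y] that by simp
    qed
    have "a x \<le> a (Suc x) + 1"
    proof -
      have "U1 \<inter> {x<..} \<subseteq> insert (Suc x) (U1 \<inter> {Suc x<..})" by auto
      then have "a x \<le> card (insert (Suc x) (U1 \<inter> {Suc x<..}))"
        unfolding a_def using fin by (intro card_mono) auto
      then show ?thesis using fin by (simp add: a_def)
    qed
    moreover have "c (Suc x) \<le> c x" unfolding c_def using fin by (intro hi_mono) auto
    \<comment> \<open>From \<open>x\<close> to \<open>Suc x\<close>, \<open>a\<close> drops by at
      most one and \<open>c\<close> does not grow, so the inequality is an equality at the last
      place where it holds.\<close>
    ultimately have eq: "a x = c x + \<delta>" using gt[of "Suc x"] x(2) by simp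
    define V1 where "V1 = (U1 \<inter> {x<..}) \<union> (U0 \<inter> {..x})"
    define W where "W = (U0 \<inter> {x<..}) \<union> (U1 \<inter> {..x})"
    have mW: "m \<notin> W" using mU0 x(3) by (auto simp: W_def)
    have finV: "finite V1" "finite W" using fin by (auto simp: V1_def W_def)
    have cardV1: "card V1 = a x + lo U0 x"
      unfolding V1_def a_def using fin by (intro card_Un_disjoint) auto
    have cardW: "card W = c x + lo U1 x"
      unfolding W_def c_def using fin by (intro card_Un_disjoint) auto
    have low: "lo V1 y = lo U0 y" "lo W y = lo U1 y" if "y \<le> x" for y
      by (rule arg_cong[of _ _ card], use that in \<open>auto simp: V1_def W_def\<close>)+
    have high: "hi V1 y = a y" "hi W y = c y" if "x \<le> y" for y
      unfolding a_def c_def by (rule arg_cong[of _ _ card], use that in \<open>auto simp: V1_def W_def\<close>)+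
    have subV: "V1 \<subseteq> {1..m}" "insert m W \<subseteq> {1..m}"
      using P1(1) P0(1) m_pos unfolding V1_def W_def by auto
    have "r \<le> lo V1 (\<phi> r)" if r: "r \<le> b" for r
    proof (cases "\<phi> r \<le> x")
      case True
      have "r < h"
      proof (rule ccontr)
        assume "\<not> r < h"
        then have "\<phi> r = m" using above[of r] r U1(3) by simp
        then show False using True x(3) by simp
      qed
      then show ?thesis using low(1)[OF True] P0(2)[of r] by simp
    next
      case False
      \<comment> \<open>By the equality at \<open>x\<close>, \<open>V1\<close> has exactly
        \<open>\<delta>\<close> more entries than \<open>U0\<close>.\<close>
      then have "lo V1 (\<phi> r) + a (\<phi> r) = card U0 + \<delta>"
        using lo_hi[OF finV(1), of "\<phi> r"] high(1)[of "\<phi> r"] cardV1 card0[of x] eq by simp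
      moreover have "a (\<phi> r) < c (\<phi> r) + \<delta>" using gt False by simp
      moreover have "a (\<phi> r) = 0 \<and> b \<le> card U0 + \<delta>" if "h \<le> r"
        using above[OF that] r U1(3) a_m column_card[OF U0'] \<delta>(1) by simp
      moreover have "r + c (\<phi> r) \<le> card U0" if "r < h"
        using P0(2)[of r] card0[of "\<phi> r"] that by simp
      ultimately show ?thesis using r by (cases "h \<le> r") linarith+
    qed
    moreover have "hi V1 (\<phi> r) + r \<le> b" if r: "\<rho> \<le> r" "r \<le> b" for r
    proof (cases "h \<le> r")
      case True
      then have "\<phi> r = m" using above r U1(3) by simp
      then show ?thesis using hi_eq_0[OF subV(1), of m] r by simp
    next
      case False
      then have cb: "c (\<phi> r) + r \<le> h" using c_bound r by simp
      show ?thesis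
      proof (cases "x \<le> \<phi> r")
        case True
        then have "a (\<phi> r) \<le> c (\<phi> r) + \<delta>" using gt[of "\<phi> r"] eq by (cases "x = \<phi> r") auto
        then show ?thesis using high(1)[OF True] cb \<delta>(1) by linarith
      next
        case False
        then have "hi V1 (\<phi> r) + lo U0 (\<phi> r) = a x + lo U0 x"
          using lo_hi[OF finV(1), of "\<phi> r"] low(1)[of "\<phi> r"] cardV1 by simp
        then show ?thesis using card0[of x] card0[of "\<phi> r"] eq cb \<delta>(1) by linarith
      qed
    qed
    ultimately have "V1 \<in> column \<phi> b \<rho>" using subV(1) m U0(2) U1(2) unfolding column_def by simp
    moreover have "insert m W \<in> column \<phi> h h"
    proof -
      have lo: "r \<le> lo (insert m W) (\<phi> r)" if r: "r \<le> h" for r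
      proof -
        have "r \<le> lo W (\<phi> r)"
        proof (cases "\<phi> r \<le> x")
          case True
          then show ?thesis using low(2) P1(2)[of r] r U1(2) by simp
        next
          case False
          \<comment> \<open>Rows before \<open>\<rho>\<close> have flags at most
            \<open>\<phi> \<rho> \<le> x\<close>; this is why \<open>x\<close> was sought from
            \<open>\<phi> \<rho>\<close> on.\<close>
          have "\<rho> \<le> r"
          proof (rule ccontr)
            assume "\<not> \<rho> \<le> r"
            then have "\<phi> r \<le> \<phi> \<rho>" using mono[of r \<rho>] U0(2) h by simp
            then show False using False x(1) by simp
          qed
          then have "c (\<phi> r) + r \<le> h" using c_bound r by simp
          moreover have "lo W (\<phi> r) + c (\<phi> r) = c x + lo U1 x"
            using lo_hi[OF finV(2), of "\<phi> r"] high(2)[of "\<phi> r"] False cardW by simp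
          ultimately show ?thesis using card1[of x] column_card[OF U1(1)] eq \<delta>(1) by linarith
        qed
        then show ?thesis using lo_insert[OF finV(2) mW, of "\<phi> r"] by simp
      qed
      have "hi (insert m W) (\<phi> r) + r \<le> h" if "h \<le> r" "r \<le> h" for r
        using hi_eq_0[OF subV(2), of m] that m by simp
      with subV(2) lo show ?thesis using m by (intro columnI) auto
    qed
    moreover have "of_bool (l \<in> V1) + of_bool (l \<in> insert m W)
        = of_bool (l \<in> U1) + of_bool (l \<in> U0) + (of_bool (l = m) :: nat)" for l
      using mW mU0 x(3) by (cases "l \<le> x"; cases "l = m") (auto simp: V1_def W_def)
    ultimately show ?thesis using that by blast
  qed
qed

end

text \<open>
  Up to support, a flagged set-valued tableau is a family of independent columns, except that
  every row is the surplus row \<open>\<rho>\<close> of at most one column.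
\<close>

definition fillings :: "(nat \<Rightarrow> nat) \<Rightarrow> 'a set \<Rightarrow> ('a \<Rightarrow> nat) \<Rightarrow> (nat \<Rightarrow> nat) set"
  where "fillings \<phi> J b = {weight J U | U \<rho>. (\<forall>j\<in>J. U j \<in> column \<phi> (b j) (\<rho> j)) \<and>
    (\<forall>i\<in>J. \<forall>j\<in>J. \<rho> i = \<rho> j \<and> \<rho> i \<noteq> 0 \<longrightarrow> i = j)}"

lemma fillingsI:
  assumes "\<And>j. j \<in> J \<Longrightarrow> U j \<in> column \<phi> (b j) (\<rho> j)"
    and "\<And>i j. i \<in> J \<Longrightarrow> j \<in> J \<Longrightarrow> \<rho> i = \<rho> j \<Longrightarrow> \<rho> i \<noteq> 0 \<Longrightarrow> i = j"
    and "\<And>l. weight J U l = q l"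
  shows "q \<in> fillings \<phi> J b"
proof -
  have "q = weight J U" using assms(3) by auto
  then show ?thesis unfolding fillings_def using assms(1,2) by blast
qed

lemma fillingsE:
  assumes "q \<in> fillings \<phi> J b"
  obtains U \<rho> where "\<And>j. j \<in> J \<Longrightarrow> U j \<in> column \<phi> (b j) (\<rho> j)"
    and "\<And>i j. i \<in> J \<Longrightarrow> j \<in> J \<Longrightarrow> \<rho> i = \<rho> j \<Longrightarrow> \<rho> i \<noteq> 0 \<Longrightarrow> i = j"
    and "q = weight J U"
  using assms unfolding fillings_def by blast

lemma column_rank_le: "U \<in> column \<phi> b \<rho> \<Longrightarrow> \<rho> \<le> b"
  by (simp add: column_def)

section \<open>The recursion for fillings\<close>

context last_flag
begin

lemma fillings_lowered_subset:
  assumes "\<And>j. j \<in> J \<Longrightarrow> b j \<le> k" "q \<in> fillings lowered J b"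
  shows "q \<in> fillings \<phi> J b"
  using assms(2)
proof (rule fillingsE)
  fix U \<rho> assume U: "\<And>j. j \<in> J \<Longrightarrow> U j \<in> column lowered (b j) (\<rho> j)"
    and R: "\<And>i j. i \<in> J \<Longrightarrow> j \<in> J \<Longrightarrow> \<rho> i = \<rho> j \<Longrightarrow> \<rho> i \<noteq> 0 \<Longrightarrow> i = j" and q: "q = weight J U"
  show ?thesis
  proof (rule fillingsI[of J U _ _ \<rho>])
    show "U j \<in> column \<phi> (b j) (\<rho> j)" if "j \<in> J" for j
      using U[OF that] column_lowered_other[of "b j"] column_lowered_subset[of "U j" "\<rho> j"] assms(1)[OF that]
      by (cases "b j = h") auto
  qed (use R q in auto)
qed

lemma fillings_lowered_eq:
  assumes "\<And>j. j \<in> J \<Longrightarrow> b j \<le> k \<and> b j \<noteq> h"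
  shows "fillings lowered J b = fillings \<phi> J b"
proof -
  have "(\<forall>j\<in>J. U j \<in> column lowered (b j) (\<rho> j)) \<longleftrightarrow> (\<forall>j\<in>J. U j \<in> column \<phi> (b j) (\<rho> j))" for U \<rho>
    using column_lowered_other assms by simp
  then show ?thesis unfolding fillings_def by simp
qed

lemma fillings_extend:
  assumes "finite J" "j \<in> J" "b j = h" "q \<in> fillings \<phi> J (b(j := h - 1))"
  shows "(\<lambda>l. q l + of_bool (l = m)) \<in> fillings \<phi> J b"
  using assms(4)
proof (rule fillingsE)
  fix U \<rho> assume U: "\<And>i. i \<in> J \<Longrightarrow> U i \<in> column \<phi> ((b(j := h - 1)) i) (\<rho> i)"
    and R: "\<And>i j. i \<in> J \<Longrightarrow> j \<in> J \<Longrightarrow> \<rho> i = \<rho> j \<Longrightarrow> \<rho> i \<noteq> 0 \<Longrightarrow> i = j" and q: "q = weight J U"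
  have "U j \<in> column \<phi> (h - 1) (\<rho> j)" using U[OF assms(2)] by simp
  note ext = column_extend[OF this]
  show ?thesis
  proof (rule fillingsI[of J "U(j := insert m (U j))" _ _ \<rho>])
    show "(U(j := insert m (U j))) i \<in> column \<phi> (b i) (\<rho> i)" if "i \<in> J" for i
      using U[OF that] ext(2) assms(3) by (cases "i = j") auto
    show "weight J (U(j := insert m (U j))) l = q l + of_bool (l = m)" for l
      using weight_update[OF assms(1,2), of U "insert m (U j)" l] ext(1) q
      by (cases "l = m"; cases "l \<in> U j") auto
  qed (use R in blast)
qed

text \<open>The new \<open>m\<close> needs a column of height \<open>h\<close> with surplus row
  \<open>h\<close>. Either such a column exists, or the row is free and \<open>j0\<close> takes it,
  or a taller column holds it and \<open>columns_swap\<close> hands it over.\<close>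

lemma fillings_raise:
  assumes J: "finite J" "j0 \<in> J" "b j0 = h" and bk: "\<And>j. j \<in> J \<Longrightarrow> b j \<le> k"
    and "q \<in> fillings lowered J b"
  shows "(\<lambda>l. q l + of_bool (l = m)) \<in> fillings \<phi> J b"
  using assms(5)
proof (rule fillingsE)
  fix U \<rho> assume U: "\<And>j. j \<in> J \<Longrightarrow> U j \<in> column lowered (b j) (\<rho> j)"
    and R: "\<And>i j. i \<in> J \<Longrightarrow> j \<in> J \<Longrightarrow> \<rho> i = \<rho> j \<Longrightarrow> \<rho> i \<noteq> 0 \<Longrightarrow> i = j" and q: "q = weight J U"
  have U\<phi>: "U j \<in> column \<phi> (b j) (\<rho> j)" if "j \<in> J" for j
    using U[OF that] column_lowered_other[of "b j"] column_lowered_subset[of "U j" "\<rho> j"] bk[OF that]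
    by (cases "b j = h") auto
  have raise: "weight J (U(j := insert m (U j))) l = q l + of_bool (l = m)" if "j \<in> J" "m \<notin> U j" for j l
    using weight_update[OF J(1) that(1), of U "insert m (U j)" l] that(2) q
    by (cases "l = m"; cases "l \<in> U j") auto
  consider j where "j \<in> J" "b j = h" "\<rho> j = h" | "\<And>j. j \<in> J \<Longrightarrow> \<rho> j \<noteq> h"
    | j where "j \<in> J" "b j \<noteq> h" "\<rho> j = h" "\<rho> j0 \<noteq> h"
    using J(2,3) by blast
  then show ?thesis
  proof cases
    case 1
    have Uj: "U j \<in> column lowered h h" using U[OF 1(1)] 1 by simp
    show ?thesis
    proof (rule fillingsI[of J "U(j := insert m (U j))" _ _ \<rho>])
      show "(U(j := insert m (U j))) i \<in> column \<phi> (b i) (\<rho> i)" if "i \<in> J" for i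
        using U\<phi>[OF that] column_raise[OF Uj] 1 by (cases "i = j") auto
      show "weight J (U(j := insert m (U j))) l = q l + of_bool (l = m)" for l
        using raise[OF 1(1)] column_lowered_subset[OF Uj] by blast
    qed (use R in blast)
  next
    case 2
    have Uj: "U j0 \<in> column lowered h (\<rho> j0)" using U[OF J(2)] J(3) by simp
    show ?thesis
    proof (rule fillingsI[of J "U(j0 := insert m (U j0))" _ _ "\<rho>(j0 := h)"])
      show "(U(j0 := insert m (U j0))) i \<in> column \<phi> (b i) ((\<rho>(j0 := h)) i)" if "i \<in> J" for i
        using U\<phi>[OF that] column_raise[OF Uj] J(3) by (cases "i = j0") auto
      show "weight J (U(j0 := insert m (U j0))) l = q l + of_bool (l = m)" for l
        using raise[OF J(2)] column_lowered_subset[OF Uj] by blast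
      show "i = j" if "i \<in> J" "j \<in> J" "(\<rho>(j0 := h)) i = (\<rho>(j0 := h)) j" "(\<rho>(j0 := h)) i \<noteq> 0" for i j
        using R[of i j] 2[of i] 2[of j] that by (auto split: if_splits)
    qed
  next
    case 3
    have neq: "j \<noteq> j0" using 3 by auto
    have Uj0: "U j0 \<in> column lowered h (\<rho> j0)" using U[OF J(2)] J(3) by simp
    then have less: "\<rho> j0 < h" using column_rank_le 3(4) by (meson le_neq_implies_less)
    have Uj: "U j \<in> column \<phi> (b j) h" using U\<phi>[OF 3(1)] 3(3) by simp
    then have "h < b j" using column_rank_le[OF Uj] 3(2) by simp
    then obtain V1 V0 where V: "V1 \<in> column \<phi> (b j) (\<rho> j0)" "V0 \<in> column \<phi> h h"
      "\<And>l. of_bool (l \<in> V1) + of_bool (l \<in> V0) = of_bool (l \<in> U j) + of_bool (l \<in> U j0) + (of_bool (l = m) :: nat)"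
      using columns_swap[OF Uj _ bk[OF 3(1)] Uj0 less] by blast
    show ?thesis
    proof (rule fillingsI[of J "U(j := V1, j0 := V0)" _ _ "\<rho>(j := \<rho> j0, j0 := h)"])
      show "(U(j := V1, j0 := V0)) i \<in> column \<phi> (b i) ((\<rho>(j := \<rho> j0, j0 := h)) i)" if "i \<in> J" for i
        using U\<phi>[OF that] V(1,2) J(3) neq by auto
      show "weight J (U(j := V1, j0 := V0)) l = q l + of_bool (l = m)" for l
      proof -
        have "weight J (U(j := V1, j0 := V0)) l + of_bool (l \<in> U j0) = weight J (U(j := V1)) l + of_bool (l \<in> V0)"
          using weight_update[OF J(1,2), of "U(j := V1)" V0 l] neq by simp
        then show ?thesis
          unfolding q using weight_update[OF J(1) 3(1), of U V1 l] V(3)[of l] by linarith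
      qed
      show "x = y" if xy: "x \<in> J" "y \<in> J" "(\<rho>(j := \<rho> j0, j0 := h)) x = (\<rho>(j := \<rho> j0, j0 := h)) y"
        "(\<rho>(j := \<rho> j0, j0 := h)) x \<noteq> 0" for x y
      proof -
        \<comment> \<open>The labels are merely interchanged between \<open>j\<close> and
          \<open>j0\<close>, so no surplus row comes to be shared.\<close>
        define \<sigma> where "\<sigma> x = (if x = j then j0 else if x = j0 then j else x)" for x
        have eq: "(\<rho>(j := \<rho> j0, j0 := h)) x = \<rho> (\<sigma> x)" for x
          using 3(3) neq by (simp add: \<sigma>_def)
        have "\<sigma> x \<in> J" "\<sigma> y \<in> J" using xy(1,2) J(2) 3(1) by (simp_all add: \<sigma>_def)
        then have "\<sigma> x = \<sigma> y" using R[of "\<sigma> x" "\<sigma> y"] xy(3,4) unfolding eq by blast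
        then show ?thesis using neq by (simp add: \<sigma>_def split: if_splits)
      qed
    qed
  qed
qed

text \<open>The outcomes match the terms of the recursion: \<open>m\<close> times a filling with a
  shorter column, a filling for the lowered flag, and \<open>m\<close> times the latter. The last
  one remains when every column of height \<open>h\<close> containing \<open>m\<close> has surplus
  row \<open>h\<close> and more than \<open>h\<close> entries.\<close>

lemma fillings_cases:
  assumes J: "finite J" and bk: "\<And>j. j \<in> J \<Longrightarrow> b j \<le> k" and "q \<in> fillings \<phi> J b"
  obtains j q' where "j \<in> J" "b j = h" "q' \<in> fillings \<phi> J (b(j := h - 1))" "\<And>l. q l = q' l + of_bool (l = m)"
  | "q \<in> fillings lowered J b"
  | j q' where "j \<in> J" "b j = h" "q' \<in> fillings lowered J b" "\<And>l. q l = q' l + of_bool (l = m)"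
  using assms(3)
proof (rule fillingsE)
  fix U \<rho> assume U: "\<And>j. j \<in> J \<Longrightarrow> U j \<in> column \<phi> (b j) (\<rho> j)"
    and R: "\<And>i j. i \<in> J \<Longrightarrow> j \<in> J \<Longrightarrow> \<rho> i = \<rho> j \<Longrightarrow> \<rho> i \<noteq> 0 \<Longrightarrow> i = j" and q: "q = weight J U"
  have drop: "q l = weight J (U(j := U j - {m})) l + of_bool (l = m)" if "j \<in> J" "m \<in> U j" for j l
    using weight_update[OF J that(1), of U "U j - {m}" l] that(2) q
    by (cases "l = m"; cases "l \<in> U j") auto
  have low: "U i \<in> column lowered (b i) (\<rho> i)" if "i \<in> J" "b i = h \<Longrightarrow> m \<notin> U i" for i
    using U[OF that(1)] that(2) column_lowered_other[of "b i"] column_lowered_if[of "U i" "\<rho> i"] bk[OF that(1)]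
    by (cases "b i = h") auto
  consider j where "j \<in> J" "b j = h" "m \<in> U j" "\<rho> j < h \<or> card (U j) = h"
    | "\<And>j. j \<in> J \<Longrightarrow> b j = h \<Longrightarrow> m \<notin> U j"
    | j where "j \<in> J" "b j = h" "m \<in> U j" "\<And>i. i \<in> J \<Longrightarrow> b i = h \<Longrightarrow> m \<in> U i \<Longrightarrow> \<not> (\<rho> i < h \<or> card (U i) = h)"
    by blast
  then show ?thesis
  proof cases
    case 1
    \<comment> \<open>A column with exactly \<open>h\<close> entries has no surplus, so its label
      \<open>h\<close> may be dropped to 0; \<open>column_shorten\<close> asks for a label below
      \<open>h\<close>.\<close>
    define r where "r = (if \<rho> j < h then \<rho> j else 0)"
    have "U j \<in> column \<phi> h r"
    proof (cases "\<rho> j < h")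
      case True
      then show ?thesis using U[OF 1(1)] 1(2) by (simp add: r_def)
    next
      case False
      then have "card (U j) = h" using 1(4) by simp
      moreover have "U j \<in> column \<phi> h (\<rho> j)" using U[OF 1(1)] 1(2) by simp
      ultimately have "U j \<in> column \<phi> h 0"
        unfolding column_zero_iff[of \<phi>, OF zero] by (simp add: column_def)
      then show ?thesis using False by (simp add: r_def)
    qed
    then have short: "U j - {m} \<in> column \<phi> (h - 1) r"
      using 1(3) h by (intro column_shorten) (auto simp: r_def)
    have "weight J (U(j := U j - {m})) \<in> fillings \<phi> J (b(j := h - 1))"
    proof (rule fillingsI[of J "U(j := U j - {m})" _ _ "\<rho>(j := r)"])
      show "(U(j := U j - {m})) i \<in> column \<phi> ((b(j := h - 1)) i) ((\<rho>(j := r)) i)" if "i \<in> J" for i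
        using U[OF that] short by (cases "i = j") auto
      show "x = y" if xy: "x \<in> J" "y \<in> J" "(\<rho>(j := r)) x = (\<rho>(j := r)) y" "(\<rho>(j := r)) x \<noteq> 0" for x y
      proof -
        have "r = \<rho> j \<or> r = 0" by (simp add: r_def)
        then show ?thesis using R[of x y] xy 1(1) by (cases "x = j"; cases "y = j") auto
      qed
    qed simp
    then show ?thesis using that(1) 1(1,2) drop[OF 1(1,3)] by blast
  next
    case 2
    have "q \<in> fillings lowered J b"
      by (rule fillingsI[of J U _ _ \<rho>]) (use low 2 R q in auto)
    then show ?thesis by (rule that(2))
  next
    case 3
    have rank: "\<rho> i = h" if "i \<in> J" "b i = h" "m \<in> U i" for i
      using 3(4)[OF that] column_rank_le[OF U[OF that(1)]] that(2) by simp
    have Uj: "U j \<in> column \<phi> h h" using U[OF 3(1)] rank[OF 3(1-3)] 3(2) by simp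
    have "h < card (U j)" using column_card[OF Uj] 3(4)[OF 3(1-3)] by simp
    note un = column_unraise[OF Uj 3(3) this]
    \<comment> \<open>Two such columns would share the surplus row \<open>h\<close>.\<close>
    have only: "m \<notin> U i" if "i \<in> J" "b i = h" "i \<noteq> j" for i
      using R[of i j] rank[of i] rank[of j] 3 that h by auto
    have "weight J (U(j := U j - {m})) \<in> fillings lowered J b"
    proof (rule fillingsI[of J "U(j := U j - {m})" _ _ \<rho>])
      show "(U(j := U j - {m})) i \<in> column lowered (b i) (\<rho> i)" if "i \<in> J" for i
        using low[OF that] only[OF that] un 3(2) rank[OF 3(1-3)] by (cases "i = j") auto
    qed (use R in auto)
    then show ?thesis using that(3) 3(1,2) drop[OF 3(1,3)] by blast
  qed
qed

end

section \<open>The support\<close>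

definition exp_degree :: "expvec \<Rightarrow> nat"
  where "exp_degree q = (\<Sum>i\<in>Poly_Mapping.keys q. Poly_Mapping.lookup q i)"

lemma exp_degree_add_single: "exp_degree (q + Poly_Mapping.single m 1) = Suc (exp_degree q)"
proof -
  let ?S = "insert m (Poly_Mapping.keys q)"
  have deg: "exp_degree r = (\<Sum>i\<in>?S. Poly_Mapping.lookup r i)" if "Poly_Mapping.keys r \<subseteq> ?S" for r
    unfolding exp_degree_def using that by (intro sum.mono_neutral_left) (auto simp: in_keys_iff)
  have "Poly_Mapping.keys (q + Poly_Mapping.single m 1) \<subseteq> ?S"
    by (auto simp: in_keys_iff lookup_add lookup_single when_def split: if_splits)
  from deg[OF this] deg[OF subset_insertI] show ?thesis
    by (simp add: lookup_add sum.distrib lookup_single when_def)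
qed

lemma coefficient_xvar_mult: "coefficient (xvar m * f) (q + Poly_Mapping.single m 1) = coefficient f q"
proof (induction f rule: ipoly_induct)
  case (single r c)
  have "Poly_Mapping.single m 1 + r = q + Poly_Mapping.single m 1 \<longleftrightarrow> r = q"
    by (simp add: add.commute)
  then show ?case
    by (simp add: xvar_def monomial_def mult_single lookup_single when_def)
qed (simp_all add: distrib_left lookup_add)

lemma coefficient_monomial_mult_nonzero:
  "coefficient (monomial p * f) q \<noteq> 0 \<Longrightarrow> \<exists>r. q = p + r"
proof (induction f rule: ipoly_induct)
  case (single r c)
  then show ?case
    by (auto simp: monomial_def mult_single lookup_single when_def split: if_splits)
next
  case (add f g)
  then show ?case
    by (cases "coefficient (monomial p * f) q = 0") (simp_all add: distrib_left lookup_add)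
qed simp

lemma monomial_dvd_imp_le:
  assumes "monomial p dvd monomial q"
  shows "Poly_Mapping.lookup p i \<le> Poly_Mapping.lookup q i"
proof -
  obtain f where f: "monomial q = monomial p * f" using assms by (elim dvdE)
  have "coefficient (monomial p * f) q \<noteq> 0" unfolding f[symmetric] by (simp add: monomial_def)
  then show ?thesis using coefficient_monomial_mult_nonzero by (metis lookup_add le_add1)
qed

section \<open>Signs and the absence of cancellation\<close>

text \<open>\<open>N\<close> stands for the number of boxes of the shape; every surplus entry of a
  tableau changes the sign.\<close>

definition alternating :: "nat \<Rightarrow> ipoly \<Rightarrow> bool"
  where "alternating N f \<longleftrightarrow> (\<forall>q. 0 \<le> (- 1) ^ (N + exp_degree q) * coefficient f q)"

lemma alternatingD: "alternating N f \<Longrightarrow> 0 \<le> (- 1) ^ (N + exp_degree q) * coefficient f q"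
  by (simp add: alternating_def)

lemma expvec_split:
  "Poly_Mapping.lookup q m \<noteq> 0 \<Longrightarrow> \<exists>r. q = r + Poly_Mapping.single m (1::nat)"
  by (intro exI[of _ "q - Poly_Mapping.single m 1"] poly_mapping_eqI)
    (auto simp: lookup_add lookup_minus lookup_single when_def)

text \<open>At \<open>q = r + Poly_Mapping.single m 1\<close> the contributions are the coefficients
  of \<open>f1\<close> at \<open>r\<close>, of \<open>f2\<close> at \<open>q\<close>, and minus that
  of \<open>f2\<close> at \<open>r\<close>. The shifts of \<open>N\<close> and of the degree make
  their signs agree.\<close>

lemma alternating_transition:
  assumes f: "f = xvar m * f1 + (1 - xvar m) * f2"
    and "alternating N f1" "alternating (Suc N) f2"
  shows "alternating (Suc N) f"
    and "coefficient f q \<noteq> 0 \<longleftrightarrow> (\<exists>r. q = r + Poly_Mapping.single m 1 \<and> coefficient f1 r \<noteq> 0) \<or>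
      coefficient f2 q \<noteq> 0 \<or> (\<exists>r. q = r + Poly_Mapping.single m 1 \<and> coefficient f2 r \<noteq> 0)"
proof -
  have *: "0 \<le> (- 1) ^ (Suc N + exp_degree q) * coefficient f q \<and>
    (coefficient f q \<noteq> 0 \<longleftrightarrow> (\<exists>r. q = r + Poly_Mapping.single m 1 \<and> coefficient f1 r \<noteq> 0) \<or>
      coefficient f2 q \<noteq> 0 \<or> (\<exists>r. q = r + Poly_Mapping.single m 1 \<and> coefficient f2 r \<noteq> 0))" for q
  proof (cases "Poly_Mapping.lookup q m = 0")
    case True
    have none: "q \<noteq> r + Poly_Mapping.single m 1" for r
      using True by (auto simp: lookup_add)
    have zero: "coefficient (xvar m * g) q = 0" for g
      using coefficient_monomial_mult_nonzero[of "Poly_Mapping.single m 1" g q] none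
      unfolding xvar_def by (metis add.commute)
    have eq: "coefficient f q = coefficient f2 q"
      unfolding f by (simp add: left_diff_distrib lookup_add lookup_minus zero)
    show ?thesis unfolding eq using none alternatingD[OF assms(3), of q] by blast
  next
    case False
    obtain r where r: "q = r + Poly_Mapping.single m 1" using expvec_split[OF False] by (elim exE)
    have uniq: "q = r' + Poly_Mapping.single m 1 \<longleftrightarrow> r' = r" for r'
      unfolding r by (metis add_right_cancel)
    have x: "coefficient (xvar m * g) q = coefficient g r" for g
      unfolding r by (rule coefficient_xvar_mult)
    have c: "coefficient f q = coefficient f1 r + coefficient f2 q - coefficient f2 r"
      unfolding f by (simp add: left_diff_distrib lookup_add lookup_minus x)
    have deg: "exp_degree q = Suc (exp_degree r)" unfolding r by (rule exp_degree_add_single)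
    define e where "e = (- 1 :: int) ^ (N + exp_degree r)"
    have e: "e = 1 \<or> e = - 1" by (simp add: e_def minus_one_power_iff)
    have sgn: "(- 1) ^ (Suc N + exp_degree q) = e" by (simp add: e_def deg)
    have "0 \<le> e * coefficient f1 r" using alternatingD[OF assms(2), of r] by (simp only: e_def)
    moreover have "0 \<le> e * coefficient f2 q" using alternatingD[OF assms(3), of q] by (simp only: sgn)
    moreover have "e * coefficient f2 r \<le> 0" using alternatingD[OF assms(3), of r] by (simp add: e_def)
    ultimately have "0 \<le> e * coefficient f q \<and> (coefficient f q \<noteq> 0 \<longleftrightarrow>
        coefficient f1 r \<noteq> 0 \<or> coefficient f2 q \<noteq> 0 \<or> coefficient f2 r \<noteq> 0)"
      using e unfolding c by auto
    then show ?thesis unfolding sgn uniq by blast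
  qed
  from * show "alternating (Suc N) f" unfolding alternating_def by blast
  from *[of q] show "coefficient f q \<noteq> 0 \<longleftrightarrow> (\<exists>r. q = r + Poly_Mapping.single m 1 \<and> coefficient f1 r \<noteq> 0) \<or>
      coefficient f2 q \<noteq> 0 \<or> (\<exists>r. q = r + Poly_Mapping.single m 1 \<and> coefficient f2 r \<noteq> 0)" by blast
qed

lemma column_zero_height: "\<phi> 0 = 0 \<Longrightarrow> column \<phi> 0 \<rho> = (if \<rho> = 0 then {{}} else {})"
  by (auto simp: column_def)

text \<open>The heights \<open>b\<close> form the conjugate partition of \<open>p\<close>:
  \<open>p r\<close> columns reach row \<open>r\<close>. The index set \<open>J\<close> stays fixed
  while heights shrink. Each step removes an empty last row or a box, or lowers a flag, which is
  what the measure counts.\<close>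

lemma flagged_support:
  assumes J: "finite J" and "\<phi> 0 = 0" and "\<And>r s. r \<le> s \<Longrightarrow> s \<le> k \<Longrightarrow> \<phi> r \<le> \<phi> s"
    and "\<And>r. r \<le> k \<Longrightarrow> r \<le> \<phi> r"
    and "\<And>r s. 1 \<le> r \<Longrightarrow> r \<le> s \<Longrightarrow> p s \<le> p r" and "\<And>r. k < r \<Longrightarrow> p r = 0"
    and "\<And>r. 1 \<le> r \<Longrightarrow> card {j \<in> J. r \<le> b j} = p r"
  shows "alternating (\<Sum>r = 1..k. p r) (flagged p \<phi> k 0) \<and>
    (\<forall>q. coefficient (flagged p \<phi> k 0) q \<noteq> 0 \<longleftrightarrow> Poly_Mapping.lookup q \<in> fillings \<phi> J b)"
  using assms(2-)
proof (induction "k + (\<Sum>r = 1..k. p r) + (\<Sum>r = 1..k. \<phi> r)" arbitrary: k p \<phi> b rule: less_induct)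
  case less
  note IH = less(1) and zero = less(2) and mono = less(3) and ge = less(4) and anti = less(5)
    and p0 = less(6) and shape = less(7)
  have bk: "b j \<le> k" if "j \<in> J" for j
  proof (rule ccontr)
    assume "\<not> b j \<le> k"
    then have "j \<in> {j \<in> J. Suc k \<le> b j}" using that by simp
    moreover have "{j \<in> J. Suc k \<le> b j} = {}"
      using shape[of "Suc k"] p0[of "Suc k"] J by (subst card_0_eq[symmetric]) auto
    ultimately show False by blast
  qed
  show ?case
  proof (cases k)
    case 0
    have b0: "b j = 0" if "j \<in> J" for j using bk[OF that] 0 by simp
    have "fillings \<phi> J b = {\<lambda>_. 0}"
    proof
      show "{\<lambda>_. 0} \<subseteq> fillings \<phi> J b"
        by (auto intro!: fillingsI[of J "\<lambda>_. {}" \<phi> b "\<lambda>_. 0"] simp: b0 column_zero_height[of \<phi>, OF zero] weight_def)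
      show "fillings \<phi> J b \<subseteq> {\<lambda>_. 0}"
      proof
        fix q assume "q \<in> fillings \<phi> J b"
        then show "q \<in> {\<lambda>_. 0}"
        proof (rule fillingsE)
          fix U \<rho> assume U: "\<And>j. j \<in> J \<Longrightarrow> U j \<in> column \<phi> (b j) (\<rho> j)" and q: "q = weight J U"
          have "U j = {}" if "j \<in> J" for j
            using U[OF that] b0[OF that] column_zero_height[of \<phi>, OF zero] by (auto split: if_splits)
          then show ?thesis unfolding q weight_def by (auto simp: fun_eq_iff)
        qed
      qed
    qed
    moreover have "coefficient 1 q \<noteq> 0 \<longleftrightarrow> Poly_Mapping.lookup q = (\<lambda>_. 0)" for q
      by (auto simp: lookup_one when_def poly_mapping_eq_iff fun_eq_iff)
    moreover have "alternating 0 1"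
      unfolding alternating_def by (auto simp: lookup_one when_def exp_degree_def)
    ultimately show ?thesis using 0 by simp
  next
    case (Suc k')
    show ?thesis
    proof (cases "p k = 0")
      case True
      \<comment> \<open>The zero term brings the equation into the form of
        \<open>flagged_linear\<close>, which carries it past the rows above.\<close>
      have "flagged p \<phi> 1 k' = 1 * flagged p \<phi> 0 k' + 0 * flagged p \<phi> 0 k'"
        using flagged_zero_row[of k' \<phi> p] ge[of k] True Suc by simp
      then have "flagged p \<phi> (k' + 1) 0 = 1 * flagged p \<phi> (k' + 0) 0 + 0 * flagged p \<phi> (k' + 0) 0"
        by (intro flagged_linear) auto
      then have eq: "flagged p \<phi> k 0 = flagged p \<phi> k' 0" using Suc by simp
      have sum: "(\<Sum>r = 1..k. p r) = (\<Sum>r = 1..k'. p r)" using Suc True by simp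
      have "p r = 0" if "k' < r" for r using p0[of r] True that Suc by (cases "r = k") auto
      then have "alternating (\<Sum>r = 1..k'. p r) (flagged p \<phi> k' 0) \<and>
        (\<forall>q. coefficient (flagged p \<phi> k' 0) q \<noteq> 0 \<longleftrightarrow> Poly_Mapping.lookup q \<in> fillings \<phi> J b)"
        using Suc sum zero mono ge anti shape by (intro IH) auto
      then show ?thesis using eq sum by simp
    next
      case False
      \<comment> \<open>\<open>h\<close> is the first row with the largest flag: lowering its flag
        keeps the order of the flags, and the chains of the rows above do not touch
        \<open>xvar m\<close>, so the recursion of row \<open>h\<close> passes through them.\<close>
      define m h where "m = \<phi> k" and "h = (LEAST r. \<phi> r = m)"
      have \<phi>h: "\<phi> h = m" unfolding h_def by (rule LeastI[of _ k]) (simp add: m_def)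
      have hk: "h \<le> k" unfolding h_def by (rule Least_le) (simp add: m_def)
      have km: "k \<le> m" using ge[of k] by (simp add: m_def)
      have h1: "1 \<le> h" using \<phi>h zero km Suc by (cases h) auto
      have below: "\<phi> r < m" if "r < h" for r
      proof -
        have "\<phi> r \<noteq> m" using not_less_Least[of r "\<lambda>r. \<phi> r = m"] that unfolding h_def[symmetric] by simp
        moreover have "\<phi> r \<le> m" using mono[of r k] that hk by (simp add: m_def)
        ultimately show ?thesis by simp
      qed
      have above: "\<phi> r = m" if "h \<le> r" "r \<le> k" for r
        using mono[OF that] mono[of r k] that \<phi>h by (simp add: m_def)
      interpret last_flag \<phi> k h m
        by unfold_locales (use zero mono h1 hk below above in auto)
      obtain m' where m': "m = Suc m'" using km Suc by (cases m) auto
      obtain s where s: "h = Suc s" using h1 by (cases h) auto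
      obtain n where n: "k = s + Suc n" using hk s by (metis add_Suc_right add_Suc le_Suc_ex)
      have lowered: "lowered = \<phi>(Suc s := m')" unfolding lowered_def by (simp add: m' s)
      have agree: "r \<noteq> h" if "r \<le> 0 + s" for r using that s by simp
      have invariant: "swap_vars i (xvar m) = xvar m" if "r \<le> s" "i < \<phi> r" for r i
        using below[of r] that s by (intro swap_vars_xvar_other) auto
      have hm: "h \<le> m" using hk km by simp
      have mono': "lowered r \<le> lowered r'" if "r \<le> r'" "r' \<le> k" for r r'
        using mono[OF that] below[of r] above[of r'] that \<phi>h by (auto simp: lowered_def)
      have measure: "(\<Sum>r = 1..k. lowered r) < (\<Sum>r = 1..k. \<phi> r)"
      proof (rule sum_strict_mono_ex1)
        show "\<forall>r\<in>{1..k}. lowered r \<le> \<phi> r" using \<phi>h by (auto simp: lowered_def)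
        show "\<exists>r\<in>{1..k}. lowered r < \<phi> r" using \<phi>h h1 hk m_pos by (intro bexI[of _ h]) auto
      qed simp
      have IHl: "alternating (\<Sum>r = 1..k. p r) (flagged p lowered k 0) \<and>
          (\<forall>q. coefficient (flagged p lowered k 0) q \<noteq> 0 \<longleftrightarrow> Poly_Mapping.lookup q \<in> fillings lowered J b)"
        if "h < m"
      proof (rule IH)
        show "k + (\<Sum>r = 1..k. p r) + (\<Sum>r = 1..k. lowered r) < k + (\<Sum>r = 1..k. p r) + (\<Sum>r = 1..k. \<phi> r)"
          using measure by simp
        show "lowered 0 = 0" using zero h1 by (simp add: lowered_def)
        show "r \<le> lowered r" if "r \<le> k" for r using ge[OF that] \<open>h < m\<close> by (auto simp: lowered_def)
      qed (use mono' anti p0 shape in auto)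
      have pk: "p k \<le> p h" using anti h1 hk by simp
      show ?thesis
      proof (cases "p h = p (Suc h)")
        case True
        \<comment> \<open>If rows \<open>h\<close> and \<open>h + 1\<close> have equal length, no
          column ends in row \<open>h\<close>, and neither the polynomial nor the fillings notice
          that the flag is lowered.\<close>
        then have hk': "Suc h \<le> k" using p0[of "Suc h"] pk False by (metis le_zero_eq not_less_eq_eq not_le)
        then have lt: "h < m" using km by simp
        obtain n' where n': "n = Suc n'" using hk' n s by (cases n) auto
        have "flagged p \<phi> (Suc (Suc n')) s = flagged p lowered (Suc (Suc n')) s"
          unfolding lowered
        proof (rule flagged_equal_rows)
          show "Suc s \<le> m'" using lt s m' by simp
          show "\<phi> (Suc s) = Suc m'" using \<phi>h s m' by simp
          show "\<phi> (Suc (Suc s)) = Suc m'" using above[of "Suc h"] hk' s m' by simp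
          show "\<phi> r \<le> \<phi> r'" if "s < r" "r \<le> r'" "r' \<le> s + Suc (Suc n')" for r r'
            using mono[of r r'] that n n' by simp
        qed (use True s in auto)
        then have "flagged p \<phi> (Suc n) (0 + s) = 1 * flagged p lowered (Suc n) (0 + s) + 0 * flagged p \<phi> 0 (0 + s)"
          using n' by simp
        then have "flagged p \<phi> (s + Suc n) 0 = 1 * flagged p lowered (s + Suc n) 0 + 0 * flagged p \<phi> (s + 0) 0"
          by (rule flagged_linear) (auto simp: lowered)
        then have eq: "flagged p \<phi> k 0 = flagged p lowered k 0" using n by simp
        have "b j \<noteq> h" if "j \<in> J" for j
        proof
          assume "b j = h"
          have "{j \<in> J. Suc h \<le> b j} = {j \<in> J. h \<le> b j}"
            using shape[of h] shape[of "Suc h"] True h1 J by (intro card_subset_eq) auto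
          moreover have "j \<in> {j \<in> J. h \<le> b j}" "j \<notin> {j \<in> J. Suc h \<le> b j}"
            using that \<open>b j = h\<close> by simp_all
          ultimately show False by blast
        qed
        then have "fillings lowered J b = fillings \<phi> J b" using bk by (intro fillings_lowered_eq) auto
        then show ?thesis using IHl[OF lt] eq by simp
      next
        case neq: False
        then have less: "p (Suc h) < p h" using anti[of h "Suc h"] h1 by simp
        obtain j0 where j0: "j0 \<in> J" "b j0 = h"
        proof (rule ccontr)
          assume no: "\<not> thesis"
          have "{j \<in> J. Suc h \<le> b j} = {j \<in> J. h \<le> b j}"
            using no that by (auto simp: Suc_le_eq le_less)
          then show False using shape[of h] shape[of "Suc h"] less h1 by simp
        qed
        obtain c where c: "p h = Suc c" using less by (cases "p h") auto
        let ?p = "p(h := c)"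
        have sum: "(\<Sum>r = 1..k. p r) = Suc (\<Sum>r = 1..k. ?p r)"
        proof -
          have "(\<Sum>r\<in>{1..k} - {h}. ?p r) = (\<Sum>r\<in>{1..k} - {h}. p r)" by (intro sum.cong) auto
          moreover have "finite {1..k}" "h \<in> {1..k}" using h1 hk by auto
          ultimately show ?thesis using c by (simp only: sum.remove fun_upd_same add_Suc)
        qed
        \<comment> \<open>Stated for every column of height \<open>h\<close>, since
          \<open>fillings_cases\<close> does not tell which of them is shortened.\<close>
        have IHp: "alternating (\<Sum>r = 1..k. ?p r) (flagged ?p \<phi> k 0) \<and>
          (\<forall>q. coefficient (flagged ?p \<phi> k 0) q \<noteq> 0 \<longleftrightarrow> Poly_Mapping.lookup q \<in> fillings \<phi> J (b(j := h - 1)))"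
          if j: "j \<in> J" "b j = h" for j
        proof (rule IH)
          show "k + (\<Sum>r = 1..k. ?p r) + (\<Sum>r = 1..k. \<phi> r) < k + (\<Sum>r = 1..k. p r) + (\<Sum>r = 1..k. \<phi> r)"
            unfolding sum by simp
          show "?p r' \<le> ?p r" if "1 \<le> r" "r \<le> r'" for r r'
            using anti[OF that] anti[of "Suc h" r'] less c that by (auto simp: Suc_le_eq)
          show "?p r = 0" if "k < r" for r using p0[OF that] hk that by simp
          show "card {i \<in> J. r \<le> (b(j := h - 1)) i} = ?p r" if "1 \<le> r" for r
          proof (cases "r = h")
            case True
            have "{i \<in> J. r \<le> (b(j := h - 1)) i} = {i \<in> J. h \<le> b i} - {j}"
              using True h1 by auto
            then show ?thesis using shape[OF h1] True c j J by (simp add: card_Diff_singleton)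
          next
            case False
            have "{i \<in> J. r \<le> (b(j := h - 1)) i} = {i \<in> J. r \<le> b i}"
              using False j by auto
            then show ?thesis using shape[OF that] False by simp
          qed
        qed (use zero mono ge in auto)
        have lookup_ext: "Poly_Mapping.lookup (r + Poly_Mapping.single m 1) = (\<lambda>l. Poly_Mapping.lookup r l + of_bool (l = m))" for r :: expvec
          by (auto simp: fun_eq_iff lookup_add lookup_single when_def)
        have split: "\<exists>r. q = r + Poly_Mapping.single m 1 \<and> Poly_Mapping.lookup r = q'"
          if "\<And>l. Poly_Mapping.lookup q l = q' l + of_bool (l = m)" for q :: expvec and q'
        proof -
          have "Poly_Mapping.lookup q m \<noteq> 0" using that[of m] by simp
          then obtain r where r: "q = r + Poly_Mapping.single m 1" by (elim exE[OF expvec_split])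
          then show ?thesis using that lookup_ext[of r] by (intro exI[of _ r]) (auto simp: fun_eq_iff)
        qed
        have "\<exists>f2. flagged p \<phi> k 0 = xvar m * flagged ?p \<phi> k 0 + (1 - xvar m) * f2 \<and>
          alternating (\<Sum>r = 1..k. p r) f2 \<and>
          (\<forall>q. coefficient f2 q \<noteq> 0 \<longleftrightarrow> Poly_Mapping.lookup q \<in> fillings lowered J b)"
        proof (cases "h < m")
          case True
          have "flagged p \<phi> (Suc n) s = xvar (Suc m') * flagged (p(Suc s := c)) \<phi> (Suc n) s
              + (1 - xvar (Suc m')) * flagged p (\<phi>(Suc s := m')) (Suc n) s"
          proof (rule flagged_transition)
            show "Suc s \<le> m'" using True s m' by simp
            show "\<phi> (Suc s) = Suc m'" using \<phi>h s m' by simp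
            show "\<phi> r \<le> \<phi> r'" if "s < r" "r \<le> r'" "r' \<le> s + Suc n" for r r'
              using mono[of r r'] that n by simp
          qed (use c s in auto)
          then have "flagged p \<phi> (Suc n) (0 + s) = xvar m * flagged ?p \<phi> (Suc n) (0 + s)
              + (1 - xvar m) * flagged p lowered (Suc n) (0 + s)"
            unfolding lowered by (simp add: s m')
          then have "flagged p \<phi> (s + Suc n) 0 = xvar m * flagged ?p \<phi> (s + Suc n) 0
              + (1 - xvar m) * flagged p lowered (s + Suc n) 0"
          proof (rule flagged_linear)
            show "?p r = p r \<and> p r = p r \<and> \<phi> r = \<phi> r \<and> lowered r = \<phi> r" if "r \<le> 0 + s" for r
              using agree[OF that] by simp
            show "swap_vars i (xvar m) = xvar m \<and> swap_vars i (1 - xvar m) = 1 - xvar m"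
              if "r \<le> 0 + s" "i < \<phi> r" for r i
              using invariant[of r i] that by simp
          qed
          then show ?thesis using IHl[OF True] n by (intro exI[of _ "flagged p lowered k 0"]) simp
        next
          case False
          \<comment> \<open>The flag of row \<open>h\<close> cannot drop below the row number. The
            chain is empty and the second term vanishes; accordingly a column of height
            \<open>h\<close> does not fit into \<open>h - 1\<close> values.\<close>
          then have eqs: "m = h" "k = h" using hm hk km by auto
          then have n0: "n = 0" using n s by simp
          have "flagged p \<phi> (Suc n) s = xvar (Suc s) * flagged (p(Suc s := c)) \<phi> (Suc n) s"
            by (rule flagged_transition_degenerate) (use \<phi>h c s eqs in auto)
          then have "flagged p \<phi> (Suc n) (0 + s) = xvar m * flagged ?p \<phi> (Suc n) (0 + s)
              + 0 * flagged p \<phi> (Suc n) (0 + s)"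
            by (simp add: s eqs)
          then have "flagged p \<phi> (s + Suc n) 0 = xvar m * flagged ?p \<phi> (s + Suc n) 0
              + 0 * flagged p \<phi> (s + Suc n) 0"
          proof (rule flagged_linear)
            show "?p r = p r \<and> p r = p r \<and> \<phi> r = \<phi> r \<and> \<phi> r = \<phi> r" if "r \<le> 0 + s" for r
              using agree[OF that] by simp
            show "swap_vars i (xvar m) = xvar m \<and> swap_vars i 0 = 0"
              if "r \<le> 0 + s" "i < \<phi> r" for r i
              using invariant[of r i] that by simp
          qed
          then have "flagged p \<phi> k 0 = xvar m * flagged ?p \<phi> k 0 + (1 - xvar m) * 0"
            using n by simp
          moreover have "fillings lowered J b = {}"
          proof -
            have False if "U \<in> column lowered h \<rho>" for U \<rho>
            proof -
              have "U \<subseteq> {1..m - 1}" using that by (simp add: column_def)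
              then have "U \<subseteq> {1..h - 1}" unfolding eqs(1) .
              then have "card U \<le> h - 1" using card_mono[of "{1..h - 1}" U] by simp
              then show False using column_card[OF that] h1 by simp
            qed
            then show ?thesis using j0 unfolding fillings_def by fastforce
          qed
          moreover have "alternating N 0" for N by (simp add: alternating_def)
          ultimately show ?thesis by (intro exI[of _ 0]) simp
        qed
        then obtain f2 where f: "flagged p \<phi> k 0 = xvar m * flagged ?p \<phi> k 0 + (1 - xvar m) * f2"
          and alt: "alternating (Suc (\<Sum>r = 1..k. ?p r)) f2"
          and f2: "\<And>q. coefficient f2 q \<noteq> 0 \<longleftrightarrow> Poly_Mapping.lookup q \<in> fillings lowered J b"
          unfolding sum by blast
        note trans = alternating_transition[OF f conjunct1[OF IHp[OF j0]] alt]
        have "coefficient (flagged p \<phi> k 0) q \<noteq> 0 \<longleftrightarrow> Poly_Mapping.lookup q \<in> fillings \<phi> J b" for q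
        proof
          assume "coefficient (flagged p \<phi> k 0) q \<noteq> 0"
          then consider r where "q = r + Poly_Mapping.single m 1" "coefficient (flagged ?p \<phi> k 0) r \<noteq> 0"
            | "coefficient f2 q \<noteq> 0"
            | r where "q = r + Poly_Mapping.single m 1" "coefficient f2 r \<noteq> 0"
            unfolding trans(2) by blast
          then show "Poly_Mapping.lookup q \<in> fillings \<phi> J b"
          proof cases
            case 1
            then have "Poly_Mapping.lookup r \<in> fillings \<phi> J (b(j0 := h - 1))" using IHp[OF j0] by blast
            then show ?thesis unfolding 1(1) lookup_ext by (rule fillings_extend[where b = b, OF J j0])
          next
            case 2
            then show ?thesis using fillings_lowered_subset[of J b] bk f2 by blast
          next
            case 3
            then have "Poly_Mapping.lookup r \<in> fillings lowered J b" using f2 by blast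
            then show ?thesis
              unfolding 3(1) lookup_ext using fillings_raise[where b = b, OF J j0] bk by blast
          qed
        next
          assume q: "Poly_Mapping.lookup q \<in> fillings \<phi> J b"
          show "coefficient (flagged p \<phi> k 0) q \<noteq> 0"
            unfolding trans(2)
          proof (rule fillings_cases[where b = b, OF J _ q])
            show "b j \<le> k" if "j \<in> J" for j by (rule bk[OF that])
          next
            fix j q' assume j: "j \<in> J" "b j = h" and q': "q' \<in> fillings \<phi> J (b(j := h - 1))"
              and eq: "\<And>l. Poly_Mapping.lookup q l = q' l + of_bool (l = m)"
            obtain r where "q = r + Poly_Mapping.single m 1" "Poly_Mapping.lookup r = q'"
              using split[OF eq] by blast
            then show "(\<exists>r. q = r + Poly_Mapping.single m 1 \<and> coefficient (flagged ?p \<phi> k 0) r \<noteq> 0) \<or>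
              coefficient f2 q \<noteq> 0 \<or> (\<exists>r. q = r + Poly_Mapping.single m 1 \<and> coefficient f2 r \<noteq> 0)"
              using IHp[OF j] q' by blast
          next
            fix j q' assume q': "q' \<in> fillings lowered J b"
              and eq: "\<And>l. Poly_Mapping.lookup q l = q' l + of_bool (l = m)"
            obtain r where "q = r + Poly_Mapping.single m 1" "Poly_Mapping.lookup r = q'"
              using split[OF eq] by blast
            then show "(\<exists>r. q = r + Poly_Mapping.single m 1 \<and> coefficient (flagged ?p \<phi> k 0) r \<noteq> 0) \<or>
              coefficient f2 q \<noteq> 0 \<or> (\<exists>r. q = r + Poly_Mapping.single m 1 \<and> coefficient f2 r \<noteq> 0)"
              using f2 q' by blast
          next
            assume "Poly_Mapping.lookup q \<in> fillings lowered J b"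
            then show "(\<exists>r. q = r + Poly_Mapping.single m 1 \<and> coefficient (flagged ?p \<phi> k 0) r \<noteq> 0) \<or>
              coefficient f2 q \<noteq> 0 \<or> (\<exists>r. q = r + Poly_Mapping.single m 1 \<and> coefficient f2 r \<noteq> 0)"
              using f2 by blast
          qed
        qed
        then show ?thesis using trans(1) unfolding sum by blast
      qed
    qed
  qed
qed

section \<open>The interval property\<close>

lemma fillings_interval:
  assumes J: "finite J" and \<phi>: "\<phi> 0 = 0" "\<And>j r s. j \<in> J \<Longrightarrow> r \<le> s \<Longrightarrow> s \<le> b j \<Longrightarrow> \<phi> r \<le> \<phi> s"
    and "\<alpha> \<in> fillings \<phi> J b" "\<gamma> \<in> fillings \<phi> J b" "\<And>l. \<alpha> l \<le> q l" "\<And>l. q l \<le> \<gamma> l"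
  shows "q \<in> fillings \<phi> J b"
proof -
  obtain V \<sigma> where V: "\<And>j. j \<in> J \<Longrightarrow> V j \<in> column \<phi> (b j) (\<sigma> j)" "\<alpha> = weight J V"
    using assms(4) by (rule fillingsE) blast
  obtain U \<rho> where U: "\<And>j. j \<in> J \<Longrightarrow> U j \<in> column \<phi> (b j) (\<rho> j)" "\<gamma> = weight J U"
    and R: "\<And>i j. i \<in> J \<Longrightarrow> j \<in> J \<Longrightarrow> \<rho> i = \<rho> j \<Longrightarrow> \<rho> i \<noteq> 0 \<Longrightarrow> i = j"
    using assms(5) by (rule fillingsE) blast
  \<comment> \<open>Only bases are kept from \<open>\<alpha>\<close>: its labels
    \<open>\<sigma>\<close> may conflict with the labels \<open>\<rho>\<close> of
    \<open>\<gamma>\<close>, but a base fits every label.\<close>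
  have "\<forall>j\<in>J. \<exists>B. B \<subseteq> V j \<and> B \<in> column \<phi> (b j) 0"
    using column_base_subset[of \<phi>, OF \<phi>(1) V(1)] by blast
  then obtain B where B: "\<And>j. j \<in> J \<Longrightarrow> B j \<subseteq> V j" "\<And>j. j \<in> J \<Longrightarrow> B j \<in> column \<phi> (b j) 0"
    by metis
  have "weight J B l \<le> q l" for l
    using weight_mono[of J B V l] B(1) V(2) assms(6)[of l] by force
  moreover have "q l \<le> weight J U l" for l using assms(7) U(2) by simp
  ultimately have "\<exists>W. (\<forall>j\<in>J. W j \<in> column \<phi> (b j) (\<rho> j)) \<and> weight J W = q"
    using \<phi> by (intro columns_interval[where \<phi> = \<phi> and B = B and U = U] J U(1) B(2))
  then obtain W where W: "\<And>j. j \<in> J \<Longrightarrow> W j \<in> column \<phi> (b j) (\<rho> j)" "weight J W = q" by blast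
  show ?thesis by (rule fillingsI[of J W _ _ \<rho>]) (use W R in auto)
qed

theorem theorem3p4:
  fixes n :: nat and w :: "nat \<Rightarrow> nat" and p1 p2 q :: expvec
  assumes "w permutes {1..n}" and "vexillary n w"
    and "Poly_Mapping.keys p1 \<subseteq> {1..n}" and "coefficient (grothendieck n w) p1 \<noteq> 0"
    and "Poly_Mapping.keys p2 \<subseteq> {1..n}" and "coefficient (grothendieck n w) p2 \<noteq> 0"
    and "monomial p1 dvd monomial p2"
    and "Poly_Mapping.keys q \<subseteq> {1..n}"
    and "monomial p1 dvd monomial q" and "monomial q dvd monomial p2"
  shows "coefficient (grothendieck n w) q \<noteq> 0"
proof -
  obtain p' \<phi>' k where gw: "grothendieck n w = flagged p' \<phi>' k 0"
    and anti': "\<And>r s. 0 < r \<Longrightarrow> r \<le> s \<Longrightarrow> s \<le> k \<Longrightarrow> p' s \<le> p' r"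
    and mono': "\<And>r s. 0 < r \<Longrightarrow> r \<le> s \<Longrightarrow> s \<le> k \<Longrightarrow> \<phi>' r \<le> \<phi>' s"
    and ge': "\<And>r. 0 < r \<Longrightarrow> r \<le> k \<Longrightarrow> r \<le> \<phi>' r"
    using vexillary_flagged[OF assms(1,2)] by blast
  \<comment> \<open>\<open>flagged\<close> reads only the rows 1 to \<open>k\<close>, so
    \<open>p\<close> may be cut off after \<open>k\<close> and \<open>\<phi> 0\<close> set to 0, as
    \<open>flagged_support\<close> requires.\<close>
  define p \<phi> where "p r = (if r \<le> k then p' r else 0)" and "\<phi> r = (if r = 0 then 0 else \<phi>' r)" for r
  have gw: "grothendieck n w = flagged p \<phi> k 0"
    unfolding gw by (rule flagged_cong) (auto simp: p_def \<phi>_def)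
  have anti: "p s \<le> p r" if "1 \<le> r" "r \<le> s" for r s
    using anti'[of r s] that by (auto simp: p_def)
  have mono: "\<phi> r \<le> \<phi> s" if "r \<le> s" "s \<le> k" for r s
    using mono'[of r s] that by (auto simp: \<phi>_def)
  \<comment> \<open>The conjugate partition; columns are counted from 0, so column \<open>j\<close>
    reaches row \<open>r\<close> iff \<open>j < p r\<close>.\<close>
  define b where "b j = card {r \<in> {1..k}. j < p r}" for j
  let ?J = "{..<p 1}"
  have b_iff: "r \<le> b j \<longleftrightarrow> j < p r" if "1 \<le> r" for r j
  proof
    assume "j < p r"
    have "x \<in> {1..k} \<and> j < p x" if "x \<in> {1..r}" for x
    proof -
      have "j < p x" using anti[of x r] that \<open>j < p r\<close> by simp
      then show ?thesis using that by (simp add: p_def split: if_splits)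
    qed
    then have "{1..r} \<subseteq> {r \<in> {1..k}. j < p r}" by blast
    from card_mono[OF _ this] show "r \<le> b j" by (simp add: b_def)
  next
    assume "r \<le> b j"
    show "j < p r"
    proof (rule ccontr)
      assume "\<not> j < p r"
      then have "x < r" if "j < p x" for x using anti[of r x] \<open>1 \<le> r\<close> that by (meson leD le_less_trans not_le less_le_trans)
      then have "{r \<in> {1..k}. j < p r} \<subseteq> {1..<r}" by auto
      from card_mono[OF _ this] show False using \<open>r \<le> b j\<close> \<open>1 \<le> r\<close> by (simp add: b_def)
    qed
  qed
  have shape: "card {j \<in> ?J. r \<le> b j} = p r" if "1 \<le> r" for r
  proof -
    have "p r \<le> p 1" using anti[of 1 r] that by simp
    then have "{j \<in> ?J. r \<le> b j} = {..<p r}" unfolding b_iff[OF that] by auto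
    then show ?thesis by simp
  qed
  have "\<forall>q. coefficient (grothendieck n w) q \<noteq> 0 \<longleftrightarrow> Poly_Mapping.lookup q \<in> fillings \<phi> ?J b"
    unfolding gw
  proof (rule flagged_support[THEN conjunct2])
    show "r \<le> \<phi> r" if "r \<le> k" for r using ge'[of r] that by (auto simp: \<phi>_def)
    show "p r = 0" if "k < r" for r using that by (simp add: p_def)
  qed (use mono anti shape in \<open>simp_all add: \<phi>_def\<close>)
  then have support: "coefficient (grothendieck n w) q \<noteq> 0 \<longleftrightarrow> Poly_Mapping.lookup q \<in> fillings \<phi> ?J b" for q
    by blast
  have bk: "b j \<le> k" for j
  proof -
    have "{r \<in> {1..k}. j < p r} \<subseteq> {1..k}" by blast
    from card_mono[OF _ this] show ?thesis by (simp add: b_def)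
  qed
  have "Poly_Mapping.lookup q \<in> fillings \<phi> ?J b"
  proof (rule fillings_interval)
    show "Poly_Mapping.lookup p1 \<in> fillings \<phi> ?J b" "Poly_Mapping.lookup p2 \<in> fillings \<phi> ?J b"
      using assms(4,6) support by blast+
    show "Poly_Mapping.lookup p1 l \<le> Poly_Mapping.lookup q l" "Poly_Mapping.lookup q l \<le> Poly_Mapping.lookup p2 l" for l
      using assms(9,10) by (auto intro: monomial_dvd_imp_le)
    show "\<phi> r \<le> \<phi> s" if "r \<le> s" "s \<le> b j" for j r s using mono[of r s] bk[of j] that by simp
  qed (auto simp: \<phi>_def)
  then show ?thesis using support by blast
qed

end
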